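(* Let $J$ be an integer and let $\mathsf{N}_j$, $j\ge J$, be $d\times d$ real-valued invertible matrices. Let $\mathbf{\Phi}=\{\boldsymbol\varphi^1,\ldots,\boldsymbol\varphi^r\}$ and $\mathbf{\Psi}_j=\{\boldsymbol\psi^{j,1},\ldots,\boldsymbol\psi^{j,s_j}\}$, with $r,s_j\in\mathbb{N}\cup\{0,+\infty\}$, be subsets of $\mathscr{D}'(\mathbb{R}^d)$ for all $j\ge J$. Then the following statements are equivalent: (i) $\mathsf{FWS}_J(\mathbf{\Phi};\{\mathbf{\Psi}_j\}_{j=J}^\infty)$ is a frequency-based nonstationary tight wavelet frame in $L_2(\mathbb{R}^d)$, that is, $\mathbf{\Phi},\mathbf{\Psi}_j\subseteq L_2(\mathbb{R}^d)$ for all $j\ge J$ and $$\sum_{\boldsymbol\varphi\in\mathbf{\Phi}}\sum_{k\in\mathbb{Z}^d}|\langle\mathbf{f},\boldsymbol\varphi_{\mathsf{N}_J;0,k}\rangle|^2+\sum_{j=J}^\infty\sum_{\boldsymbol\psi\in\mathbf{\Psi}_j}\sum_{k\in\mathbb{Z}^d}|\langle\mathbf{f},\boldsymbol\psi_{\mathsf{N}_j;0,k}\rangle|^2=(2\pi)^d\|\mathbf{f}\|^2_{L_2(\mathbb{R}^d)},\qquad\forall\mathbf{f}\in L_2(\mathbb{R}^d);$$ (ii) $(\mathsf{FWS}_J(\mathbf{\Phi};\{\mathbf{\Psi}_j\}_{j=J}^\infty),\mathsf{FWS}_J(\mathbf{\Phi};\{\mathbf{\Psi}_j\}_{j=J}^\infty))$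 is a pair of frequency-based nonstationary dual wavelet frames in the distribution space $\mathscr{D}'(\mathbb{R}^d)$. If in addition $\Lambda:=\bigcup_{j=J}^\infty[\mathsf{N}_j^{-1}\mathbb{Z}^d]$ has no accumulation point and $\lim_{j\to+\infty}\|\mathsf{N}_jk\|=0$ for all $k\in\Lambda$, and all $\mathbf{\Phi},\mathbf{\Psi}_j$, $j\ge J$, are finite subsets of $L_2^{loc}(\mathbb{R}^d)$, then each of the statements (i) and (ii) is also equivalent to (iii) one has $$\lim_{J'\to+\infty}\Big\langle\mathcal{I}^0_{\mathbf{\Phi}}(\mathsf{N}_J\cdot)+\sum_{j=J}^{J'-1}\mathcal{I}^0_{\mathbf{\Psi}_j}(\mathsf{N}_j\cdot),\mathbf{h}\Big\rangle=\langle1,\mathbf{h}\rangle\qquad\forall\mathbf{h}\in\mathscr{D}(\mathbb{R}^d)$$ and $$\mathcal{I}^{\mathsf{N}_Jk}_{\mathbf{\Phi}}(\mathsf{N}_J\xi)+\sum_{j=J}^\infty\mathcal{I}^{\mathsf{N}_jk}_{\mathbf{\Psi}_j}(\mathsf{N}_j\xi)=0,\qquad\text{a.e. }\xi\in\mathbb{R}^d,\ k\in\Lambda\setminus\{0\},$$ where $\mathcal{I}^k_{\mathbf{\Phi}}(\xi):=\sum_{\ell=1}^r\overline{\boldsymbol\varphi^\ell(\xi)}\boldsymbol\varphi^\ell(\xi+2\pi k)$ and $\mathcal{I}^k_{\mathbf{\Psi}_j}(\xi):=\sum_{\ell=1}^{s_j}\overline{\boldsymbol\psi^{j,\ell}(\xi)}\boldsymbol\psi^{j,\ell}(\xi+2\pi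 k)$ for $k\in\mathbb{Z}^d$, and $\mathcal{I}^k_{\mathbf{\Phi}}:=0$, $\mathcal{I}^k_{\mathbf{\Psi}_j}:=0$ for $k\in\mathbb{R}^d\setminus\mathbb{Z}^d$.
   Context: $\mathscr{D}(\mathbb{R}^d)$ is the space of compactly supported $C^\infty$ functions and $\mathscr{D}'(\mathbb{R}^d)$ its dual. $L_2^{loc}(\mathbb{R}^d)$ is the space of measurable functions square integrable on every compact set. For a function $f$, real invertible $U$ and $k\in\mathbb{R}^d$, $f_{U;0,k}(\xi):=|\det U|^{1/2}e^{-ik\cdot U\xi}f(U\xi)$, extended to distributions by duality. For $\mathbf{f}\in\mathscr{D}(\mathbb{R}^d)$ and $\boldsymbol\psi\in\mathscr{D}'(\mathbb{R}^d)$: $\langle\boldsymbol\psi,\mathbf{f}\rangle:=\boldsymbol\psi(\overline{\mathbf{f}})$ and $\langle\mathbf{f},\boldsymbol\psi\rangle:=\overline{\langle\boldsymbol\psi,\mathbf{f}\rangle}$ (so $\langle\mathbf{f},\boldsymbol\psi\rangle=\int\mathbf{f}\,\overline{\boldsymbol\psi}$ when $\boldsymbol\psi$ is locally integrable). Sets of generators are counted with multiplicity. Define $$\mathsf{FWS}_J(\mathbf{\Phi};\{\mathbf{\Psi}_j\}_{j=J}^\infty)=\{\boldsymbol\varphi_{\mathsf{N}_J;0,k}:k\in\mathbb{Z}^d,\boldsymbol\varphi\in\mathbf{\Phi}\}\cup\bigcup_{j=J}^\infty\{\boldsymbol\psi_{\mathsf{N}_j;0,k}:k\in\mathbb{Z}^d,\boldsymbol\psi\in\mathbf{\Psi}_j\}.$$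 For generators $\boldsymbol\varphi^\ell,\tilde{\boldsymbol\varphi}^\ell$ ($1\le\ell\le r$) in $\mathbf{\Phi},\tilde{\mathbf{\Phi}}$ and $\boldsymbol\psi^{j,\ell},\tilde{\boldsymbol\psi}^{j,\ell}$ ($1\le\ell\le s_j$) in $\mathbf{\Psi}_j,\tilde{\mathbf{\Psi}}_j$, the pair $(\mathsf{FWS}_J(\mathbf{\Phi};\{\mathbf{\Psi}_j\}_{j=J}^\infty),\mathsf{FWS}_J(\tilde{\mathbf{\Phi}};\{\tilde{\mathbf{\Psi}}_j\}_{j=J}^\infty))$ is a pair of frequency-based nonstationary dual wavelet frames in the distribution space $\mathscr{D}'(\mathbb{R}^d)$ if for all $\mathbf{f},\mathbf{g}\in\mathscr{D}(\mathbb{R}^d)$: (1) the series $\sum_{\ell=1}^r\sum_{k\in\mathbb{Z}^d}\langle\mathbf{f},\boldsymbol\varphi^\ell_{\mathsf{N}_J;0,k}\rangle\langle\tilde{\boldsymbol\varphi}^\ell_{\mathsf{N}_J;0,k},\mathbf{g}\rangle$ and $\sum_{\ell=1}^{s_j}\sum_{k\in\mathbb{Z}^d}\langle\mathbf{f},\boldsymbol\psi^{j,\ell}_{\mathsf{N}_j;0,k}\rangle\langle\tilde{\boldsymbol\psi}^{j,\ell}_{\mathsf{N}_j;0,k},\mathbf{g}\rangle$ converge absolutely for all integers $j\ge J$; and (2) the following limit exists and $$\lim_{J'\to+\infty}\Big(\sum_{\ell=1}^r\sum_{k\in\mathbb{Z}^d}\langle\mathbf{f},\boldsymbol\varphi^\ell_{\mathsf{N}_J;0,k}\rangle\langle\tilde{\boldsymbol\varphi}^\ell_{\mathsf{N}_J;0,k},\mathbf{g}\rangle+\sum_{j=J}^{J'-1}\sum_{\ell=1}^{s_j}\sum_{k\in\mathbb{Z}^d}\langle\mathbf{f},\boldsymbol\psi^{j,\ell}_{\mathsf{N}_j;0,k}\rangle\langle\tilde{\boldsymbol\psi}^{j,\ell}_{\mathsf{N}_j;0,k},\mathbf{g}\rangle\Big)=(2\pi)^d\langle\mathbf{f},\mathbf{g}\rangle.$$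 *)

theory Defs
  imports "HOL-Analysis.Analysis"
begin

type_synonym 'd cfun = "real ^ 'd \<Rightarrow> complex"
type_synonym 'd functional = "'d cfun \<Rightarrow> complex"

subsection \<open>Test functions and distributions\<close>

primrec iter_pderiv :: "'d list \<Rightarrow> 'd::finite cfun \<Rightarrow> 'd cfun" where
  "iter_pderiv [] f = f"
| "iter_pderiv (i # is) f = (\<lambda>x. frechet_derivative (iter_pderiv is f) (at x) (axis i 1))"

definition test_fun :: "'d::finite cfun \<Rightarrow> bool" where
  "test_fun f \<longleftrightarrow> (\<forall>is. iter_pderiv is f differentiable_on UNIV) \<and> compact (closure {x. f x \<noteq> 0})"

text \<open>
  A distribution is a functional whose restriction to the test functions is linear and continuous
  for the usual inductive limit topology; continuity is expressed by the seminorm estimates on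
  each compact set. The values of the functional outside the test functions are irrelevant.
\<close>

definition distribution :: "'d::finite functional \<Rightarrow> bool" where
  "distribution T \<longleftrightarrow>
     (\<forall>f g. test_fun f \<longrightarrow> test_fun g \<longrightarrow> T (\<lambda>x. f x + g x) = T f + T g) \<and>
     (\<forall>c f. test_fun f \<longrightarrow> T (\<lambda>x. c * f x) = c * T f) \<and>
     (\<forall>K. compact K \<longrightarrow> (\<exists>C n. \<forall>f. test_fun f \<longrightarrow> {x. f x \<noteq> 0} \<subseteq> K \<longrightarrow>
        cmod (T f) \<le> C * (\<Sum>is | length is \<le> n. SUP x. cmod (iter_pderiv is f x))))"

definition pair_dist_fun :: "'d::finite functional \<Rightarrow> 'd cfun \<Rightarrow> complex" where
  "pair_dist_fun T f = T (\<lambda>x. cnj (f x))"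

definition pair_fun_dist :: "'d::finite cfun \<Rightarrow> 'd functional \<Rightarrow> complex" where
  "pair_fun_dist f T = cnj (pair_dist_fun T f)"

definition pair_fun :: "'d::finite cfun \<Rightarrow> 'd cfun \<Rightarrow> complex" where
  "pair_fun f g = (LINT x|lebesgue. f x * cnj (g x))"

text \<open>
  Measurability is Lebesgue measurability throughout. A function is the chosen representative of
  its almost-everywhere class; no definition below depends on this choice.
\<close>

definition L2 :: "'d::finite cfun \<Rightarrow> bool" where
  "L2 f \<longleftrightarrow> f \<in> borel_measurable lebesgue \<and> integrable lebesgue (\<lambda>x. (cmod (f x))\<^sup>2)"

definition L2_loc :: "'d::finite cfun \<Rightarrow> bool" where
  "L2_loc f \<longleftrightarrow> f \<in> borel_measurable lebesgue \<and>
     (\<forall>K. compact K \<longrightarrow> set_integrable lebesgue K (\<lambda>x. (cmod (f x))\<^sup>2))"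

text \<open>The identification of a (locally integrable) function with a distribution.\<close>

definition represents :: "'d::finite cfun \<Rightarrow> 'd functional \<Rightarrow> bool" where
  "represents g T \<longleftrightarrow> (\<forall>f. test_fun f \<longrightarrow> T f = (LINT x|lebesgue. g x * f x))"

subsection \<open>Modulated dilations\<close>

definition fun_dil :: "real ^ 'd ^ 'd \<Rightarrow> real ^ 'd \<Rightarrow> 'd::finite cfun \<Rightarrow> 'd cfun" where
  "fun_dil U k f = (\<lambda>\<xi>. of_real (sqrt \<bar>det U\<bar>) * exp (- \<i> * of_real (k \<bullet> (U *v \<xi>))) * f (U *v \<xi>))"

text \<open>
  The extension to distributions by duality: the function the functional is applied to arises from
  integrating \<open>fun_dil U k g\<close> against \<open>f\<close> and substituting \<open>\<eta> = U \<xi>\<close>, whose Jacobian contributes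
  the factor \<open>1 / \<bar>det U\<bar>\<close>. It is intended for invertible \<open>U\<close>.
\<close>

definition dist_dil :: "real ^ 'd ^ 'd \<Rightarrow> real ^ 'd \<Rightarrow> 'd::finite functional \<Rightarrow> 'd functional" where
  "dist_dil U k T = (\<lambda>f. T (\<lambda>\<eta>. of_real (1 / sqrt \<bar>det U\<bar>) * exp (- \<i> * of_real (k \<bullet> \<eta>))
                              * f (matrix_inv U *v \<eta>)))"

subsection \<open>Frequency-based nonstationary wavelet frames\<close>

definition Zd :: "(real ^ 'd::finite) set" where
  "Zd = {k. \<forall>i. k $ i \<in> \<int>}"

text \<open>
  Generators are counted with multiplicity, so a generating set with \<open>r \<in> \<nat> \<union> {0, \<infinity>}\<close> members is
  a family indexed by the natural numbers below \<open>r\<close>.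
\<close>

definition idx :: "enat \<Rightarrow> nat set" where
  "idx r = {l. enat l < r}"

definition tight_wavelet_frame ::
  "int \<Rightarrow> (int \<Rightarrow> real ^ 'd ^ 'd) \<Rightarrow> enat \<Rightarrow> (nat \<Rightarrow> 'd::finite functional) \<Rightarrow>
   (int \<Rightarrow> enat) \<Rightarrow> (int \<Rightarrow> nat \<Rightarrow> 'd functional) \<Rightarrow> bool" where
  "tight_wavelet_frame J N r \<Phi> s \<Psi> \<longleftrightarrow>
     (\<exists>\<phi> \<psi>.
        (\<forall>l\<in>idx r. L2 (\<phi> l) \<and> represents (\<phi> l) (\<Phi> l)) \<and>
        (\<forall>j\<ge>J. \<forall>l\<in>idx (s j). L2 (\<psi> j l) \<and> represents (\<psi> j l) (\<Psi> j l)) \<and>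
        (\<forall>f. L2 f \<longrightarrow>
           (\<Sum>\<^sub>\<infinity>l\<in>idx r. \<Sum>\<^sub>\<infinity>k\<in>Zd. ennreal ((cmod (pair_fun f (fun_dil (N J) k (\<phi> l))))\<^sup>2))
           + (\<Sum>\<^sub>\<infinity>j\<in>{J..}. \<Sum>\<^sub>\<infinity>l\<in>idx (s j). \<Sum>\<^sub>\<infinity>k\<in>Zd.
                ennreal ((cmod (pair_fun f (fun_dil (N j) k (\<psi> j l))))\<^sup>2))
           = ennreal ((2 * pi) ^ CARD('d) * (LINT x|lebesgue. (cmod (f x))\<^sup>2))))"

definition dual_term ::
  "real ^ 'd ^ 'd \<Rightarrow> (nat \<Rightarrow> 'd functional) \<Rightarrow> (nat \<Rightarrow> 'd functional) \<Rightarrow>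
   'd::finite cfun \<Rightarrow> 'd cfun \<Rightarrow> nat \<times> (real ^ 'd) \<Rightarrow> complex" where
  "dual_term U \<Phi> \<Phi>' f g = (\<lambda>(l, k).
     pair_fun_dist f (dist_dil U k (\<Phi> l)) * pair_dist_fun (dist_dil U k (\<Phi>' l)) g)"

definition dual_wavelet_frames ::
  "int \<Rightarrow> (int \<Rightarrow> real ^ 'd ^ 'd) \<Rightarrow> enat \<Rightarrow> (nat \<Rightarrow> 'd::finite functional) \<Rightarrow> (nat \<Rightarrow> 'd functional) \<Rightarrow>
   (int \<Rightarrow> enat) \<Rightarrow> (int \<Rightarrow> nat \<Rightarrow> 'd functional) \<Rightarrow> (int \<Rightarrow> nat \<Rightarrow> 'd functional) \<Rightarrow> bool" where
  "dual_wavelet_frames J N r \<Phi> \<Phi>' s \<Psi> \<Psi>' \<longleftrightarrow>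
     (\<forall>f g. test_fun f \<longrightarrow> test_fun g \<longrightarrow>
        (\<lambda>p. norm (dual_term (N J) \<Phi> \<Phi>' f g p)) summable_on idx r \<times> Zd \<and>
        (\<forall>j\<ge>J. (\<lambda>p. norm (dual_term (N j) (\<Psi> j) (\<Psi>' j) f g p)) summable_on idx (s j) \<times> Zd) \<and>
        ((\<lambda>J'. (\<Sum>\<^sub>\<infinity>p\<in>idx r \<times> Zd. dual_term (N J) \<Phi> \<Phi>' f g p)
              + (\<Sum>j\<in>{J..<J'}. \<Sum>\<^sub>\<infinity>p\<in>idx (s j) \<times> Zd. dual_term (N j) (\<Psi> j) (\<Psi>' j) f g p))
         \<longlongrightarrow> (2 * pi) ^ CARD('d) * pair_fun f g) at_top)"

definition I_op :: "enat \<Rightarrow> (nat \<Rightarrow> 'd::finite cfun) \<Rightarrow> real ^ 'd \<Rightarrow> 'd cfun" where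
  "I_op r \<phi> k = (\<lambda>\<xi>. if k \<in> Zd then \<Sum>l\<in>idx r. cnj (\<phi> l \<xi>) * \<phi> l (\<xi> + (2 * pi) *\<^sub>R k) else 0)"

definition Lam :: "int \<Rightarrow> (int \<Rightarrow> real ^ 'd ^ 'd) \<Rightarrow> (real ^ 'd::finite) set" where
  "Lam J N = (\<Union>j\<in>{J..}. (\<lambda>k. matrix_inv (N j) *v k) ` Zd)"

text \<open>
  Here \<open>\<phi>\<close> and \<open>\<psi>\<close> are functions, not distributions. The series over \<open>j\<close> in the second part is read,
  like the one in the first part, as a limit of partial sums.
\<close>

definition fiber_conditions ::
  "int \<Rightarrow> (int \<Rightarrow> real ^ 'd ^ 'd) \<Rightarrow> enat \<Rightarrow> (nat \<Rightarrow> 'd::finite cfun) \<Rightarrow>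
   (int \<Rightarrow> enat) \<Rightarrow> (int \<Rightarrow> nat \<Rightarrow> 'd cfun) \<Rightarrow> bool" where
  "fiber_conditions J N r \<phi> s \<psi> \<longleftrightarrow>
     (\<forall>h. test_fun h \<longrightarrow>
        ((\<lambda>J'. pair_fun (\<lambda>\<xi>. I_op r \<phi> 0 (N J *v \<xi>) + (\<Sum>j\<in>{J..<J'}. I_op (s j) (\<psi> j) 0 (N j *v \<xi>))) h)
         \<longlongrightarrow> pair_fun (\<lambda>\<xi>. 1) h) at_top) \<and>
     (\<forall>k\<in>Lam J N - {0}. AE \<xi> in lebesgue.
        ((\<lambda>J'. I_op r \<phi> (N J *v k) (N J *v \<xi>) + (\<Sum>j\<in>{J..<J'}. I_op (s j) (\<psi> j) (N j *v k) (N j *v \<xi>)))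
         \<longlongrightarrow> 0) at_top)"

end

theory Submission
  imports Defs
begin

text \<open>
  Put \<open>c = (2 \<pi>)\<^sup>d\<close>, and treat the generators \<open>\<Phi>\<close> as one more level \<open>J - 1\<close> below the levels
  \<open>j \<ge> J\<close>, with the matrix \<open>N J\<close> repeated there (\<open>prepend\<close>). Each of the three conditions then speaks
  of one family of levels, and the sum over \<open>\<Phi>\<close> is the first term of the sum over levels.

  Tight frames and dual frames are both equivalent to the identity \<open>\<Sum> |\<langle>f, \<eta>\<rangle>|\<^sup>2 = c \<parallel>f\<parallel>\<^sup>2\<close>,
  summed over all shifted and dilated generators \<open>\<eta>\<close>, for test functions \<open>f\<close> only. For dual frames
  (\<open>dual_iff_test\<close>), taking \<open>f = g\<close> makes all terms nonnegative, so that the limit over levels is an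
  unordered sum; in the other direction polarization recovers the sesquilinear identity together with
  absolute convergence. For tight frames (\<open>tight_iff_test\<close>), each single term of the identity is
  at most \<open>c \<parallel>f\<parallel>\<^sup>2\<close>, so every generator is bounded in the \<open>L\<^sub>2\<close> norm on test functions and
  is therefore an \<open>L\<^sub>2\<close> function (\<open>Riesz_test\<close>); the identity then extends to all of \<open>L\<^sub>2\<close> because
  test functions are dense (\<open>frame_extend\<close>).

  For the third condition, let \<open>U = N j\<close>. Up to the factor \<open>|det U|\<^sup>-\<^sup>1\<^sup>/\<^sup>2\<close>, the numbers
  \<open>\<langle>f, \<phi>\<^bsub>U;0,k\<^esub>\<rangle>\<close> are the Fourier coefficients of the compactly supported function
  \<open>f(U\<^sup>-\<^sup>1 \<cdot>) cnj \<phi>\<close>. Parseval's identity for the periodizations, on the cube with side \<open>2 \<pi>\<close>,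
  turns the sum over \<open>k\<close> into
  \<open>c \<Sum>\<^sub>\<kappa> \<integral> f(\<xi>) cnj (g(\<xi> + 2 \<pi> \<kappa>)) I\<^bsup>U \<kappa>\<^esup>(U \<xi>) d\<xi>\<close> (\<open>dual_term_has_sum\<close>), where \<open>\<kappa>\<close> runs
  through \<open>U\<^sup>-\<^sup>1 \<int>\<^sup>d\<close>. As \<open>\<Lambda>\<close> has no accumulation point, only finitely many \<open>\<kappa>\<close> count for
  given \<open>f\<close> and \<open>g\<close>, and a single \<open>\<kappa>\<close> is isolated by functions supported in a small box.

  If the fiber conditions hold, the limit over levels is taken separately for each \<open>\<kappa>\<close>
  (\<open>fiber_limit_imp_dual_limit\<close>). For the converse, note that for \<open>\<kappa> \<noteq> 0\<close> the vectors \<open>N j \<kappa>\<close> are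
  nonzero and eventually shorter than every nonzero lattice vector, so that the sum over levels is
  eventually constant; its integrals over all small boxes vanish, and so it vanishes almost everywhere
  (\<open>dual_limit_imp_off_diagonal\<close>). For \<open>\<kappa> = 0\<close> the partial sums are nonnegative and increasing, so
  monotone convergence over small boxes shows that they increase to \<open>1\<close> almost everywhere
  (\<open>dual_limit_imp_mass_one\<close>), and dominated convergence gives the limit against every test function.
\<close>

section \<open>Smooth functions\<close>

abbreviation partial_deriv :: "'d::finite \<Rightarrow> 'd cfun \<Rightarrow> 'd cfun" where
  "partial_deriv i f \<equiv> (\<lambda>x. frechet_derivative f (at x) (axis i 1))"

definition smooth :: "'d::finite cfun \<Rightarrow> bool" where
  "smooth f \<longleftrightarrow> (\<forall>is. iter_pderiv is f differentiable_on UNIV)"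

lemma smooth_coinduct:
  assumes "P f" and "\<And>f. P f \<Longrightarrow> f differentiable_on UNIV" and "\<And>f i. P f \<Longrightarrow> P (partial_deriv i f)"
  shows "smooth f"
proof -
  have "P (iter_pderiv is f)" for "is"
    by (induction "is") (use assms in auto)
  then show ?thesis using assms(2) by (simp add: smooth_def)
qed

lemma iter_pderiv_snoc: "iter_pderiv (is @ [i]) f = iter_pderiv is (partial_deriv i f)"
  by (induction "is") auto

lemma smooth_partial_deriv: "smooth f \<Longrightarrow> smooth (partial_deriv i f)"
  unfolding smooth_def by (metis iter_pderiv_snoc)

lemma smooth_diff_on: "smooth f \<Longrightarrow> f differentiable_on UNIV"
  unfolding smooth_def by (metis iter_pderiv.simps(1))

lemma smooth_diff: "smooth f \<Longrightarrow> f differentiable (at x)"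
  using smooth_diff_on by (auto simp: differentiable_on_def)

lemma test_fun_iff: "test_fun f \<longleftrightarrow> smooth f \<and> bounded {x. f x \<noteq> 0}"
  by (simp add: test_fun_def smooth_def)

text \<open>
  The smoothness proofs below share one pattern: a set \<open>S\<close> of functions whose partial derivatives are
  polynomial expressions in members of \<open>S\<close> consists of smooth functions. The predicate collects these
  polynomial expressions.
\<close>

inductive generated_algebra :: "('d::finite cfun \<Rightarrow> bool) \<Rightarrow> 'd cfun \<Rightarrow> bool" for S where
  base: "S f \<Longrightarrow> generated_algebra S f"
| const: "generated_algebra S (\<lambda>x. c)"
| add: "generated_algebra S f \<Longrightarrow> generated_algebra S g \<Longrightarrow> generated_algebra S (\<lambda>x. f x + g x)"
| mult: "generated_algebra S f \<Longrightarrow> generated_algebra S g \<Longrightarrow> generated_algebra S (\<lambda>x. f x * g x)"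

lemma generated_algebra_sum: "finite A \<Longrightarrow> (\<And>a. a \<in> A \<Longrightarrow> generated_algebra S (f a)) \<Longrightarrow> generated_algebra S (\<lambda>x. \<Sum>a\<in>A. f a x)"
  by (induction A rule: finite_induct) (auto intro: generated_algebra.const generated_algebra.add)

lemma partial_deriv_eqI: "(f has_derivative f') (at x) \<Longrightarrow> partial_deriv i f x = f' (axis i 1)"
  using frechet_derivative_at by metis

text \<open>
  By the sum and product rules the generated algebra is closed under all partial derivatives, so
  coinduction applies to it.
\<close>

lemma smooth_generated_algebra:
  assumes S: "\<And>f. S f \<Longrightarrow> f differentiable_on UNIV" "\<And>f i. S f \<Longrightarrow> generated_algebra S (partial_deriv i f)"
    and "generated_algebra S f"
  shows "smooth f"
proof -
  have *: "f differentiable_on UNIV \<and> (\<forall>i. generated_algebra S (partial_deriv i f))" if "generated_algebra S f" for f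
    using that
  proof (induction)
    case (base f)
    then show ?case using S by auto
  next
    case (const c)
    then show ?case by (auto intro: generated_algebra.intros simp: frechet_derivative_const)
  next
    case (add f g)
    have "partial_deriv i (\<lambda>x. f x + g x) = (\<lambda>x. partial_deriv i f x + partial_deriv i g x)" for i
      using add by (intro ext partial_deriv_eqI has_derivative_add)
        (auto simp: differentiable_on_def frechet_derivative_works[symmetric])
    moreover have "generated_algebra S (\<lambda>x. partial_deriv i f x + partial_deriv i g x)" for i
      using add by (intro generated_algebra.add) auto
    ultimately show ?case using add by (auto intro: differentiable_on_add)
  next
    case (mult f g)
    have "partial_deriv i (\<lambda>x. f x * g x) = (\<lambda>x. f x * partial_deriv i g x + partial_deriv i f x * g x)" for i
    proof
      fix x
      have "((\<lambda>x. f x * g x) has_derivative (\<lambda>h. f x * frechet_derivative g (at x) h + frechet_derivative f (at x) h * g x)) (at x)"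
        using mult by (intro has_derivative_mult) (auto simp: differentiable_on_def frechet_derivative_works[symmetric])
      from partial_deriv_eqI[OF this] show "partial_deriv i (\<lambda>x. f x * g x) x = f x * partial_deriv i g x + partial_deriv i f x * g x" .
    qed
    moreover have "generated_algebra S (\<lambda>x. f x * partial_deriv i g x + partial_deriv i f x * g x)" for i
      using mult by (intro generated_algebra.add generated_algebra.mult) auto
    ultimately show ?case using mult by (auto intro: differentiable_on_mult)
  qed
  show ?thesis by (rule smooth_coinduct[of "generated_algebra S"]) (use assms * in auto)
qed

lemma smooth_of_smooth_generators: "generated_algebra smooth f \<Longrightarrow> smooth f"
  by (rule smooth_generated_algebra[of smooth]) (auto intro: smooth_diff_on smooth_partial_deriv generated_algebra.base)

lemma smooth_const: "smooth (\<lambda>x. c)"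
  by (rule smooth_of_smooth_generators, rule generated_algebra.const)
lemma smooth_add: "smooth f \<Longrightarrow> smooth g \<Longrightarrow> smooth (\<lambda>x. f x + g x)"
  by (rule smooth_of_smooth_generators, rule generated_algebra.add; rule generated_algebra.base)
lemma smooth_mult: "smooth f \<Longrightarrow> smooth g \<Longrightarrow> smooth (\<lambda>x. f x * g x)"
  by (rule smooth_of_smooth_generators, rule generated_algebra.mult; rule generated_algebra.base)

lemma smooth_prod: "finite A \<Longrightarrow> (\<And>a. a \<in> A \<Longrightarrow> smooth (f a)) \<Longrightarrow> smooth (\<lambda>x. \<Prod>a\<in>A. f a x)"
  by (induction A rule: finite_induct) (auto intro: smooth_const smooth_mult)

lemma smooth_cnj:
  assumes "smooth f"
  shows "smooth (\<lambda>x. cnj (f x))"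
proof (rule smooth_coinduct[of "\<lambda>h. \<exists>f. smooth f \<and> h = (\<lambda>x. cnj (f x))"])
  fix h :: "'a cfun" and i assume "\<exists>f. smooth f \<and> h = (\<lambda>x. cnj (f x))"
  then obtain f where f: "smooth f" "h = (\<lambda>x. cnj (f x))" by auto
  have d: "(h has_derivative (\<lambda>v. cnj (frechet_derivative f (at x) v))) (at x)" for x
    unfolding f(2) using smooth_diff[OF f(1)]
    by (intro has_derivative_cnj) (simp add: frechet_derivative_works)
  then show "h differentiable_on UNIV"
    by (auto simp: differentiable_on_def differentiable_def)
  have "partial_deriv i h = (\<lambda>x. cnj (partial_deriv i f x))"
    using partial_deriv_eqI[OF d] by auto
  then show "\<exists>f. smooth f \<and> partial_deriv i h = (\<lambda>x. cnj (f x))"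
    using smooth_partial_deriv[OF f(1)] by blast
qed (use assms in auto)

text \<open>
  By the chain rule a partial derivative of an affine composition is a linear combination of affine
  compositions of partial derivatives. The composition with the given affine map, applied to all smooth functions,
  is therefore a generating set of the required kind.
\<close>

lemma smooth_affine:
  fixes f :: "'d::finite cfun" and A :: "real^'d^'d"
  assumes "smooth f"
  shows "smooth (\<lambda>x. f (A *v x + b))"
proof -
  let ?S = "\<lambda>h::'d cfun. \<exists>f. smooth f \<and> h = (\<lambda>x. f (A *v x + b))"
  have d: "((\<lambda>x. f (A *v x + b)) has_derivative (\<lambda>v. frechet_derivative f (at (A *v x + b)) (A *v v))) (at x)"
    if "smooth f" for f x
  proof -
    have 1: "((\<lambda>x. A *v x + b) has_derivative (\<lambda>v. A *v v)) (at x)"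
      using bounded_linear_imp_has_derivative[OF matrix_vector_mul_bounded_linear[of A]]
      by (auto intro!: has_derivative_add_const)
    have 2: "(f has_derivative frechet_derivative f (at (A *v x + b))) (at (A *v x + b))"
      using smooth_diff[OF that] by (simp add: frechet_derivative_works)
    show ?thesis using has_derivative_compose[OF 1 2] .
  qed
  show ?thesis
  proof (rule smooth_generated_algebra[of ?S])
    fix h i assume "?S h"
    then obtain f where f: "smooth f" "h = (\<lambda>x. f (A *v x + b))" by auto
    show "h differentiable_on UNIV"
      using d[OF f(1)] by (auto simp: differentiable_on_def differentiable_def f(2))
    have "partial_deriv i h x = (\<Sum>j\<in>UNIV. of_real (A $ j $ i) * partial_deriv j f (A *v x + b))" for x
    proof -
      have lin: "linear (frechet_derivative f (at (A *v x + b)))"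
        using smooth_diff[OF f(1)] by (rule linear_frechet_derivative)
      have "A *v axis i 1 = (\<Sum>j\<in>UNIV. (A $ j $ i) *\<^sub>R axis j 1)"
        unfolding matrix_vector_mult_basis
        by (simp add: vec_eq_iff column_def axis_def if_distrib cong: if_cong)
      then have "frechet_derivative f (at (A *v x + b)) (A *v axis i 1)
         = (\<Sum>j\<in>UNIV. (A $ j $ i) *\<^sub>R partial_deriv j f (A *v x + b))"
        using lin by (simp add: linear_sum linear_scale)
      then show ?thesis using partial_deriv_eqI[OF d[OF f(1)]] by (simp add: f(2) scaleR_conv_of_real)
    qed
    then have "partial_deriv i h = (\<lambda>x. \<Sum>j\<in>UNIV. of_real (A $ j $ i) * partial_deriv j f (A *v x + b))" by auto
    moreover have "generated_algebra ?S (\<lambda>x. \<Sum>j\<in>UNIV. of_real (A $ j $ i) * partial_deriv j f (A *v x + b))"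
      using smooth_partial_deriv[OF f(1)] by (intro generated_algebra_sum generated_algebra.mult generated_algebra.const generated_algebra.base) auto
    ultimately show "generated_algebra ?S (partial_deriv i h)" by simp
  next
    show "generated_algebra ?S (\<lambda>x. f (A *v x + b))" using assms by (intro generated_algebra.base) auto
  qed
qed

text \<open>
  The function is, up to a constant factor, its own partial derivative, so it generates an algebra closed
  under differentiation.
\<close>

lemma smooth_exp:
  fixes k :: "real^'d::finite"
  shows "smooth (\<lambda>x. exp (c * of_real (k \<bullet> x)))"
proof -
  let ?e = "\<lambda>x. exp (c * of_real (k \<bullet> x))"
  have d: "(?e has_derivative (\<lambda>v. c * of_real (k \<bullet> v) * ?e x)) (at x)" for x
  proof -
    have 1: "((\<lambda>x. c * of_real (k \<bullet> x)) has_derivative (\<lambda>v. c * of_real (k \<bullet> v))) (at x)"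
      by (auto intro!: derivative_eq_intros)
    have 2: "(exp has_derivative (\<lambda>u. u * exp (c * of_real (k \<bullet> x)))) (at (c * of_real (k \<bullet> x)))"
      using DERIV_exp[of "c * of_real (k \<bullet> x)"] unfolding has_field_derivative_def
      by (simp only: mult_commute_abs)
    show ?thesis using has_derivative_compose[OF 1 2] .
  qed
  show ?thesis
  proof (rule smooth_generated_algebra[of "\<lambda>h. h = ?e"])
    fix h i assume h: "h = ?e"
    show "h differentiable_on UNIV"
      using d by (auto simp: differentiable_on_def differentiable_def h)
    have "partial_deriv i h = (\<lambda>x. c * of_real (k \<bullet> axis i 1) * ?e x)"
      using partial_deriv_eqI[OF d] by (auto simp: h)
    moreover have "generated_algebra (\<lambda>h. h = ?e) (\<lambda>x. c * of_real (k \<bullet> axis i 1) * ?e x)"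
      by (intro generated_algebra.mult generated_algebra.const generated_algebra.base) auto
    ultimately show "generated_algebra (\<lambda>h. h = ?e) (partial_deriv i h)" by simp
  qed (auto intro: generated_algebra.base)
qed

section \<open>Flat functions and bumps\<close>

text \<open>
  The powers in the denominator are there because the family over \<open>n\<close> is then closed under
  differentiation up to linear combinations.
\<close>

definition flat :: "real \<Rightarrow> nat \<Rightarrow> real \<Rightarrow> real" where
  "flat e n t = (if t > 0 then exp (- e / t) / t ^ n else 0)"

lemma flat_tendsto:
  assumes "e > 0" shows "(flat e n \<longlongrightarrow> 0) (at 0)"
proof -
  have "((\<lambda>t. (e / t) ^ n / exp (e / t)) \<longlongrightarrow> 0) (at_right 0)"
  proof (rule filterlim_compose[OF tendsto_power_div_exp_0])
    show "filterlim (\<lambda>t. e / t) at_top (at_right 0)"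
      using assms by (simp add: divide_inverse filterlim_tendsto_pos_mult_at_top[OF tendsto_const] filterlim_inverse_at_top_right)
  qed
  then have lim: "((\<lambda>t. (1 / e ^ n) * ((e / t) ^ n / exp (e / t))) \<longlongrightarrow> (1 / e^n) * 0) (at_right 0)"
    by (intro tendsto_intros)
  have "(flat e n \<longlongrightarrow> 0) (at_right 0)"
  proof -
    have "1 / e ^ n * ((e / t) ^ n / exp (e / t)) = flat e n t" if "0 < t" for t
      using assms that by (simp add: flat_def field_simps exp_minus)
    then have "\<forall>\<^sub>F t in at_right 0. 1 / e ^ n * ((e / t) ^ n / exp (e / t)) = flat e n t"
      by (intro eventually_mono[OF eventually_at_right_less])
    from Lim_transform_eventually[OF lim this] show ?thesis by simp
  qed
  moreover have "(flat e n \<longlongrightarrow> 0) (at_left 0)"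
  proof (rule Lim_transform_eventually[OF tendsto_const])
    show "\<forall>\<^sub>F t in at_left 0. 0 = flat e n t"
      by (auto simp: eventually_at_left_field flat_def intro: exI[of _ "-1"])
  qed
  ultimately show ?thesis by (simp add: filterlim_split_at)
qed

lemma flat_deriv:
  assumes e: "e > 0"
  shows "(flat e n has_real_derivative (e * flat e (n + 2) t - n * flat e (n + 1) t)) (at t)"
proof (cases "t = 0")
  case True
  \<comment> \<open>At the origin the difference quotient of one flat function is the next one in the family.\<close>
  have "((\<lambda>h. (flat e n (0 + h) - flat e n 0) / h) \<longlongrightarrow> 0) (at 0)"
  proof (rule Lim_transform_eventually[OF flat_tendsto[OF e, of "n+1"]])
    show "\<forall>\<^sub>F x in at 0. flat e (n + 1) x = (flat e n (0 + x) - flat e n 0) / x"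
      by (rule always_eventually) (auto simp: flat_def field_simps)
  qed
  then show ?thesis using True by (simp add: DERIV_def flat_def)
next
  case False
  show ?thesis
  proof (cases "t > 0")
    case True
    have "((\<lambda>t. exp (- e / t) / t ^ n) has_real_derivative (e * flat e (n + 2) t - n * flat e (n + 1) t)) (at t)"
    proof -
      have quotient_rule: "(E * (e / t\<^sup>2) * t ^ n - E * (real n * t ^ (n - 1))) / (t ^ n * t ^ n) = e * (E / t ^ (n + 2)) - n * (E / t ^ (n + 1))" for E
      proof (cases n)
        case 0
        then show ?thesis using True by (simp add: power2_eq_square)
      next
        case (Suc m)
        define p where "p = t ^ m"
        have "p \<noteq> 0" using True by (simp add: p_def)
        have eqs: "t ^ n = t * p" "t ^ (n - 1) = p" "t ^ (n + 2) = t * t * t * p" "t ^ (n + 1) = t * t * p"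
          using Suc by (auto simp: p_def)
        show ?thesis unfolding eqs power2_eq_square using True \<open>p \<noteq> 0\<close>
          by (simp add: divide_simps) (simp add: algebra_simps)
      qed
      have 1: "((\<lambda>t. exp (- e / t)) has_real_derivative exp (- e / t) * (e / t\<^sup>2)) (at t)"
        using True by (auto intro!: derivative_eq_intros simp: power2_eq_square)
      have 2: "((\<lambda>t. t ^ n) has_real_derivative real n * t ^ (n - 1)) (at t)"
        by (auto intro!: derivative_eq_intros)
      show ?thesis
        using DERIV_divide[OF 1 2] True quotient_rule[of "exp (- e / t)"] by (simp add: flat_def)
    qed
    moreover have "\<forall>\<^sub>F u in nhds t. exp (- e / u) / u ^ n = flat e n u"
      using True eventually_nhds_in_open[of "{0<..}" t] by (auto simp: flat_def elim: eventually_mono)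
    ultimately show ?thesis using DERIV_cong_ev[OF refl _ refl] by fastforce
  next
    case f: False
    have "((\<lambda>t. 0) has_real_derivative (e * flat e (n + 2) t - n * flat e (n + 1) t)) (at t)"
      using f by (auto simp: flat_def)
    moreover have "\<forall>\<^sub>F u in nhds t. 0 = flat e n u"
      using f False eventually_nhds_in_open[of "{..<0}" t] by (auto simp: flat_def elim: eventually_mono)
    ultimately show ?thesis using DERIV_cong_ev[OF refl _ refl] by fastforce
  qed
qed

lemma smooth_flat:
  fixes c :: "real^'d::finite"
  assumes e: "e > 0"
  shows "smooth (\<lambda>x. of_real (flat e n (c \<bullet> x + a)))"
proof -
  let ?S = "\<lambda>h. \<exists>n. h = (\<lambda>x::real^'d. complex_of_real (flat e n (c \<bullet> x + a)))"
  have d: "((\<lambda>x. complex_of_real (flat e n (c \<bullet> x + a))) has_derivative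
      (\<lambda>v. of_real (c \<bullet> v) * (of_real e * of_real (flat e (n + 2) (c \<bullet> x + a)) + of_real (- real n) * of_real (flat e (n + 1) (c \<bullet> x + a))))) (at x)" for n x
  proof -
    have 1: "((\<lambda>x. c \<bullet> x + a) has_derivative (\<lambda>v. c \<bullet> v)) (at x)"
      by (auto intro!: derivative_eq_intros)
    have 2: "(flat e n has_derivative (\<lambda>u. u * (e * flat e (n + 2) (c \<bullet> x + a) - n * flat e (n + 1) (c \<bullet> x + a)))) (at (c \<bullet> x + a))"
      using flat_deriv[OF e, of n "c \<bullet> x + a"] unfolding has_field_derivative_def
      by (simp only: mult_commute_abs)
    show ?thesis
      using has_derivative_of_real[OF has_derivative_compose[OF 1 2]] by simp
  qed
  show ?thesis
  proof (rule smooth_generated_algebra[of ?S])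
    fix h i assume "?S h"
    then obtain n where h: "h = (\<lambda>x. complex_of_real (flat e n (c \<bullet> x + a)))" by auto
    show "h differentiable_on UNIV"
      unfolding h using d by (auto simp only: differentiable_on_def differentiable_def)
    have "partial_deriv i h = (\<lambda>x. of_real (c \<bullet> axis i 1) * (of_real e * of_real (flat e (n + 2) (c \<bullet> x + a)) + of_real (- real n) * of_real (flat e (n + 1) (c \<bullet> x + a))))"
      using partial_deriv_eqI[OF d] by (auto simp: h)
    moreover have "generated_algebra ?S (\<lambda>x. of_real (c \<bullet> axis i 1) * (of_real e * of_real (flat e (n + 2) (c \<bullet> x + a)) + of_real (- real n) * of_real (flat e (n + 1) (c \<bullet> x + a))))"
      by (intro generated_algebra.mult generated_algebra.add generated_algebra.const generated_algebra.base) auto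
    ultimately show "generated_algebra ?S (partial_deriv i h)" by simp
  next
    show "generated_algebra ?S (\<lambda>x. of_real (flat e n (c \<bullet> x + a)))" by (intro generated_algebra.base) auto
  qed
qed

text \<open>
  A smooth function supported in the closure of the box, positive exactly on the open box. The exponents
  \<open>1 / Suc n\<close> make the sequence increase to the indicator function of the open box.
\<close>

definition real_bump :: "real^'d::finite \<Rightarrow> real^'d \<Rightarrow> nat \<Rightarrow> real^'d \<Rightarrow> real" where
  "real_bump a b n x = (\<Prod>i\<in>UNIV. flat (1 / Suc n) 0 (x $ i - a $ i) * flat (1 / Suc n) 0 (b $ i - x $ i))"

definition bump :: "real^'d::finite \<Rightarrow> real^'d \<Rightarrow> nat \<Rightarrow> 'd cfun" where
  "bump a b n = (\<lambda>x. of_real (real_bump a b n x))"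

lemma flat01: "e > 0 \<Longrightarrow> 0 \<le> flat e 0 t \<and> flat e 0 t \<le> 1"
  by (auto simp: flat_def)

lemma smooth_bump: "smooth (bump a b n)"
proof -
  have "smooth (\<lambda>x. \<Prod>i\<in>UNIV. complex_of_real (flat (1 / Suc n) 0 (axis i 1 \<bullet> x + (- a $ i))) * of_real (flat (1 / Suc n) 0 ((- axis i 1) \<bullet> x + b $ i)))"
    by (intro smooth_prod smooth_mult smooth_flat) auto
  then show ?thesis by (simp add: bump_def real_bump_def inner_axis' algebra_simps)
qed

lemma real_bump_outside:
  assumes "x \<notin> box a b" shows "real_bump a b n x = 0"
proof -
  obtain i where "\<not> a $ i < x $ i \<or> \<not> x $ i < b $ i"
    using assms by (auto simp: mem_box_cart)
  then have "flat (1 / Suc n) 0 (x $ i - a $ i) * flat (1 / Suc n) 0 (b $ i - x $ i) = 0"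
    by (auto simp: flat_def)
  then show ?thesis unfolding real_bump_def by (intro prod_zero) auto
qed

lemma bump_outside: "x \<notin> box a b \<Longrightarrow> bump a b n x = 0"
  by (simp add: bump_def real_bump_outside)

lemma test_fun_bump: "test_fun (bump a b n)"
proof -
  have "{x. bump a b n x \<noteq> 0} \<subseteq> box a b" using bump_outside by blast
  then show ?thesis unfolding test_fun_iff using smooth_bump bounded_subset bounded_box by blast
qed

lemma real_bump_01: "0 \<le> real_bump a b n x" "real_bump a b n x \<le> 1"
  unfolding real_bump_def by (auto intro!: prod_nonneg prod_le_1 mult_le_one simp: flat01)

lemma real_bump_mono: "real_bump a b n x \<le> real_bump a b (Suc n) x"
  unfolding real_bump_def
proof (intro prod_mono conjI mult_mono mult_nonneg_nonneg)
  have *: "flat (1 / Suc n) 0 t \<le> flat (1 / Suc (Suc n)) 0 t" for t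
    by (auto simp: flat_def intro!: divide_right_mono frac_le)
  show "flat (1 / real (Suc n)) 0 (x $ i - a $ i) \<le> flat (1 / real (Suc (Suc n))) 0 (x $ i - a $ i)"
   "flat (1 / real (Suc n)) 0 (b $ i - x $ i) \<le> flat (1 / real (Suc (Suc n))) 0 (b $ i - x $ i)" for i
    using * by blast+
qed (auto simp: flat01)

lemma flat_lim: "t > 0 \<Longrightarrow> (\<lambda>n. flat (1 / Suc n) 0 t) \<longlonglongrightarrow> 1"
proof -
  assume t: "t > 0"
  have "(\<lambda>n. exp (- (1 / Suc n) / t)) \<longlonglongrightarrow> exp (- 0 / t)"
    by (intro tendsto_intros LIMSEQ_Suc[OF lim_1_over_n]) (use t in auto)
  then show ?thesis using t by (simp add: flat_def)
qed

lemma real_bump_lim: "(\<lambda>n. real_bump a b n x) \<longlonglongrightarrow> indicator (box a b) x"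
proof (cases "x \<in> box a b")
  case True
  have "(\<lambda>n. real_bump a b n x) \<longlonglongrightarrow> (\<Prod>i\<in>(UNIV::'a set). 1 * 1)"
    unfolding real_bump_def using True
    by (intro tendsto_prod tendsto_mult flat_lim) (auto simp: mem_box_cart)
  then show ?thesis using True by simp
next
  case False
  then show ?thesis using real_bump_outside[OF False] by simp
qed

section \<open>Operations on test functions\<close>

lemma matrix_inv_cancel:
  fixes A :: "real^'n^'n"
  assumes "invertible A"
  shows "A *v (matrix_inv A *v x) = x" "matrix_inv A *v (A *v x) = x"
proof -
  have "A ** matrix_inv A = mat 1 \<and> matrix_inv A ** A = mat 1"
    using assms unfolding matrix_inv_def invertible_def by (rule someI_ex)
  then show "A *v (matrix_inv A *v x) = x" "matrix_inv A *v (A *v x) = x"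
    by (simp_all add: matrix_vector_mul_assoc)
qed

lemma test_fun_add: "test_fun f \<Longrightarrow> test_fun g \<Longrightarrow> test_fun (\<lambda>x. f x + g x)"
  unfolding test_fun_iff
  by (auto intro: smooth_add bounded_subset[of "{x. f x \<noteq> 0} \<union> {x. g x \<noteq> 0}"])

lemma test_fun_mult_left: "smooth g \<Longrightarrow> test_fun f \<Longrightarrow> test_fun (\<lambda>x. g x * f x)"
  unfolding test_fun_iff
  by (auto intro: smooth_mult bounded_subset[of "{x. f x \<noteq> 0}"])

lemma test_fun_cmult: "test_fun f \<Longrightarrow> test_fun (\<lambda>x. c * f x)"
  by (intro test_fun_mult_left smooth_const)

lemma test_fun_zero: "test_fun (\<lambda>x. 0)"
  using smooth_const by (auto simp: test_fun_iff)

lemma test_fun_smooth: "test_fun f \<Longrightarrow> smooth f" by (simp add: test_fun_iff)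

lemma test_fun_cnj: "test_fun f \<Longrightarrow> test_fun (\<lambda>x. cnj (f x))"
  by (auto simp: test_fun_iff smooth_cnj)

lemma test_fun_affine:
  fixes f :: "'d::finite cfun" and A :: "real^'d^'d"
  assumes "test_fun f" "invertible A"
  shows "test_fun (\<lambda>x. f (A *v x + b))"
proof -
  have "x \<in> (\<lambda>y. matrix_inv A *v (y - b)) ` {y. f y \<noteq> 0}" if "f (A *v x + b) \<noteq> 0" for x
    using that matrix_inv_cancel[OF assms(2)]
    by (intro image_eqI[of _ _ "A *v x + b"]) auto
  then have "{x. f (A *v x + b) \<noteq> 0} \<subseteq> (\<lambda>y. matrix_inv A *v (y - b)) ` {y. f y \<noteq> 0}"
    by blast
  moreover have "bounded ((\<lambda>y. matrix_inv A *v (y - b)) ` {y. f y \<noteq> 0})"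
  proof -
    have "bounded ((\<lambda>y. y - b) ` {y. f y \<noteq> 0})"
      using assms(1) bounded_translation_minus by (auto simp: test_fun_iff)
    from bounded_linear_image[OF this matrix_vector_mul_bounded_linear[of "matrix_inv A"]]
    show ?thesis by (simp add: image_image)
  qed
  ultimately show ?thesis
    using assms by (auto simp: test_fun_iff smooth_affine intro: bounded_subset)
qed

lemma test_fun_continuous: "test_fun f \<Longrightarrow> continuous_on UNIV f"
  by (simp add: differentiable_imp_continuous_on smooth_diff_on test_fun_smooth)

lemma test_fun_measurable: "test_fun f \<Longrightarrow> f \<in> borel_measurable lebesgue"
  using borel_measurable_continuous_onI[OF test_fun_continuous, of f]
  by (intro measurable_completion) simp

lemma test_fun_bounded:
  assumes "test_fun f" obtains B where "B > 0" "\<And>x. cmod (f x) \<le> B"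
proof -
  let ?K = "closure {x. f x \<noteq> 0}"
  have "bounded (f ` ?K)"
    using assms continuous_on_subset[OF test_fun_continuous[OF assms], of ?K]
    by (intro compact_imp_bounded compact_continuous_image) (auto simp: test_fun_def)
  then obtain B where B: "B > 0" "\<And>x. x \<in> ?K \<Longrightarrow> cmod (f x) \<le> B"
    unfolding bounded_pos by blast
  have "cmod (f x) \<le> B" for x
    using B closure_subset[of "{x. f x \<noteq> 0}"] by (cases "f x = 0") auto
  with B(1) that show thesis by blast
qed

section \<open>Linear change of variables\<close>

lemma Basis_cart: "(Basis :: (real^'d::finite) set) = range (\<lambda>i. axis i 1)"
  by (auto simp: Basis_vec_def)

lemma prod_Basis_cart: "(\<Prod>b\<in>(Basis :: (real^'d::finite) set). f b) = (\<Prod>i\<in>UNIV. f (axis i 1))"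
proof -
  have inj: "inj (\<lambda>i::'d. axis i (1::real))"
    by (auto simp: inj_on_def axis_eq_axis)
  show ?thesis unfolding Basis_cart by (subst prod.reindex[OF inj]) simp
qed

text \<open>
  Integrating over the coordinate \<open>m\<close> first, the shear is a translation of this coordinate by an amount that
  depends only on the other coordinates.
\<close>

lemma nn_integral_shear:
  fixes F :: "real^'d::finite \<Rightarrow> ennreal"
  assumes [measurable]: "F \<in> borel_measurable borel" and mn: "m \<noteq> n"
  shows "(\<integral>\<^sup>+x. F (x + (x $ n) *\<^sub>R axis m 1) \<partial>lborel) = (\<integral>\<^sup>+x. F x \<partial>lborel)"
proof -
  define e :: "real^'d" where "e = axis m 1"
  define B where "B = (Basis :: (real^'d) set) - {e}"
  have e: "e \<in> Basis" by (auto simp: e_def)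
  have B: "finite B" "e \<notin> B" "Basis = insert e B" using e by (auto simp: B_def)
  interpret product_sigma_finite "\<lambda>_::real^'d. lborel :: real measure" by standard
  have rep: "(\<integral>\<^sup>+x. G x \<partial>lborel) = (\<integral>\<^sup>+f. (\<integral>\<^sup>+y. G (y *\<^sub>R e + (\<Sum>b\<in>B. f b *\<^sub>R b)) \<partial>lborel) \<partial>(\<Pi>\<^sub>M b\<in>B. lborel))"
    if [measurable]: "G \<in> borel_measurable borel" for G :: "real^'d \<Rightarrow> ennreal"
  proof -
    have "(\<integral>\<^sup>+x. G x \<partial>lborel) = (\<integral>\<^sup>+f. G (\<Sum>b\<in>insert e B. f b *\<^sub>R b) \<partial>(\<Pi>\<^sub>M b\<in>insert e B. lborel))"
      by (subst lborel_eq, subst nn_integral_distr) (auto simp: B(3))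
    also have "\<dots> = (\<integral>\<^sup>+f. (\<integral>\<^sup>+y. G (\<Sum>b\<in>insert e B. (f(e := y)) b *\<^sub>R b) \<partial>lborel) \<partial>(\<Pi>\<^sub>M b\<in>B. lborel))"
      by (rule product_nn_integral_insert[OF B(1,2)]) measurable
    also have "\<dots> = (\<integral>\<^sup>+f. (\<integral>\<^sup>+y. G (y *\<^sub>R e + (\<Sum>b\<in>B. f b *\<^sub>R b)) \<partial>lborel) \<partial>(\<Pi>\<^sub>M b\<in>B. lborel))"
    proof (intro nn_integral_cong arg_cong[of _ _ G])
      fix f y
      have "(\<Sum>b\<in>B. (f(e := y)) b *\<^sub>R b) = (\<Sum>b\<in>B. f b *\<^sub>R b)"
        using B by (intro sum.cong) auto
      then show "(\<Sum>b\<in>insert e B. (f(e := y)) b *\<^sub>R b) = y *\<^sub>R e + (\<Sum>b\<in>B. f b *\<^sub>R b)"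
        using B(1,2) by simp
    qed
    finally show ?thesis .
  qed
  have "(\<integral>\<^sup>+x. F (x + (x $ n) *\<^sub>R e) \<partial>lborel)
     = (\<integral>\<^sup>+f. (\<integral>\<^sup>+y. F ((y *\<^sub>R e + (\<Sum>b\<in>B. f b *\<^sub>R b)) + ((y *\<^sub>R e + (\<Sum>b\<in>B. f b *\<^sub>R b)) $ n) *\<^sub>R e) \<partial>lborel) \<partial>(\<Pi>\<^sub>M b\<in>B. lborel))"
    by (rule rep) measurable
  also have "\<dots> = (\<integral>\<^sup>+f. (\<integral>\<^sup>+y. F (y *\<^sub>R e + (\<Sum>b\<in>B. f b *\<^sub>R b)) \<partial>lborel) \<partial>(\<Pi>\<^sub>M b\<in>B. lborel))"
  proof (rule nn_integral_cong)
    fix f :: "real^'d \<Rightarrow> real"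
    define w where "w = (\<Sum>b\<in>B. f b *\<^sub>R b)"
    have "e $ n = 0" using mn by (simp add: e_def axis_def)
    then have "F ((y *\<^sub>R e + w) + ((y *\<^sub>R e + w) $ n) *\<^sub>R e) = F ((w $ n + 1 * y) *\<^sub>R e + w)" for y
      by (simp add: algebra_simps)
    moreover have "(\<integral>\<^sup>+y. F (y *\<^sub>R e + w) \<partial>lborel) = ennreal \<bar>1\<bar> * (\<integral>\<^sup>+y. F ((w $ n + 1 * y) *\<^sub>R e + w) \<partial>lborel)"
      by (rule nn_integral_real_affine) auto
    ultimately show "(\<integral>\<^sup>+y. F ((y *\<^sub>R e + (\<Sum>b\<in>B. f b *\<^sub>R b)) + ((y *\<^sub>R e + (\<Sum>b\<in>B. f b *\<^sub>R b)) $ n) *\<^sub>R e) \<partial>lborel)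
       = (\<integral>\<^sup>+y. F (y *\<^sub>R e + (\<Sum>b\<in>B. f b *\<^sub>R b)) \<partial>lborel)"
      by (simp add: w_def)
  qed
  also have "\<dots> = (\<integral>\<^sup>+x. F x \<partial>lborel)"
    by (rule rep[symmetric]) measurable
  finally show ?thesis by (simp add: e_def)
qed

lemma measurable_matvec[measurable]: "(\<lambda>x. (A::real^'d^'d::finite) *v x) \<in> borel_measurable borel"
  by (intro borel_measurable_continuous_onI continuous_intros)

lemma nn_integral_diagonal:
  fixes A :: "real^'d^'d::finite"
  assumes diag: "\<And>i j. i \<noteq> j \<Longrightarrow> A $ i $ j = 0" and det: "det A \<noteq> 0"
    and [measurable]: "F \<in> borel_measurable borel"
  shows "(\<integral>\<^sup>+x. F (A *v x) \<partial>lborel) = ennreal (1 / \<bar>det A\<bar>) * (\<integral>\<^sup>+x. F x \<partial>lborel)"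
proof -
  have dA: "det A = (\<Prod>i\<in>UNIV. A $ i $ i)" using diag by (rule det_diagonal)
  then have nz: "A $ i $ i \<noteq> 0" for i using det by auto
  define c where "c = (\<lambda>b::real^'d. (A *v b) \<bullet> b)"
  have caxis: "c (axis i 1) = A $ i $ i" for i
    by (simp add: c_def inner_axis matrix_vector_mult_basis column_def)
  have T: "(\<lambda>x. 0 + (\<Sum>b\<in>Basis. (c b * (x \<bullet> b)) *\<^sub>R b)) = (\<lambda>x. A *v x)"
  proof
    fix x :: "real^'d"
    have "(A *v x) \<bullet> b = c b * (x \<bullet> b)" if b: "b \<in> Basis" for b
    proof -
      obtain i where i: "b = axis i 1" using b unfolding Basis_cart by blast
      have "(A *v x) $ i = (\<Sum>j\<in>UNIV. A $ i $ j * x $ j)"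
        by (simp add: matrix_vector_mult_def)
      also have "\<dots> = (\<Sum>j\<in>UNIV. if j = i then A $ i $ i * x $ i else 0)"
        by (rule sum.cong) (use diag in auto)
      finally have "(A *v x) $ i = A $ i $ i * x $ i" by simp
      then show ?thesis unfolding i caxis by (simp add: inner_axis)
    qed
    then have "A *v x = (\<Sum>b\<in>Basis. (c b * (x \<bullet> b)) *\<^sub>R b)"
      by (subst euclidean_representation[symmetric]) (auto intro!: sum.cong)
    then show "0 + (\<Sum>b\<in>Basis. (c b * (x \<bullet> b)) *\<^sub>R b) = A *v x" by simp
  qed
  have cnz: "c b \<noteq> 0" if "b \<in> Basis" for b
    using that nz by (auto simp: Basis_vec_def caxis)
  have pc: "(\<Prod>b\<in>Basis. \<bar>c b\<bar>) = \<bar>det A\<bar>"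
    by (simp add: prod_Basis_cart caxis dA abs_prod)
  have "lborel = density (distr lborel borel ((*v) A)) (\<lambda>_. ennreal \<bar>det A\<bar>)"
    using lborel_affine_euclidean[of c 0] cnz unfolding T pc by simp
  then have "(\<integral>\<^sup>+x. F x \<partial>lborel) = (\<integral>\<^sup>+x. F x \<partial>density (distr lborel borel ((*v) A)) (\<lambda>_. ennreal \<bar>det A\<bar>))"
    by simp
  also have "\<dots> = ennreal \<bar>det A\<bar> * (\<integral>\<^sup>+x. F (A *v x) \<partial>lborel)"
    by (simp add: nn_integral_density nn_integral_distr nn_integral_cmult)
  finally show ?thesis using det
    by (simp add: mult.assoc[symmetric] ennreal_mult[symmetric])
qed

lemma nn_integral_transpose:
  fixes F :: "real^'d::finite \<Rightarrow> ennreal" and m n :: 'd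
  assumes [measurable]: "F \<in> borel_measurable borel"
  defines "p \<equiv> Transposition.transpose m n"
  shows "(\<integral>\<^sup>+x. F (\<chi> i. x $ p i) \<partial>lborel) = (\<integral>\<^sup>+x. F x \<partial>lborel)"
proof -
  have p: "p permutes UNIV" "p (p i) = i" for i by (auto simp: p_def permutes_swap_id)
  have [measurable]: "(\<lambda>x::real^'d. \<chi> i. x $ p i) \<in> borel_measurable borel"
    by (intro borel_measurable_continuous_onI continuous_intros)
  have "lborel = distr lborel borel (\<lambda>x::real^'d. \<chi> i. x $ p i)"
  proof (rule lborel_eqI)
    fix l u :: "real^'d"
    assume lu: "\<And>b. b \<in> Basis \<Longrightarrow> l \<bullet> b \<le> u \<bullet> b"
    have lu': "l $ i \<le> u $ i" for i using lu[of "axis i 1"] by (simp add: inner_axis)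
    have "(\<lambda>x::real^'d. \<chi> i. x $ p i) -` box l u = box (\<chi> i. l $ p i) (\<chi> i. u $ p i)"
    proof (rule set_eqI)
      fix x :: "real^'d"
      have "(\<forall>i. P i) \<longleftrightarrow> (\<forall>i. P (p i))" for P using p(2) by metis
      from this[of "\<lambda>i. l $ i < x $ p i \<and> x $ p i < u $ i"]
      show "x \<in> (\<lambda>x. \<chi> i. x $ p i) -` box l u \<longleftrightarrow> x \<in> box (\<chi> i. l $ p i) (\<chi> i. u $ p i)"
        by (simp add: mem_box_cart p(2))
    qed
    then have "emeasure (distr lborel borel (\<lambda>x::real^'d. \<chi> i. x $ p i)) (box l u)
       = emeasure lborel (box (\<chi> i. l $ p i) (\<chi> i. u $ p i))"
      by (subst emeasure_distr) auto
    also have "\<dots> = (\<Prod>b\<in>Basis. ((\<chi> i. u $ p i) - (\<chi> i. l $ p i)) \<bullet> b)"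
      using lu' by (intro emeasure_lborel_box) (auto simp: Basis_vec_def inner_axis)
    also have "(\<Prod>b\<in>Basis. ((\<chi> i. u $ p i) - (\<chi> i. l $ p i)) \<bullet> b) = (\<Prod>i\<in>UNIV. u $ p i - l $ p i)"
      by (simp add: prod_Basis_cart inner_axis)
    also have "\<dots> = (\<Prod>i\<in>UNIV. u $ i - l $ i)"
      using prod.permute[OF p(1), of "\<lambda>i. u $ i - l $ i"] by (simp add: o_def)
    also have "\<dots> = (\<Prod>b\<in>Basis. (u - l) \<bullet> b)"
      by (simp add: prod_Basis_cart inner_axis)
    finally show "emeasure (distr lborel borel (\<lambda>x::real^'d. \<chi> i. x $ p i)) (box l u) = (\<Prod>b\<in>Basis. (u - l) \<bullet> b)" .
  qed simp
  then have "(\<integral>\<^sup>+x. F x \<partial>lborel) = (\<integral>\<^sup>+x. F x \<partial>distr lborel borel (\<lambda>x::real^'d. \<chi> i. x $ p i))"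
    by simp
  then show ?thesis by (simp add: nn_integral_distr)
qed

text \<open>
  The determinant is multiplicative, so the formula passes from factors to products. Every matrix is a product of shears,
  transpositions, diagonal matrices and matrices with a zero row; the last have determinant zero.
\<close>

lemma nn_integral_linear_lborel:
  fixes A :: "real^'d^'d::finite"
  assumes "det A \<noteq> 0" "F \<in> borel_measurable borel"
  shows "(\<integral>\<^sup>+x. F (A *v x) \<partial>lborel) = ennreal (1 / \<bar>det A\<bar>) * (\<integral>\<^sup>+x. F x \<partial>lborel)"
proof -
  let ?P = "\<lambda>A::real^'d^'d. det A \<noteq> 0 \<longrightarrow> (\<forall>F\<in>borel_measurable borel.
     (\<integral>\<^sup>+x. F (A *v x) \<partial>lborel) = ennreal (1 / \<bar>det A\<bar>) * (\<integral>\<^sup>+x. F x \<partial>lborel))"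
  have "?P A"
  proof (rule induct_matrix_elementary_alt)
    fix A B :: "real^'d^'d" assume A: "?P A" and B: "?P B"
    show "?P (A ** B)"
    proof (intro impI ballI)
      fix F :: "real^'d \<Rightarrow> ennreal" assume [measurable]: "F \<in> borel_measurable borel" and nz: "det (A ** B) \<noteq> 0"
      have "(\<integral>\<^sup>+x. F ((A ** B) *v x) \<partial>lborel) = (\<integral>\<^sup>+x. (\<lambda>y. F (A *v y)) (B *v x) \<partial>lborel)"
        by (simp add: matrix_vector_mul_assoc)
      also have "\<dots> = ennreal (1 / \<bar>det B\<bar>) * (\<integral>\<^sup>+x. F (A *v x) \<partial>lborel)"
        using B nz by (intro B[rule_format]) (auto simp: det_mul)
      also have "(\<integral>\<^sup>+x. F (A *v x) \<partial>lborel) = ennreal (1 / \<bar>det A\<bar>) * (\<integral>\<^sup>+x. F x \<partial>lborel)"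
        using A nz by (intro A[rule_format]) (auto simp: det_mul)
      finally have fin: "(\<integral>\<^sup>+x. F ((A ** B) *v x) \<partial>lborel) = ennreal (1 / \<bar>det B\<bar>) * (ennreal (1 / \<bar>det A\<bar>) * (\<integral>\<^sup>+x. F x \<partial>lborel))" .
      show "(\<integral>\<^sup>+x. F ((A ** B) *v x) \<partial>lborel) = ennreal (1 / \<bar>det (A ** B)\<bar>) * (\<integral>\<^sup>+x. F x \<partial>lborel)"
      proof -
        have "ennreal (1 / \<bar>det (A ** B)\<bar>) = ennreal (1 / \<bar>det B\<bar>) * ennreal (1 / \<bar>det A\<bar>)"
          by (subst ennreal_mult[symmetric]) (auto simp: det_mul abs_mult)
        then show ?thesis using fin by (simp add: mult.assoc)
      qed
    qed
  next
    fix A :: "real^'d^'d" and i assume "row i A = 0"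
    then show "?P A" by (simp add: det_zero_row)
  next
    fix A :: "real^'d^'d" assume "\<And>i j. i \<noteq> j \<Longrightarrow> A $ i $ j = 0"
    then show "?P A" using nn_integral_diagonal by blast
  next
    fix m n :: 'd assume mn: "m \<noteq> n"
    let ?p = "Transposition.transpose m n"
    let ?A = "\<chi> i j. (mat 1 :: real^'d^'d) $ i $ ?p j"
    have "det ?A = of_int (sign ?p) * det (mat 1 :: real^'d^'d)"
      by (rule det_permute_columns) (simp add: permutes_swap_id)
    then have d: "\<bar>det ?A\<bar> = 1" using mn by (simp add: sign_swap_id)
    have "?A *v x = (\<chi> i. x $ ?p i)" for x
    proof -
      have "(?A *v x) $ i = (\<Sum>j\<in>UNIV. (if i = ?p j then 1 else 0) * x $ j)" for i
        by (simp add: matrix_vector_mult_def mat_def)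
      also have "(\<Sum>j\<in>UNIV. (if i = ?p j then 1 else 0) * x $ j) = (\<Sum>j\<in>UNIV. if j = ?p i then x $ j else 0)" for i
        by (rule sum.cong) auto
      finally show ?thesis by (simp add: vec_eq_iff)
    qed
    note eq = this
    show "?P ?A" unfolding d eq using nn_integral_transpose[of _ m n] by simp
  next
    fix m n :: 'd assume mn: "m \<noteq> n"
    let ?A = "(\<chi> i j. of_bool (i = m \<and> j = n \<or> i = j)) :: real^'d^'d"
    have eqA: "?A = (\<chi> k. if k = m then row m (mat 1) + 1 *s row n (mat 1) else row k (mat 1))"
      using mn by (auto simp: vec_eq_iff row_def mat_def)
    have d: "det ?A = 1" unfolding eqA using det_row_operation[OF mn, where c = 1 and A = "mat 1 :: real^'d^'d"] by simp
    have "?A *v x = x + (x $ n) *\<^sub>R axis m 1" for x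
    proof -
      have "(?A *v x) $ i = (\<Sum>j\<in>UNIV. of_bool (i = m \<and> j = n \<or> i = j) * x $ j)" for i
        by (simp add: matrix_vector_mult_def)
      also have "(\<Sum>j\<in>UNIV. of_bool (i = m \<and> j = n \<or> i = j) * x $ j) = (\<Sum>j\<in>UNIV. (if j = i then x $ i else 0) + (if j = n then if i = m then x $ n else 0 else 0))" for i
        by (rule sum.cong) (use mn in auto)
      finally show ?thesis by (simp add: vec_eq_iff sum.distrib axis_def)
    qed
    note eq = this
    show "?P ?A" unfolding d eq using nn_integral_shear[OF _ mn] by simp
  qed
  then show ?thesis using assms by blast
qed

lemma nn_integral_affine_lborel:
  fixes A :: "real^'d^'d::finite"
  assumes "det A \<noteq> 0" and [measurable]: "F \<in> borel_measurable borel"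
  shows "(\<integral>\<^sup>+x. F (A *v x + b) \<partial>lborel) = ennreal (1 / \<bar>det A\<bar>) * (\<integral>\<^sup>+x. F x \<partial>lborel)"
proof -
  have "(\<integral>\<^sup>+x. F (A *v x + b) \<partial>lborel) = ennreal (1 / \<bar>det A\<bar>) * (\<integral>\<^sup>+x. F (x + b) \<partial>lborel)"
    using assms by (intro nn_integral_linear_lborel[where F = "\<lambda>x. F (x + b)"]) auto
  also have "(\<integral>\<^sup>+x. F (x + b) \<partial>lborel) = (\<integral>\<^sup>+x. F x \<partial>distr lborel borel ((+) b))"
    by (simp add: nn_integral_distr add.commute)
  finally show ?thesis by (simp add: lborel_distr_plus)
qed

text \<open>
  A Lebesgue measurable set differs from a Borel set by a subset of a Borel null set, and the hypothesis with indicator functions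
  shows that preimages of Borel null sets are null.
\<close>

lemma lebesgue_transfer:
  fixes T :: "'a::euclidean_space \<Rightarrow> 'a"
  assumes [measurable]: "T \<in> borel_measurable borel"
    and nn: "\<And>F. F \<in> borel_measurable borel \<Longrightarrow> (\<integral>\<^sup>+x. F (T x) \<partial>lborel) = c * (\<integral>\<^sup>+x. F x \<partial>lborel)"
  shows "T \<in> lebesgue \<rightarrow>\<^sub>M lebesgue" "distr lebesgue lebesgue T = density lebesgue (\<lambda>_. c)"
proof -
  have vm: "T -` S \<in> sets borel" if "S \<in> sets borel" for S
    using measurable_sets[OF assms(1) that] by simp
  have em: "emeasure lborel (T -` S) = c * emeasure lborel S" if "S \<in> sets borel" for S
  proof -
    have "(\<integral>\<^sup>+x. indicator S (T x) \<partial>lborel) = c * (\<integral>\<^sup>+x. indicator S x \<partial>lborel)"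
      using that by (intro nn) auto
    moreover have "(\<integral>\<^sup>+x. indicator S (T x) \<partial>lborel) = (\<integral>\<^sup>+x. indicator (T -` S) x \<partial>lborel)"
      by (intro nn_integral_cong) (auto simp: indicator_def)
    ultimately show ?thesis using that vm by simp
  qed
  have null: "T -` N \<in> null_sets lborel" if "N \<in> null_sets lborel" for N
    using that em[of N] vm[of N] by (auto simp: null_sets_def)
  have *: "T -` S \<in> sets lebesgue \<and> emeasure lebesgue (T -` S) = c * emeasure lebesgue S"
    if S: "S \<in> sets lebesgue" for S
  proof -
    obtain A N N' where A: "S = A \<union> N" "N \<subseteq> N'" "N' \<in> null_sets lborel" "A \<in> sets lborel"
      using S by (rule sets_completionE)
    have s: "T -` S \<in> sets lebesgue"
      by (rule sets_completionI[of _ "T -` A" "T -` N" "T -` N'"]) (use A null vm in auto)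
    have "emeasure lebesgue (T -` S) = emeasure lebesgue (T -` A)"
    proof (rule emeasure_eq_AE)
      have "AE x in lebesgue. x \<notin> T -` N'" using null[OF A(3)] by (intro AE_not_in) (auto intro: null_sets_completionI)
      then show "AE x in lebesgue. x \<in> T -` S \<longleftrightarrow> x \<in> T -` A"
        by eventually_elim (use A in auto)
    qed (use s A vm in auto)
    also have "\<dots> = c * emeasure lebesgue A" using A em vm by simp
    also have "emeasure lebesgue A = emeasure lebesgue S"
    proof (rule emeasure_eq_AE)
      have "AE x in lebesgue. x \<notin> N'" using A(3) by (intro AE_not_in) (auto intro: null_sets_completionI)
      then show "AE x in lebesgue. x \<in> A \<longleftrightarrow> x \<in> S"
        by eventually_elim (use A in auto)
    qed (use S A in auto)
    finally show ?thesis using s by simp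
  qed
  then show m: "T \<in> lebesgue \<rightarrow>\<^sub>M lebesgue" by (intro measurableI) auto
  show "distr lebesgue lebesgue T = density lebesgue (\<lambda>_. c)"
  proof (rule measure_eqI)
    fix S assume "S \<in> sets (distr lebesgue lebesgue T)"
    then have S: "S \<in> sets lebesgue" by simp
    have "emeasure (density lebesgue (\<lambda>_. c)) S = c * emeasure lebesgue S"
      using S by (simp add: emeasure_density nn_integral_cmult_indicator)
    then show "emeasure (distr lebesgue lebesgue T) S = emeasure (density lebesgue (\<lambda>_. c)) S"
      using *[OF S] by (simp add: emeasure_distr[OF m S])
  qed simp
qed

context
  fixes A :: "real^'d^'d::finite" and b :: "real^'d"
  assumes inv: "invertible A"
begin

lemma det_nz: "det A \<noteq> 0" using inv by (simp add: invertible_det_nz)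

lemma
  shows affine_measurable: "(\<lambda>x. A *v x + b) \<in> lebesgue \<rightarrow>\<^sub>M lebesgue"
    and distr_affine: "distr lebesgue lebesgue (\<lambda>x. A *v x + b) = density lebesgue (\<lambda>_. ennreal (1 / \<bar>det A\<bar>))"
  using lebesgue_transfer[of "\<lambda>x. A *v x + b" "ennreal (1 / \<bar>det A\<bar>)"] nn_integral_affine_lborel[OF det_nz]
  by auto

lemma measurable_affine_comp:
  "f \<in> borel_measurable lebesgue \<Longrightarrow> (\<lambda>x. f (A *v x + b)) \<in> borel_measurable lebesgue"
  using measurable_compose[OF affine_measurable] .

lemma integral_affine:
  fixes f :: "real^'d \<Rightarrow> 'b::{banach,second_countable_topology}"
  assumes [measurable]: "f \<in> borel_measurable lebesgue"
  shows "(LINT x|lebesgue. f (A *v x + b)) = (1 / \<bar>det A\<bar>) *\<^sub>R (LINT x|lebesgue. f x)"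
proof -
  have "(LINT x|lebesgue. f (A *v x + b)) = (LINT x|distr lebesgue lebesgue (\<lambda>x. A *v x + b). f x)"
    by (rule integral_distr[symmetric]) (auto intro: affine_measurable)
  then show ?thesis by (simp add: distr_affine integral_density)
qed

lemma integrable_affine:
  fixes f :: "real^'d \<Rightarrow> 'b::{banach,second_countable_topology}"
  assumes f: "integrable lebesgue f"
  shows "integrable lebesgue (\<lambda>x. f (A *v x + b))"
proof -
  have "integrable (distr lebesgue lebesgue (\<lambda>x. A *v x + b)) f"
    using f by (simp add: distr_affine integrable_density)
  then show ?thesis
    using integrable_distr[OF affine_measurable] by blast
qed

end

section \<open>Square integrable functions\<close>

definition sqnorm :: "'d::finite cfun \<Rightarrow> real" where
  "sqnorm f = (LINT x|lebesgue. (cmod (f x))\<^sup>2)"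

lemma L2_measurable: "L2 f \<Longrightarrow> f \<in> borel_measurable lebesgue"
  and L2_integrable: "L2 f \<Longrightarrow> integrable lebesgue (\<lambda>x. (cmod (f x))\<^sup>2)"
  by (auto simp: L2_def)

lemma sqnorm_nonneg: "0 \<le> sqnorm f"
  by (simp add: sqnorm_def)

lemma L2_bound:
  assumes "f \<in> borel_measurable lebesgue" "integrable lebesgue w" "AE x in lebesgue. (cmod (f x))\<^sup>2 \<le> w x"
  shows "L2 f"
proof -
  have "integrable lebesgue (\<lambda>x. (cmod (f x))\<^sup>2)"
  proof (rule Bochner_Integration.integrable_bound[OF assms(2)])
    show "AE x in lebesgue. norm ((cmod (f x))\<^sup>2) \<le> norm (w x)"
      using assms(3) by eventually_elim (simp add: abs_le_iff)
  qed (use assms(1) in measurable)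
  then show ?thesis using assms(1) by (simp add: L2_def)
qed

lemma norm_add_sq_le: "(cmod (a + b))\<^sup>2 \<le> 2 * (cmod a)\<^sup>2 + 2 * (cmod b)\<^sup>2"
proof -
  have "(cmod (a + b))\<^sup>2 \<le> (cmod a + cmod b)\<^sup>2"
    by (intro power_mono norm_triangle_ineq) auto
  also have "\<dots> \<le> 2 * (cmod a)\<^sup>2 + 2 * (cmod b)\<^sup>2"
    using zero_le_power2[of "cmod a - cmod b"] by (simp add: power2_eq_square algebra_simps)
  finally show ?thesis .
qed

lemma L2_add:
  assumes "L2 f" "L2 g"
  shows "L2 (\<lambda>x. f x + g x)" and sqnorm_add_le: "sqnorm (\<lambda>x. f x + g x) \<le> 2 * sqnorm f + 2 * sqnorm g"
proof -
  note i = L2_integrable[OF assms(1)] L2_integrable[OF assms(2)] L2_measurable[OF assms(1)] L2_measurable[OF assms(2)]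
  show 1: "L2 (\<lambda>x. f x + g x)"
    by (rule L2_bound[of _ "\<lambda>x. 2 * (cmod (f x))\<^sup>2 + 2 * (cmod (g x))\<^sup>2"])
       (use i in \<open>auto intro!: norm_add_sq_le\<close>)
  have "sqnorm (\<lambda>x. f x + g x) \<le> (LINT x|lebesgue. 2 * (cmod (f x))\<^sup>2 + 2 * (cmod (g x))\<^sup>2)"
    unfolding sqnorm_def by (rule integral_mono) (use i L2_integrable[OF 1] in \<open>auto intro!: norm_add_sq_le\<close>)
  also have "\<dots> = 2 * sqnorm f + 2 * sqnorm g"
    unfolding sqnorm_def using i by simp
  finally show "sqnorm (\<lambda>x. f x + g x) \<le> 2 * sqnorm f + 2 * sqnorm g" .
qed

lemma L2_mult_bounded:
  assumes "L2 f" "h \<in> borel_measurable lebesgue" "\<And>x. cmod (h x) \<le> B"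
  shows "L2 (\<lambda>x. h x * f x)"
proof (rule L2_bound[of _ "\<lambda>x. B\<^sup>2 * (cmod (f x))\<^sup>2"])
  have "(cmod (h x * f x))\<^sup>2 \<le> B\<^sup>2 * (cmod (f x))\<^sup>2" for x
    unfolding norm_mult power_mult_distrib using assms(3)[of x]
    by (intro mult_right_mono power_mono) auto
  then show "AE x in lebesgue. (cmod (h x * f x))\<^sup>2 \<le> B\<^sup>2 * (cmod (f x))\<^sup>2" by simp
qed (use assms L2_integrable[OF assms(1)] L2_measurable[OF assms(1)] in auto)

lemma L2_cmult: "L2 f \<Longrightarrow> L2 (\<lambda>x. c * f x)"
  by (rule L2_mult_bounded) auto

lemma sqnorm_cmult: "sqnorm (\<lambda>x. c * f x) = (cmod c)\<^sup>2 * sqnorm f"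
  by (simp add: sqnorm_def norm_mult power_mult_distrib)

lemma L2_zero: "L2 (\<lambda>x. 0)" by (simp add: L2_def)

lemma L2_diff: "L2 f \<Longrightarrow> L2 g \<Longrightarrow> L2 (\<lambda>x. f x - g x)"
  using L2_add(1)[of f "\<lambda>x. (-1) * g x"] L2_cmult[of g "-1"] by simp

lemma sqnorm_diff_commute: "sqnorm (\<lambda>x. f x - g x) = sqnorm (\<lambda>x. g x - f x)"
  by (simp add: sqnorm_def norm_minus_commute)

lemma L2_cnj: "L2 f \<Longrightarrow> L2 (\<lambda>x. cnj (f x))"
  by (auto simp: L2_def intro: measurable_compose[OF _ borel_measurable_continuous_onI[OF continuous_on_cnj[OF continuous_on_id]]])

lemma sqnorm_cnj: "sqnorm (\<lambda>x. cnj (f x)) = sqnorm f"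
  by (simp add: sqnorm_def)

lemma L2_bounded_support:
  assumes "f \<in> borel_measurable lebesgue" "bounded {x. f x \<noteq> 0}" "\<And>x. cmod (f x) \<le> B"
  shows "L2 f"
proof -
  obtain a b where ab: "{x. f x \<noteq> 0} \<subseteq> cbox a b"
    using bounded_subset_cbox_symmetric[OF assms(2)] by blast
  have "integrable lebesgue (\<lambda>x. B\<^sup>2 * indicator (cbox a b) x :: real)"
    by (intro integrable_mult_right integrable_real_indicator) (auto simp: emeasure_lborel_cbox_eq)
  moreover have "(cmod (f x))\<^sup>2 \<le> B\<^sup>2 * indicator (cbox a b) x" for x
    using ab assms(3)[of x] by (cases "f x = 0") (auto simp: indicator_def intro!: power_mono)
  ultimately show ?thesis by (intro L2_bound[OF assms(1)] AE_I2)
qed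

lemma L2_test_fun: "test_fun f \<Longrightarrow> L2 f"
  by (metis L2_bounded_support test_fun_bounded test_fun_iff test_fun_measurable)

lemma L2_prod_integrable:
  assumes "L2 f" "L2 g"
  shows "integrable lebesgue (\<lambda>x. f x * g x)"
proof (rule Bochner_Integration.integrable_bound[of _ "\<lambda>x. (cmod (f x))\<^sup>2 + (cmod (g x))\<^sup>2"])
  have "cmod (f x) * cmod (g x) \<le> (cmod (f x))\<^sup>2 + (cmod (g x))\<^sup>2" for x
    using zero_le_power2[of "cmod (f x) - cmod (g x)"] zero_le_power2[of "cmod (f x)"] zero_le_power2[of "cmod (g x)"]
    unfolding power2_diff by linarith
  then show "AE x in lebesgue. norm (f x * g x) \<le> norm ((cmod (f x))\<^sup>2 + (cmod (g x))\<^sup>2)"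
    by (simp add: norm_mult)
qed (use assms[THEN L2_measurable] assms[THEN L2_integrable] in auto)

text \<open>
  The quadratic polynomial \<open>t \<mapsto> \<integral> (t |f| - |g|)\<^sup>2\<close> is nonnegative; evaluate it at its minimum.
\<close>

lemma L2_Cauchy_Schwarz:
  assumes "L2 f" "L2 g"
  shows "(cmod (LINT x|lebesgue. f x * g x))\<^sup>2 \<le> sqnorm f * sqnorm g"
proof -
  define I where "I = (LINT x|lebesgue. cmod (f x) * cmod (g x))"
  define A where "A = sqnorm f"
  define B where "B = sqnorm g"
  have ii: "integrable lebesgue (\<lambda>x. cmod (f x) * cmod (g x))"
    using L2_prod_integrable[OF assms, THEN integrable_norm] by (simp add: norm_mult)
  have quad: "0 \<le> t\<^sup>2 * A - 2 * t * I + B" for t :: real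
  proof -
    have "0 \<le> (LINT x|lebesgue. (t * cmod (f x) - cmod (g x))\<^sup>2)" by simp
    also have "\<dots> = (LINT x|lebesgue. t\<^sup>2 * (cmod (f x))\<^sup>2 - 2 * t * (cmod (f x) * cmod (g x)) + (cmod (g x))\<^sup>2)"
      by (intro arg_cong[of _ _ "integral\<^sup>L lebesgue"] ext) (simp add: power2_eq_square algebra_simps)
    also have "\<dots> = t\<^sup>2 * A - 2 * t * I + B"
      using ii L2_integrable[OF assms(1)] L2_integrable[OF assms(2)]
      by (simp add: A_def B_def I_def sqnorm_def)
    finally show ?thesis .
  qed
  have I: "I \<ge> 0" by (simp add: I_def)
  have A: "A \<ge> 0" "B \<ge> 0" by (simp_all add: A_def B_def sqnorm_nonneg)
  have "I\<^sup>2 \<le> A * B"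
  proof (cases "A = 0")
    case True
    have "I = 0"
    proof (rule ccontr)
      assume "I \<noteq> 0"
      \<comment> \<open>With \<open>A = 0\<close> the polynomial is affine, and at this argument it has the value \<open>- 1\<close>.\<close>
      then have "2 * ((B + 1) / (2 * I)) * I = B + 1" by simp
      with quad[of "(B + 1) / (2 * I)"] True show False by simp
    qed
    then show ?thesis using True by simp
  next
    case False
    then have "A > 0" using A by simp
    then have "(I / A)\<^sup>2 * A - 2 * (I / A) * I + B = B - I\<^sup>2 / A"
      by (simp add: power2_eq_square field_simps)
    with quad[of "I / A"] have "I\<^sup>2 / A \<le> B" by simp
    then show ?thesis using \<open>A > 0\<close> by (simp add: pos_divide_le_eq mult.commute)
  qed
  moreover have "cmod (LINT x|lebesgue. f x * g x) \<le> I"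
    unfolding I_def norm_mult[symmetric] by (rule integral_norm_bound)
  then have "(cmod (LINT x|lebesgue. f x * g x))\<^sup>2 \<le> I\<^sup>2"
    by (intro power_mono) auto
  ultimately show ?thesis by (simp add: A_def B_def)
qed

lemma L2_dominated:
  fixes g :: "nat \<Rightarrow> 'd::finite cfun" and w :: "real^'d \<Rightarrow> real"
  assumes g: "\<And>n. g n \<in> borel_measurable lebesgue" and f: "f \<in> borel_measurable lebesgue"
    and lim: "AE x in lebesgue. (\<lambda>n. g n x) \<longlonglongrightarrow> f x"
    and dom: "\<And>n. AE x in lebesgue. cmod (g n x) \<le> w x"
    and w: "w \<in> borel_measurable lebesgue" "integrable lebesgue (\<lambda>x. (w x)\<^sup>2)"
  shows "L2 f" "\<And>n. L2 (g n)" "(\<lambda>n. sqnorm (\<lambda>x. f x - g n x)) \<longlonglongrightarrow> 0"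
proof -
  have domA: "AE x in lebesgue. \<forall>n. cmod (g n x) \<le> w x" using dom by (simp add: AE_all_countable)
  have fw: "AE x in lebesgue. cmod (f x) \<le> w x"
    using domA lim by eventually_elim (auto intro: LIMSEQ_le_const2 tendsto_norm)
  show "L2 f"
    by (rule L2_bound[OF f w(2)]) (use fw in \<open>eventually_elim, auto intro!: power_mono\<close>)
  show "L2 (g n)" for n
    by (rule L2_bound[OF g w(2)]) (use dom[of n] in \<open>eventually_elim, auto intro!: power_mono\<close>)
  have "(\<lambda>n. LINT x|lebesgue. (cmod (f x - g n x))\<^sup>2) \<longlonglongrightarrow> (LINT x|(lebesgue :: (real^'d) measure). 0)"
  proof (rule integral_dominated_convergence[where w = "\<lambda>x. 4 * (w x)\<^sup>2" and s = "\<lambda>n x. (cmod (f x - g n x))\<^sup>2" and f = "\<lambda>x. 0"])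
    show "AE x in lebesgue. (\<lambda>n. (cmod (f x - g n x))\<^sup>2) \<longlonglongrightarrow> (0::real)"
      using lim
    proof eventually_elim
      case (elim x)
      have "(\<lambda>n. (cmod (f x - g n x))\<^sup>2) \<longlonglongrightarrow> (cmod (f x - f x))\<^sup>2"
        by (intro tendsto_intros elim)
      then show ?case by simp
    qed
    show "AE x in lebesgue. norm ((cmod (f x - g n x))\<^sup>2) \<le> 4 * (w x)\<^sup>2" for n
      using fw domA
    proof eventually_elim
      case (elim x)
      have "cmod (f x - g n x) \<le> 2 * w x"
        using elim norm_triangle_ineq4[of "f x" "g n x"] spec[OF elim(2), of n] by linarith
      then have "(cmod (f x - g n x))\<^sup>2 \<le> (2 * w x)\<^sup>2" by (intro power_mono) auto
      then show ?case by simp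
    qed
  qed (use f g w in \<open>auto intro!: borel_measurable_power borel_measurable_norm borel_measurable_diff\<close>)
  then show "(\<lambda>n. sqnorm (\<lambda>x. f x - g n x)) \<longlonglongrightarrow> 0" by (simp add: sqnorm_def)
qed

lemma L2_indicator_bounded:
  assumes "E \<in> sets lebesgue" "bounded E"
  shows "L2 (indicator E)"
  by (rule L2_bounded_support[of _ 1]) (use assms in \<open>auto simp: indicator_def intro: bounded_subset\<close>)

lemma sqnorm_diff_AE_eq_0: "AE x in lebesgue. f x = g x \<Longrightarrow> f \<in> borel_measurable lebesgue \<Longrightarrow> g \<in> borel_measurable lebesgue \<Longrightarrow> sqnorm (\<lambda>x. f x - g x) = 0"
  unfolding sqnorm_def
  by (subst integral_cong_AE[of _ _ "\<lambda>_. 0"]) (auto intro!: borel_measurable_power borel_measurable_norm borel_measurable_diff)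

section \<open>Density of test functions\<close>

lemma box_symmetric_absorb: "norm x < R \<Longrightarrow> (x::real^'d::finite) \<in> box (\<chi> i. - R) (\<chi> i. R)"
  unfolding mem_box_cart using component_le_norm_cart[of x] by (auto simp: abs_le_iff) (smt (verit) component_le_norm_cart)+

text \<open>
  The property passes from boxes to Borel subsets of a large box \<open>B R\<close> because boxes are stable under
  intersection and the sets with the property form a Dynkin system, then to Lebesgue sets by changing null
  sets, to functions vanishing outside \<open>B R\<close> by approximation with simple functions, and to the general case
  by letting \<open>R\<close> tend to infinity.
\<close>

lemma L2_density_induct:
  fixes P :: "'d::finite cfun \<Rightarrow> bool"
  assumes add: "\<And>f g. P f \<Longrightarrow> P g \<Longrightarrow> L2 f \<Longrightarrow> L2 g \<Longrightarrow> P (\<lambda>x. f x + g x)"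
    and cmult: "\<And>c f. P f \<Longrightarrow> L2 f \<Longrightarrow> P (\<lambda>x. c * f x)"
    and lim: "\<And>f. L2 f \<Longrightarrow> (\<And>e. e > 0 \<Longrightarrow> \<exists>g. P g \<and> L2 g \<and> sqnorm (\<lambda>x. f x - g x) < e) \<Longrightarrow> P f"
    and box: "\<And>a b. P (indicator (box a b))"
    and "L2 f"
  shows "P f"
proof -
  have zero: "P (\<lambda>x. 0)" using box[of 0 0] by (simp add: indicator_def[abs_def])
  have seq: "P f" if "L2 f" "\<And>n. P (g n)" "\<And>n. L2 (g n)" "(\<lambda>n. sqnorm (\<lambda>x. f x - g n x)) \<longlonglongrightarrow> 0"
    for f and g :: "nat \<Rightarrow> 'd cfun"
  proof (rule lim[OF that(1)])
    fix e :: real assume "e > 0"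
    from order_tendstoD(2)[OF that(4) this] obtain n where "sqnorm (\<lambda>x. f x - g n x) < e"
      by (auto simp: eventually_sequentially)
    then show "\<exists>g. P g \<and> L2 g \<and> sqnorm (\<lambda>x. f x - g x) < e" using that by blast
  qed
  have sum: "P (\<lambda>x. \<Sum>a\<in>A. h a x) \<and> L2 (\<lambda>x. \<Sum>a\<in>A. h a x)"
    if "finite A" "\<And>a. a \<in> A \<Longrightarrow> P (h a) \<and> L2 (h a)" for A :: "'i set" and h
    using that by (induction A rule: finite_induct) (auto intro: zero L2_zero add L2_add)
  have sumn: "P (\<lambda>x. \<Sum>i<n. h i x) \<and> L2 (\<lambda>x. \<Sum>i<n. h i x)"
    if "\<And>a. P (h a) \<and> L2 (h a)" for n :: nat and h
    using that by (induction n) (auto intro: zero L2_zero add L2_add)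
  define B where "B = (\<lambda>R::real. box (\<chi> i::'d. - R) (\<chi> i. R))"
  have Bb: "bounded (B R)" "B R \<in> sets borel" for R by (auto simp: B_def)
  have borel: "P (indicator (E \<inter> B R))" if "E \<in> sets borel" for E R
  proof -
    have sb: "sets borel = sigma_sets UNIV (range (\<lambda>(a, b). box a b :: (real^'d) set))"
      by (subst borel_eq_box) (auto simp: sets_measure_of)
    have 3: "E \<in> sigma_sets UNIV (range (\<lambda>(a, b). box a b))" using that sb by simp
    have 1: "Int_stable (range (\<lambda>(a, b). box a b :: (real^'d) set))"
      by (auto simp: Int_stable_def box_Int_box)
    have 2: "range (\<lambda>(a, b). box a b :: (real^'d) set) \<subseteq> Pow UNIV" by simp
    from 1 2 3 show ?thesis
    proof (induction rule: sigma_sets_induct_disjoint)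
      case (basic A)
      then obtain p where p: "A = (case p of (a, b) \<Rightarrow> box a b)" by auto
      show ?case using box by (cases p) (simp add: p B_def box_Int_box)
    next
      case empty
      then show ?case using zero by (simp add: indicator_def)
    next
      case (compl A)
      have A: "A \<in> sets borel"
        using compl sb by simp
      have "P (\<lambda>x. indicator (B R) x + (- 1) * indicator (A \<inter> B R) x)"
        using compl box A Bb by (intro add cmult L2_cmult L2_indicator_bounded) (auto simp: B_def)
      moreover have "(\<lambda>x. indicator (B R) x + (- 1) * indicator (A \<inter> B R) x) = (indicator ((UNIV - A) \<inter> B R) :: 'd cfun)"
        by (auto simp: indicator_def)
      ultimately show ?case by simp
    next
      case (union A)
      have A: "A i \<in> sets borel" for i
        using union sb by auto
      have Ps: "P (\<lambda>x. \<Sum>i<n. indicator (A i \<inter> B R) x) \<and> L2 (\<lambda>x. \<Sum>i<n. indicator (A i \<inter> B R) x)" for n :: nat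
        using union A Bb by (intro sumn conjI L2_indicator_bounded) auto
      have eq: "(\<lambda>x. \<Sum>i<n. indicator (A i \<inter> B R) x) = (indicator (\<Union>i<n. A i \<inter> B R) :: 'd cfun)" for n
        using union(1) by (intro ext indicator_UN_disjoint[symmetric]) (auto simp: disjoint_family_on_def)
      note D = L2_dominated[of "\<lambda>n x. \<Sum>i<n. indicator (A i \<inter> B R) x" "indicator ((\<Union>i. A i) \<inter> B R)" "indicator (B R)"]
      have I: "L2 (indicator ((\<Union>i. A i) \<inter> B R) :: 'd cfun)"
        using A Bb by (intro L2_indicator_bounded) auto
      have L: "(\<lambda>n. sqnorm (\<lambda>x. indicator ((\<Union>i. A i) \<inter> B R) x - (\<Sum>i<n. indicator (A i \<inter> B R) x))) \<longlonglongrightarrow> 0"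
      proof (rule D(3))
        show "AE x in lebesgue. (\<lambda>n. \<Sum>i<n. indicator (A i \<inter> B R) x) \<longlonglongrightarrow> (indicator ((\<Union>i. A i) \<inter> B R) x :: complex)"
        proof (rule AE_I2)
          fix x
          have "(\<lambda>n. indicator (\<Union>i<n. A i \<inter> B R) x :: complex) \<longlonglongrightarrow> indicator (\<Union>i. A i \<inter> B R) x"
            by (rule LIMSEQ_indicator_UN)
          then show "(\<lambda>n. \<Sum>i<n. indicator (A i \<inter> B R) x) \<longlonglongrightarrow> (indicator ((\<Union>i. A i) \<inter> B R) x :: complex)"
            using fun_cong[OF eq] by simp
        qed
        show "AE x in lebesgue. cmod (\<Sum>i<n. indicator (A i \<inter> B R) x) \<le> indicator (B R) x" for n
          using fun_cong[OF eq[of n]] by (auto simp: indicator_def)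
        show "integrable lebesgue (\<lambda>x. (indicator (B R) x)\<^sup>2 :: real)"
          using L2_integrable[OF L2_indicator_bounded[of "B R"]] Bb by (simp add: indicator_def of_bool_def if_distrib cong: if_cong)
        have ms: "A i \<inter> B R \<in> sets lebesgue" "B R \<in> sets lebesgue" "(\<Union>i. A i) \<inter> B R \<in> sets lebesgue" for i
          using A Bb by auto
        show "(\<lambda>x. \<Sum>i<n. indicator (A i \<inter> B R) x :: complex) \<in> borel_measurable lebesgue" for n
          by (rule borel_measurable_sum, rule borel_measurable_indicator, rule ms(1))
        show "(indicator (\<Union> (range A) \<inter> B R) :: 'd cfun) \<in> borel_measurable lebesgue"
          by (rule borel_measurable_indicator, rule ms(3))
        show "indicat_real (B R) \<in> borel_measurable lebesgue"
          by (rule borel_measurable_indicator, rule ms(2))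
      qed
      show ?case by (rule seq[OF I _ _ L]) (use Ps in blast)+
    qed
  qed
  have leb: "P (indicator (E \<inter> B R))" if E: "E \<in> sets lebesgue" for E R
  proof -
    obtain A N N' where A: "E = A \<union> N" "N \<subseteq> N'" "N' \<in> null_sets lborel" "A \<in> sets lborel"
      using E by (rule sets_completionE)
    show ?thesis
    proof (rule lim)
      show "L2 (indicator (E \<inter> B R) :: 'd cfun)" using E Bb by (intro L2_indicator_bounded) auto
      fix e :: real assume "e > 0"
      have "AE x in lebesgue. x \<notin> N'" using A(3) by (intro AE_not_in) (auto intro: null_sets_completionI)
      then have "AE x in lebesgue. (indicator (E \<inter> B R) x :: complex) = indicator (A \<inter> B R) x"
        by eventually_elim (use A in \<open>auto simp: indicator_def\<close>)
      then have "sqnorm (\<lambda>x. indicator (E \<inter> B R) x - indicator (A \<inter> B R) x) = 0"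
        by (rule sqnorm_diff_AE_eq_0; intro borel_measurable_indicator sets.Int) (use A E Bb in auto)
      moreover have "P (indicator (A \<inter> B R))" "L2 (indicator (A \<inter> B R) :: 'd cfun)"
        using A Bb borel by (auto intro!: L2_indicator_bounded)
      ultimately show "\<exists>g. P g \<and> L2 g \<and> sqnorm (\<lambda>x. indicator (E \<inter> B R) x - g x) < e"
        using \<open>e > 0\<close> by (intro exI[of _ "indicator (A \<inter> B R)"]) auto
    qed
  qed
  have bnd: "P f" if "L2 f" "\<And>x. x \<notin> B R \<Longrightarrow> f x = 0" for f R
  proof -
    from borel_measurable_implies_sequence_metric[OF L2_measurable[OF that(1)], of 0] obtain s
      where s: "\<And>i. simple_function lebesgue (s i)" "\<And>x. (\<lambda>i. s i x) \<longlonglongrightarrow> f x"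
        and sb: "\<And>i x. cmod (s i x) \<le> 2 * cmod (f x)" by auto
    have rep: "s i = (\<lambda>x. \<Sum>y\<in>range (s i). y * indicator (s i -` {y} \<inter> B R) x)" for i
    proof
      fix x
      have fin: "finite (range (s i))" using s(1)[of i] by (simp add: simple_function_def)
      show "s i x = (\<Sum>y\<in>range (s i). y * indicator (s i -` {y} \<inter> B R) x)"
      proof (cases "x \<in> B R")
        case True
        then have "(\<Sum>y\<in>range (s i). y * indicator (s i -` {y} \<inter> B R) x) = (\<Sum>y\<in>range (s i). if y = s i x then s i x else 0)"
          by (intro sum.cong) (auto simp: indicator_def)
        also have "\<dots> = s i x" using fin by simp
        finally show ?thesis by simp
      next
        case False
        then show ?thesis using sb[of i x] that(2)[of x] by simp
      qed
    qed
    have Ps: "P (s i) \<and> L2 (s i)" for i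
    proof -
      have "P (\<lambda>x. \<Sum>y\<in>range (s i). y * indicator (s i -` {y} \<inter> B R) x) \<and> L2 (\<lambda>x. \<Sum>y\<in>range (s i). y * indicator (s i -` {y} \<inter> B R) x)"
      proof (rule sum)
        show "finite (range (s i))" using s(1)[of i] by (simp add: simple_function_def)
        fix y
        have "s i -` {y} \<in> sets lebesgue" using simple_functionD(2)[OF s(1), of i "{y}"] by simp
        then show "P (\<lambda>x. y * indicator (s i -` {y} \<inter> B R) x) \<and> L2 (\<lambda>x. y * indicator (s i -` {y} \<inter> B R) x)"
          using Bb by (intro conjI cmult leb L2_cmult L2_indicator_bounded) auto
      qed
      then show ?thesis using rep[of i] by simp
    qed
    have sm: "s n \<in> borel_measurable lebesgue" for n using Ps L2_measurable by blast
    have fm: "f \<in> borel_measurable lebesgue" using that(1) by (rule L2_measurable)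
    have "(\<lambda>n. sqnorm (\<lambda>x. f x - s n x)) \<longlonglongrightarrow> 0"
      by (rule L2_dominated(3)[where w = "\<lambda>x. 2 * cmod (f x)"])
         (use s(2) sb sm fm L2_integrable[OF that(1)] in \<open>auto simp: power_mult_distrib\<close>)
    then show ?thesis using seq[OF that(1)] Ps by blast
  qed
  have fm: "f \<in> borel_measurable lebesgue" using \<open>L2 f\<close> by (rule L2_measurable)
  have L2R: "L2 (\<lambda>x. indicator (B R) x * f x)" for R
  proof (rule L2_mult_bounded[where B = 1, OF \<open>L2 f\<close>])
    show "indicator (B R) \<in> borel_measurable lebesgue"
      by (rule borel_measurable_indicator) (use Bb in auto)
  qed (auto simp: indicator_def)
  have mR: "(\<lambda>x. indicator (B R) x * f x) \<in> borel_measurable lebesgue" for R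
    using L2R by (rule L2_measurable)
  have "(\<lambda>n. sqnorm (\<lambda>x. f x - indicator (B (real n)) x * f x)) \<longlonglongrightarrow> 0"
  proof (rule L2_dominated(3)[where w = "\<lambda>x. cmod (f x)"])
    show "AE x in lebesgue. (\<lambda>n. indicator (B (real n)) x * f x) \<longlonglongrightarrow> f x"
    proof (rule AE_I2, rule tendsto_eventually)
      fix x :: "real^'d"
      obtain N :: nat where "norm x < real N" using reals_Archimedean2 by blast
      then have "x \<in> B (real n)" if "n \<ge> N" for n
        unfolding B_def using that by (intro box_symmetric_absorb) linarith
      then show "\<forall>\<^sub>F n in sequentially. indicator (B (real n)) x * f x = f x"
        unfolding eventually_sequentially by (intro exI[of _ N]) simp
    qed
    show "AE x in lebesgue. cmod (indicator (B (real n)) x * f x) \<le> cmod (f x)" for n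
      by (auto simp: indicator_def)
  qed (use fm mR L2_integrable[OF \<open>L2 f\<close>] in auto)
  moreover have "P (\<lambda>x. indicator (B R) x * f x)" for R
    using L2R by (rule bnd[of _ R]) simp
  ultimately show ?thesis by (intro seq[OF \<open>L2 f\<close> _ L2R]) blast+
qed

lemma sqnorm_mult_indicator_le:
  assumes "S \<in> sets lebesgue" "L2 f"
  shows "L2 (\<lambda>x. indicator S x * f x)" "sqnorm (\<lambda>x. indicator S x * f x) \<le> sqnorm f"
proof -
  show 1: "L2 (\<lambda>x. indicator S x * f x)"
  proof (rule L2_mult_bounded[where B = 1, OF assms(2)])
    show "indicator S \<in> borel_measurable lebesgue"
      by (rule borel_measurable_indicator[OF assms(1)])
  qed (auto simp: indicator_def)
  show "sqnorm (\<lambda>x. indicator S x * f x) \<le> sqnorm f"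
    unfolding sqnorm_def using L2_integrable[OF 1] L2_integrable[OF assms(2)]
    by (intro integral_mono) (auto simp: indicator_def)
qed

text \<open>
  A criterion for density of a subspace \<open>V\<close> among the functions cut off to \<open>S\<close>. It serves twice: with \<open>S\<close> the
  whole space for test functions, and with \<open>S\<close> the fundamental cube for trigonometric polynomials.
\<close>

lemma L2_approx:
  fixes V :: "'d::finite cfun \<Rightarrow> bool"
  assumes S: "S \<in> sets lebesgue"
    and VL: "\<And>f. V f \<Longrightarrow> L2 f"
    and Vadd: "\<And>f g. V f \<Longrightarrow> V g \<Longrightarrow> V (\<lambda>x. f x + g x)"
    and Vcmult: "\<And>c f. V f \<Longrightarrow> V (\<lambda>x. c * f x)"
    and box: "\<And>a b e. e > 0 \<Longrightarrow> \<exists>g. V g \<and> sqnorm (\<lambda>x. indicator S x * indicator (box a b) x - g x) < e"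
    and "L2 f" "e > 0"
  shows "\<exists>g. V g \<and> sqnorm (\<lambda>x. indicator S x * f x - g x) < e"
proof -
  have "\<forall>e>0. \<exists>g. V g \<and> sqnorm (\<lambda>x. indicator S x * f x - g x) < e"
    using \<open>L2 f\<close>
  proof (rule L2_density_induct[rotated -1]; intro allI impI)
    fix f g :: "'d cfun" and e :: real
    assume f: "\<forall>e>0. \<exists>h. V h \<and> sqnorm (\<lambda>x. indicator S x * f x - h x) < e"
      and g: "\<forall>e>0. \<exists>h. V h \<and> sqnorm (\<lambda>x. indicator S x * g x - h x) < e"
      and L: "L2 f" "L2 g" "e > 0"
    from f[rule_format, of "e/4"] g[rule_format, of "e/4"] \<open>e > 0\<close> obtain h k
      where h: "V h" "sqnorm (\<lambda>x. indicator S x * f x - h x) < e/4"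
        and k: "V k" "sqnorm (\<lambda>x. indicator S x * g x - k x) < e/4" by auto
    have "sqnorm (\<lambda>x. (indicator S x * f x - h x) + (indicator S x * g x - k x)) < e"
      using sqnorm_add_le[of "\<lambda>x. indicator S x * f x - h x" "\<lambda>x. indicator S x * g x - k x"] h k
        sqnorm_mult_indicator_le(1)[OF S L(1)] sqnorm_mult_indicator_le(1)[OF S L(2)]
      by (simp add: L2_diff VL)
    then show "\<exists>h. V h \<and> sqnorm (\<lambda>x. indicator S x * (f x + g x) - h x) < e"
      using h k by (intro exI[of _ "\<lambda>x. h x + k x"]) (auto simp: Vadd algebra_simps)
  next
    fix c and f :: "'d cfun" and e :: real
    assume f: "\<forall>e>0. \<exists>h. V h \<and> sqnorm (\<lambda>x. indicator S x * f x - h x) < e" and "L2 f" "e > 0"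
    have c: "(cmod c)\<^sup>2 + 1 > 0" by (simp add: add_nonneg_pos)
    then obtain h where h: "V h" "sqnorm (\<lambda>x. indicator S x * f x - h x) < e / ((cmod c)\<^sup>2 + 1)"
      using f[rule_format, of "e / ((cmod c)\<^sup>2 + 1)"] \<open>e > 0\<close> by auto
    have "sqnorm (\<lambda>x. c * (indicator S x * f x - h x)) \<le> ((cmod c)\<^sup>2 + 1) * sqnorm (\<lambda>x. indicator S x * f x - h x)"
      unfolding sqnorm_cmult using sqnorm_nonneg by (intro mult_right_mono) auto
    also have "\<dots> < e" using h(2) c by (simp add: pos_less_divide_eq mult.commute)
    finally show "\<exists>h. V h \<and> sqnorm (\<lambda>x. indicator S x * (c * f x) - h x) < e"
      using h by (intro exI[of _ "\<lambda>x. c * h x"]) (auto simp: Vcmult algebra_simps)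
  next
    fix f :: "'d cfun" and e :: real
    assume f: "L2 f" and "e > 0" and ap: "\<And>e. e > 0 \<Longrightarrow> \<exists>g. (\<forall>e>0. \<exists>h. V h \<and> sqnorm (\<lambda>x. indicator S x * g x - h x) < e) \<and> L2 g \<and> sqnorm (\<lambda>x. f x - g x) < e"
    obtain g where g: "\<forall>e>0. \<exists>h. V h \<and> sqnorm (\<lambda>x. indicator S x * g x - h x) < e" "L2 g" "sqnorm (\<lambda>x. f x - g x) < e/4"
      using ap[of "e/4"] \<open>e > 0\<close> by auto
    obtain h where h: "V h" "sqnorm (\<lambda>x. indicator S x * g x - h x) < e/4"
      using g(1)[rule_format, of "e/4"] \<open>e > 0\<close> by auto
    note r = sqnorm_mult_indicator_le[OF S L2_diff[OF f g(2)]]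
    have "sqnorm (\<lambda>x. indicator S x * (f x - g x) + (indicator S x * g x - h x)) < e"
      using sqnorm_add_le[of "\<lambda>x. indicator S x * (f x - g x)" "\<lambda>x. indicator S x * g x - h x"] h g r
        sqnorm_mult_indicator_le(1)[OF S g(2)]
      by (simp add: L2_diff VL)
    then show "\<exists>h. V h \<and> sqnorm (\<lambda>x. indicator S x * f x - h x) < e" using h by (auto simp: algebra_simps)
  qed (rule box)
  then show ?thesis using \<open>e > 0\<close> by blast
qed

lemma test_fun_dense:
  assumes "L2 f" "e > 0"
  shows "\<exists>g. test_fun g \<and> sqnorm (\<lambda>x. f x - g x) < e"
proof -
  have "\<exists>g. test_fun g \<and> sqnorm (\<lambda>x. indicator UNIV x * f x - g x) < e"
  proof (rule L2_approx[OF _ L2_test_fun test_fun_add test_fun_cmult _ assms])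
    fix a b :: "real^'a" and e :: real assume "e > 0"
    have "(\<lambda>n. sqnorm (\<lambda>x. indicator (box a b) x - bump a b n x)) \<longlonglongrightarrow> 0"
    proof (rule L2_dominated(3)[where w = "indicator (box a b)"])
      show "AE x in lebesgue. (\<lambda>n. bump a b n x) \<longlonglongrightarrow> indicator (box a b) x"
      proof (rule AE_I2)
        fix x show "(\<lambda>n. bump a b n x) \<longlonglongrightarrow> indicator (box a b) x"
          using tendsto_of_real[OF real_bump_lim[of a b x], where 'a = complex]
          by (cases "x \<in> box a b") (simp_all add: bump_def)
      qed
      show "AE x in lebesgue. cmod (bump a b n x) \<le> indicator (box a b) x" for n
        using real_bump_01[of a b n] real_bump_outside[of _ a b n] by (auto simp: bump_def indicator_def)
      show "integrable lebesgue (\<lambda>x. (indicator (box a b) x)\<^sup>2 :: real)"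
        using L2_integrable[OF L2_indicator_bounded[of "box a b"]] by (simp add: indicator_def of_bool_def if_distrib cong: if_cong)
    qed (auto intro: test_fun_measurable test_fun_bump intro!: borel_measurable_indicator)
    from order_tendstoD(2)[OF this \<open>e > 0\<close>]
    show "\<exists>h. test_fun h \<and> sqnorm (\<lambda>x. indicator UNIV x * indicator (box a b) x - h x) < e"
      using test_fun_bump[of a b] unfolding eventually_sequentially by auto
  qed auto
  then show ?thesis by simp
qed

section \<open>Completeness and representation of functionals\<close>

text \<open>
  The increments \<open>d i\<close> have squared norm at most \<open>8\<^sup>-\<^sup>i\<close>, so \<open>W = \<Sum> 4\<^sup>i |d i|\<^sup>2\<close> is integrable. By Cauchy--Schwarz
  against \<open>2\<^sup>-\<^sup>i\<close> the sum of all \<open>|d i|\<close> is at most \<open>sqrt (2 W)\<close>, which gives pointwise convergence almost everywhere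
  together with a square integrable majorant.
\<close>

lemma L2_complete:
  fixes f :: "nat \<Rightarrow> 'd::finite cfun"
  assumes L2: "\<And>n. L2 (f n)" and fast: "\<And>n. sqnorm (\<lambda>x. f (Suc n) x - f n x) \<le> (1/8)^n"
  shows "\<exists>g. L2 g \<and> (\<lambda>n. sqnorm (\<lambda>x. g x - f n x)) \<longlonglongrightarrow> 0"
proof -
  define d where "d = (\<lambda>n x. f (Suc n) x - f n x)"
  define W where "W = (\<lambda>x. \<Sum>i. 4^i * (cmod (d i x))\<^sup>2)"
  have Ld: "L2 (d n)" for n unfolding d_def by (intro L2_diff L2)
  have fm[measurable]: "f n \<in> borel_measurable lebesgue" and dm[measurable]: "d n \<in> borel_measurable lebesgue" for n
    using L2 Ld L2_measurable by auto
  have di: "integrable lebesgue (\<lambda>x. 4^n * (cmod (d n x))\<^sup>2)" for n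
    using L2_integrable[OF Ld] by simp
  have dI: "(LINT x|lebesgue. 4^n * (cmod (d n x))\<^sup>2) \<le> (1/2)^n" for n
  proof -
    have "(LINT x|lebesgue. 4^n * (cmod (d n x))\<^sup>2) = 4^n * sqnorm (d n)" by (simp add: sqnorm_def)
    also have "\<dots> \<le> 4^n * (1/8)^n" using fast[of n] by (intro mult_left_mono) (auto simp: d_def)
    also have "\<dots> = (1/2)^n" by (simp add: power_mult_distrib[symmetric])
    finally show ?thesis .
  qed
  have dI0: "0 \<le> (LINT x|lebesgue. 4^n * (cmod (d n x))\<^sup>2)" for n by simp
  have sI: "summable (\<lambda>n. LINT x|lebesgue. 4^n * (cmod (d n x))\<^sup>2)"
    by (rule summable_comparison_test'[of "\<lambda>n. (1/2)^n" 0]) (use dI dI0 in \<open>auto simp del: integral_mult_right_zero\<close>)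
  have summ: "AE x in lebesgue. summable (\<lambda>i. 4^i * (cmod (d i x))\<^sup>2)"
  proof -
    have "(\<integral>\<^sup>+x. (\<Sum>i. ennreal (4^i * (cmod (d i x))\<^sup>2)) \<partial>lebesgue) = (\<Sum>i. \<integral>\<^sup>+x. ennreal (4^i * (cmod (d i x))\<^sup>2) \<partial>lebesgue)"
      by (rule nn_integral_suminf) measurable
    also have "\<dots> = (\<Sum>i. ennreal (LINT x|lebesgue. 4^i * (cmod (d i x))\<^sup>2))"
      by (intro arg_cong[of _ _ suminf] ext nn_integral_eq_integral di) auto
    also have "\<dots> = ennreal (\<Sum>i. LINT x|lebesgue. 4^i * (cmod (d i x))\<^sup>2)"
      by (rule suminf_ennreal2) (use sI dI0 in auto)
    finally have "(\<integral>\<^sup>+x. (\<Sum>i. ennreal (4^i * (cmod (d i x))\<^sup>2)) \<partial>lebesgue) \<noteq> \<infinity>" by simp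
    then have "AE x in lebesgue. (\<Sum>i. ennreal (4^i * (cmod (d i x))\<^sup>2)) \<noteq> \<infinity>"
      by (intro nn_integral_PInf_AE) measurable
    then show ?thesis
      by eventually_elim (rule summable_suminf_not_top, auto)
  qed
  have Wi: "integrable lebesgue W" unfolding W_def
    by (rule integrable_suminf[OF di]) (use summ sI in auto)
  have Wm: "W \<in> borel_measurable lebesgue" using Wi by simp
  have bnd: "(\<Sum>i<m. cmod (d i x)) \<le> sqrt (2 * W x)" if "summable (\<lambda>i. 4^i * (cmod (d i x))\<^sup>2)" for x m
  proof -
    have "(\<Sum>i<m. (1/2)^i * (2^i * cmod (d i x)))\<^sup>2 \<le> (\<Sum>i<m. ((1/2)^i)\<^sup>2) * (\<Sum>i<m. (2^i * cmod (d i x))\<^sup>2)"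
      by (rule Cauchy_Schwarz_ineq_sum)
    also have "(\<Sum>i<m. (2^i * cmod (d i x))\<^sup>2) = (\<Sum>i<m. 4^i * (cmod (d i x))\<^sup>2)"
      by (intro sum.cong refl) (simp add: power_mult_distrib power2_eq_square flip: power_mult_distrib[of 2 2])
    also have "(\<Sum>i<m. ((1/2)^i)\<^sup>2 :: real) * (\<Sum>i<m. 4^i * (cmod (d i x))\<^sup>2) \<le> 2 * W x"
    proof (intro mult_mono)
      have "(\<Sum>i<m. ((1/2)^i)\<^sup>2 :: real) = (\<Sum>i<m. (1/4)^i)"
        by (intro sum.cong refl) (simp add: power2_eq_square flip: power_mult_distrib)
      also have "\<dots> = (4/3) * (1 - (1/4)^m)"
        by (subst sum_gp_strict) (simp add: field_simps)
      also have "\<dots> \<le> 2"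
        by (rule order_trans[of _ "4/3"]) auto
      finally show "(\<Sum>i<m. ((1/2)^i)\<^sup>2 :: real) \<le> 2" .
      show "(\<Sum>i<m. 4^i * (cmod (d i x))\<^sup>2) \<le> W x"
        unfolding W_def by (rule sum_le_suminf[OF that]) auto
    qed (auto intro: sum_nonneg)
    finally have "(\<Sum>i<m. (1/2)^i * (2^i * cmod (d i x)))\<^sup>2 \<le> 2 * W x" .
    moreover have "(\<Sum>i<m. (1/2)^i * (2^i * cmod (d i x))) = (\<Sum>i<m. cmod (d i x))"
      by (intro sum.cong) (auto simp: power_divide)
    ultimately show ?thesis by (simp add: real_le_rsqrt)
  qed
  have tele: "f m x = f 0 x + (\<Sum>i<m. d i x)" for m x
    by (induction m) (auto simp: d_def)
  define g where "g = (\<lambda>x. lim (\<lambda>n. f n x))"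
  have gm: "g \<in> borel_measurable lebesgue" unfolding g_def by (rule borel_measurable_lim_metric) measurable
  define w where "w = (\<lambda>x. cmod (f 0 x) + sqrt (2 * W x))"
  have lim: "AE x in lebesgue. (\<lambda>n. f n x) \<longlonglongrightarrow> g x"
    using summ
  proof eventually_elim
    case (elim x)
    have "summable (\<lambda>i. cmod (d i x))"
      by (rule summableI_nonneg_bounded[of _ "sqrt (2 * W x)"]) (use bnd[OF elim] in auto)
    then have "summable (\<lambda>i. d i x)" by (rule summable_norm_cancel)
    then have "(\<lambda>m. f 0 x + (\<Sum>i<m. d i x)) \<longlonglongrightarrow> f 0 x + (\<Sum>i. d i x)"
      by (intro tendsto_intros summable_LIMSEQ)
    then have "convergent (\<lambda>m. f m x)" unfolding tele[symmetric] by (rule convergentI)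
    then show ?case by (simp add: g_def convergent_LIMSEQ_iff)
  qed
  have dom: "AE x in lebesgue. cmod (f n x) \<le> w x" for n
    using summ
  proof eventually_elim
    case (elim x)
    have "cmod (f n x) \<le> cmod (f 0 x) + cmod (\<Sum>i<n. d i x)"
      unfolding tele[of n x] by (rule norm_triangle_ineq)
    also have "cmod (\<Sum>i<n. d i x) \<le> (\<Sum>i<n. cmod (d i x))" by (rule norm_sum)
    also have "\<dots> \<le> sqrt (2 * W x)" by (rule bnd[OF elim])
    finally show ?case by (simp add: w_def)
  qed
  have W0: "AE x in lebesgue. 0 \<le> W x"
    using summ by eventually_elim (auto simp: W_def intro!: suminf_nonneg)
  have wi: "integrable lebesgue (\<lambda>x. (w x)\<^sup>2)"
  proof (rule Bochner_Integration.integrable_bound[of _ "\<lambda>x. 2 * (cmod (f 0 x))\<^sup>2 + 4 * W x"])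
    show "integrable lebesgue (\<lambda>x. 2 * (cmod (f 0 x))\<^sup>2 + 4 * W x)"
      using L2_integrable[OF L2[of 0]] Wi by auto
    show "(\<lambda>x. (w x)\<^sup>2) \<in> borel_measurable lebesgue"
      unfolding w_def using Wm by measurable
    show "AE x in lebesgue. norm ((w x)\<^sup>2) \<le> norm (2 * (cmod (f 0 x))\<^sup>2 + 4 * W x)"
      using W0
    proof eventually_elim
      case (elim x)
      have "(w x)\<^sup>2 \<le> 2 * (cmod (f 0 x))\<^sup>2 + 2 * (sqrt (2 * W x))\<^sup>2"
        unfolding w_def using zero_le_power2[of "cmod (f 0 x) - sqrt (2 * W x)"]
        by (simp add: power2_eq_square algebra_simps)
      then show ?case using elim by simp
    qed
  qed
  have wm: "w \<in> borel_measurable lebesgue" unfolding w_def using Wm by measurable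
  note L2_dominated[OF fm gm lim dom wm wi]
  then show ?thesis by blast
qed

lemma pair_fun_integrable: "L2 f \<Longrightarrow> L2 g \<Longrightarrow> integrable lebesgue (\<lambda>x. f x * cnj (g x))"
  by (intro L2_prod_integrable L2_cnj)

lemma pair_fun_add: "L2 f \<Longrightarrow> L2 f' \<Longrightarrow> L2 g \<Longrightarrow> pair_fun (\<lambda>x. f x + f' x) g = pair_fun f g + pair_fun f' g"
  unfolding pair_fun_def distrib_right by (intro Bochner_Integration.integral_add pair_fun_integrable)

lemma pair_fun_cmult: "pair_fun (\<lambda>x. c * f x) g = c * pair_fun f g"
  unfolding pair_fun_def by (simp add: mult.assoc)

lemma pair_fun_diff: "L2 f \<Longrightarrow> L2 f' \<Longrightarrow> L2 g \<Longrightarrow> pair_fun (\<lambda>x. f x - f' x) g = pair_fun f g - pair_fun f' g"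
  unfolding pair_fun_def left_diff_distrib by (intro Bochner_Integration.integral_diff pair_fun_integrable)

lemma pair_fun_self: "pair_fun f f = of_real (sqnorm f)"
  unfolding pair_fun_def sqnorm_def complex_norm_square[symmetric] by (rule integral_complex_of_real)

lemma pair_fun_bound: "L2 f \<Longrightarrow> L2 g \<Longrightarrow> (cmod (pair_fun f g))\<^sup>2 \<le> sqnorm f * sqnorm g"
  using L2_Cauchy_Schwarz[of f "\<lambda>x. cnj (g x)"] by (simp add: pair_fun_def L2_cnj sqnorm_cnj)

lemma sqnorm_add_expand:
  assumes "L2 f" "L2 h"
  shows "sqnorm (\<lambda>x. f x + c * h x) = sqnorm f + 2 * Re (cnj c * pair_fun f h) + (cmod c)\<^sup>2 * sqnorm h"
proof -
  define k where "k = (\<lambda>x. Re (cnj c * (f x * cnj (h x))))"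
  have eq: "(cmod (f x + c * h x))\<^sup>2 = (cmod (f x))\<^sup>2 + 2 * k x + (cmod c)\<^sup>2 * (cmod (h x))\<^sup>2" for x
    unfolding cmod_power2 k_def by (simp add: power2_eq_square algebra_simps)
  have ki: "integrable lebesgue k"
    unfolding k_def using pair_fun_integrable[OF assms] by (intro integrable_Re integrable_mult_right) auto
  have kI: "(LINT x|lebesgue. k x) = Re (cnj c * pair_fun f h)"
    unfolding pair_fun_def k_def using pair_fun_integrable[OF assms]
    by (subst integral_Re) (auto simp del: times_complex.sel complex_cnj_mult)
  show ?thesis
    unfolding sqnorm_def eq kI[symmetric]
    using L2_integrable[OF assms(1)] L2_integrable[OF assms(2)] ki by simp
qed

lemma pair_fun_tendsto:
  assumes "\<And>n. L2 (f n)" "L2 u" "L2 h" "(\<lambda>n. sqnorm (\<lambda>x. u x - f n x)) \<longlonglongrightarrow> 0"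
  shows "(\<lambda>n. pair_fun (f n) h) \<longlonglongrightarrow> pair_fun u h"
proof -
  have "(\<lambda>n. sqrt (sqnorm (\<lambda>x. u x - f n x) * sqnorm h)) \<longlonglongrightarrow> sqrt (0 * sqnorm h)"
    by (intro tendsto_intros assms)
  then have s: "(\<lambda>n. sqrt (sqnorm (\<lambda>x. u x - f n x) * sqnorm h)) \<longlonglongrightarrow> 0" by simp
  have "(\<lambda>n. pair_fun u h - pair_fun (f n) h) \<longlonglongrightarrow> 0"
  proof (rule Lim_null_comparison[OF _ s], intro always_eventually allI)
    fix n
    have "(cmod (pair_fun (\<lambda>x. u x - f n x) h))\<^sup>2 \<le> sqnorm (\<lambda>x. u x - f n x) * sqnorm h"
      by (rule pair_fun_bound) (auto intro: L2_diff assms)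
    then show "cmod (pair_fun u h - pair_fun (f n) h) \<le> sqrt (sqnorm (\<lambda>x. u x - f n x) * sqnorm h)"
      by (simp add: pair_fun_diff assms real_le_rsqrt)
  qed
  then have "(\<lambda>n. pair_fun u h - (pair_fun u h - pair_fun (f n) h)) \<longlonglongrightarrow> pair_fun u h - 0"
    by (intro tendsto_intros)
  then show ?thesis by simp
qed

lemma sqnorm_tendsto:
  assumes "\<And>n. L2 (f n)" "L2 u" "(\<lambda>n. sqnorm (\<lambda>x. u x - f n x)) \<longlonglongrightarrow> 0"
  shows "(\<lambda>n. sqnorm (f n)) \<longlonglongrightarrow> sqnorm u"
proof -
  have "sqnorm (f n) = sqnorm u + 2 * Re (- pair_fun u (\<lambda>x. u x - f n x)) + sqnorm (\<lambda>x. u x - f n x)" for n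
    using sqnorm_add_expand[OF assms(2) L2_diff[OF assms(2) assms(1)], of "-1" n] by simp
  moreover have "(\<lambda>n. sqnorm u + 2 * Re (- pair_fun u (\<lambda>x. u x - f n x)) + sqnorm (\<lambda>x. u x - f n x)) \<longlonglongrightarrow> sqnorm u + 2 * Re (- 0) + 0"
  proof (intro tendsto_intros assms)
    have "(\<lambda>n. sqrt (sqnorm u * sqnorm (\<lambda>x. u x - f n x))) \<longlonglongrightarrow> sqrt (sqnorm u * 0)"
      by (intro tendsto_intros assms)
    then have s: "(\<lambda>n. sqrt (sqnorm u * sqnorm (\<lambda>x. u x - f n x))) \<longlonglongrightarrow> 0" by simp
    show "(\<lambda>n. pair_fun u (\<lambda>x. u x - f n x)) \<longlonglongrightarrow> 0"
      by (rule Lim_null_comparison[OF always_eventually s])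
         (auto intro!: real_le_rsqrt pair_fun_bound L2_diff assms)
  qed
  ultimately show ?thesis by simp
qed

text \<open>
  The function sought is the conjugate of a limit of test functions that minimize \<open>F f = \<parallel>f\<parallel>\<^sup>2 - 2 Re (T f)\<close>.
  The parallelogram law makes a fast minimizing sequence a Cauchy sequence, and minimality of the limit in the
  direction of a test function \<open>h\<close> forces \<open>T h\<close> to be the pairing with it.
\<close>

lemma Riesz_test:
  fixes T :: "'d::finite functional"
  assumes add: "\<And>f g. test_fun f \<Longrightarrow> test_fun g \<Longrightarrow> T (\<lambda>x. f x + g x) = T f + T g"
    and cmult: "\<And>c f. test_fun f \<Longrightarrow> T (\<lambda>x. c * f x) = c * T f"
    and bound: "\<And>f. test_fun f \<Longrightarrow> (cmod (T f))\<^sup>2 \<le> C * sqnorm f" and C: "C \<ge> 0"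
  shows "\<exists>\<phi>. L2 \<phi> \<and> represents \<phi> T"
proof -
  define F where "F = (\<lambda>f. sqnorm f - 2 * Re (T f))"
  define m where "m = Inf (F ` Collect test_fun)"
  have low: "F f \<ge> - C" if f: "test_fun f" for f
  proof -
    have "Re (T f) \<le> sqrt C * sqrt (sqnorm f)"
      using complex_Re_le_cmod[of "T f"] real_le_rsqrt[OF bound[OF f]] by (simp add: real_sqrt_mult)
    moreover have "0 \<le> (sqrt C - sqrt (sqnorm f))\<^sup>2" by simp
    ultimately show ?thesis using C sqnorm_nonneg[of f]
      by (simp add: F_def power2_diff)
  qed
  have bdd: "bdd_below (F ` Collect test_fun)" using low by (auto intro!: bdd_belowI[of _ "-C"])
  have mle: "m \<le> F f" if "test_fun f" for f
    unfolding m_def using that by (intro cInf_lower bdd) auto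
  have "\<exists>f. test_fun f \<and> F f < m + (1/8)^n / 4" for n :: nat
  proof -
    have ne: "F ` Collect test_fun \<noteq> {}" using test_fun_zero by auto
    have lt: "Inf (F ` Collect test_fun) < m + (1/8)^n / 4" by (simp add: m_def)
    obtain z where "z \<in> F ` Collect test_fun" "z < m + (1/8)^n / 4"
      using cInf_lessD[OF ne lt] by blast
    then show ?thesis by auto
  qed
  then obtain f where f: "\<And>n. test_fun (f n)" and fF: "\<And>n::nat. F (f n) < m + (1/8)^n / 4"
    using choice[of "\<lambda>n f. test_fun f \<and> F f < m + (1/8)^n / 4"] by blast
  have fL: "L2 (f n)" for n using f by (rule L2_test_fun)
  have "sqnorm (\<lambda>x. f (Suc n) x - f n x) \<le> (1/8)^n" for n
  proof -
    let ?f = "f (Suc n)" and ?g = "f n"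
    \<comment> \<open>Since \<open>F\<close> is at least \<open>m\<close> at the midpoint, the parallelogram law bounds the distance.\<close>
    define h where "h = (\<lambda>x. (1/2) * (?f x + 1 * ?g x))"
    have th: "test_fun h" unfolding h_def using test_fun_cmult[OF test_fun_add[OF f f, of "Suc n" n], of "1/2"] by simp
    have h1: "sqnorm h = (1/4) * sqnorm (\<lambda>x. ?f x + 1 * ?g x)"
      unfolding h_def sqnorm_cmult by (simp add: power2_eq_square)
    have h2: "sqnorm (\<lambda>x. ?f x + 1 * ?g x) = sqnorm ?f + 2 * Re (pair_fun ?f ?g) + sqnorm ?g"
      using sqnorm_add_expand[OF fL fL, of "Suc n" 1 n] by simp
    have h3: "sqnorm (\<lambda>x. ?f x - ?g x) = sqnorm ?f - 2 * Re (pair_fun ?f ?g) + sqnorm ?g"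
      using sqnorm_add_expand[OF fL fL, of "Suc n" "-1" n] by simp
    have "T h = (1/2) * (T ?f + T ?g)"
      unfolding h_def using cmult[OF test_fun_add[OF f f, of "Suc n" n], of "1/2"] add[OF f f, of "Suc n" n] by simp
    then have h4: "Re (T h) = (Re (T ?f) + Re (T ?g)) / 2"
      by (simp del: divide_eq_eq_numeral1 eq_divide_eq_numeral1)
    have "sqnorm (\<lambda>x. ?f x - ?g x) = 2 * F ?f + 2 * F ?g - 4 * F h"
      unfolding F_def using h1 h2 h3 h4 by argo
    also have "\<dots> \<le> (1/8)^n"
    proof -
      define p :: real where "p = (1/8)^n"
      have "F ?g < m + p / 4" using fF[of n] by (simp add: p_def)
      moreover have "F ?f < m + p / 32" using fF[of "Suc n"] by (simp add: p_def)
      moreover have "m \<le> F h" using mle[OF th] .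
      moreover have "p > 0" by (simp add: p_def)
      ultimately show ?thesis unfolding p_def[symmetric] by argo
    qed
    finally show ?thesis .
  qed
  from L2_complete[OF fL this] obtain u where u: "L2 u" "(\<lambda>n. sqnorm (\<lambda>x. u x - f n x)) \<longlonglongrightarrow> 0" by blast
  have Fm: "(\<lambda>n. F (f n)) \<longlonglongrightarrow> m"
  proof (rule real_tendsto_sandwich[OF _ _ tendsto_const])
    show "\<forall>\<^sub>F n in sequentially. m \<le> F (f n)" using mle f by simp
    show "\<forall>\<^sub>F n in sequentially. F (f n) \<le> m + (1/8)^n / 4" by (rule always_eventually, rule allI, rule less_imp_le, rule fF)
    have "(\<lambda>n. m + (1/8)^n / 4) \<longlonglongrightarrow> m + 0 / 4"
      by (intro tendsto_intros LIMSEQ_realpow_zero) auto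
    then show "(\<lambda>n. m + (1/8)^n / 4) \<longlonglongrightarrow> m" by simp
  qed
  have "T h = (LINT x|lebesgue. cnj (u x) * h x)" if h: "test_fun h" for h
  proof -
    have hL: "L2 h" using h by (rule L2_test_fun)
    define z where "z = cnj (pair_fun u h) - T h"
    have key: "0 \<le> 2 * Re (c * z) + (cmod c)\<^sup>2 * sqnorm h" for c
    proof -
      have "m \<le> F (f n) + 2 * Re (cnj c * pair_fun (f n) h - c * T h) + (cmod c)\<^sup>2 * sqnorm h" for n
      proof -
        have t: "test_fun (\<lambda>x. f n x + c * h x)" using test_fun_add[OF f test_fun_cmult[OF h]] .
        have "T (\<lambda>x. f n x + c * h x) = T (f n) + c * T h"
          using add[OF f test_fun_cmult[OF h]] cmult[OF h] by simp
        then have "F (\<lambda>x. f n x + c * h x) = F (f n) + 2 * Re (cnj c * pair_fun (f n) h - c * T h) + (cmod c)\<^sup>2 * sqnorm h"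
          by (simp add: F_def sqnorm_add_expand[OF fL hL] del: complex_cnj_mult times_complex.sel)
        with mle[OF t] show ?thesis by simp
      qed
      moreover have "(\<lambda>n. F (f n) + 2 * Re (cnj c * pair_fun (f n) h - c * T h) + (cmod c)\<^sup>2 * sqnorm h) \<longlonglongrightarrow>
         m + 2 * Re (cnj c * pair_fun u h - c * T h) + (cmod c)\<^sup>2 * sqnorm h"
        by (intro tendsto_intros Fm pair_fun_tendsto fL u hL)
      ultimately have "m \<le> m + 2 * Re (cnj c * pair_fun u h - c * T h) + (cmod c)\<^sup>2 * sqnorm h"
        by (intro LIMSEQ_le_const) auto
      moreover have "Re (cnj c * pair_fun u h - c * T h) = Re (c * z)"
        by (simp add: z_def algebra_simps)
      ultimately show ?thesis by simp
    qed
    have "z = 0"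
    proof (rule ccontr)
      assume "z \<noteq> 0"
      \<comment> \<open>For a step of this size against \<open>cnj z\<close> the linear decrease exceeds the quadratic term.\<close>
      define t where "t = 1 / (sqnorm h + 1)"
      have t: "t > 0" "t * sqnorm h < 1" using sqnorm_nonneg[of h] by (auto simp: t_def field_simps)
      have "Re ((- of_real t * cnj z) * z) = - t * (cmod z)\<^sup>2"
        unfolding cmod_power2 by (simp add: power2_eq_square algebra_simps)
      moreover have "(cmod (- of_real t * cnj z))\<^sup>2 = t\<^sup>2 * (cmod z)\<^sup>2"
        by (simp add: norm_mult power_mult_distrib)
      ultimately have "0 \<le> t * (cmod z)\<^sup>2 * (t * sqnorm h - 2)"
        using key[of "- of_real t * cnj z"] by (simp add: power2_eq_square algebra_simps)
      moreover have "t * (cmod z)\<^sup>2 * (t * sqnorm h - 2) < 0"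
        using t \<open>z \<noteq> 0\<close> by (intro mult_pos_neg mult_pos_pos) auto
      ultimately show False by simp
    qed
    then have "T h = cnj (LINT x|lebesgue. u x * cnj (h x))"
      by (simp add: z_def pair_fun_def)
    also have "\<dots> = (LINT x|lebesgue. cnj (u x) * h x)"
      using Bochner_Integration.integral_cnj[of lebesgue "\<lambda>x. u x * cnj (h x)"] by simp
    finally show ?thesis .
  qed
  then show ?thesis using L2_cnj[OF u(1)] by (auto simp: represents_def)
qed

section \<open>Orthogonal systems and polarization\<close>

text \<open>
  The last conjunct only serves the induction: subtracting further members of the system leaves the remaining coefficients unchanged.
\<close>

lemma sqnorm_orthogonal_sum:
  fixes E :: "'k \<Rightarrow> 'd::finite cfun"
  assumes P: "L2 P" and E: "\<And>k. k \<in> Z \<Longrightarrow> L2 (E k)"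
    and orth: "\<And>k l. k \<in> Z \<Longrightarrow> l \<in> Z \<Longrightarrow> pair_fun (E k) (E l) = (if k = l then of_real B else 0)"
    and K: "finite K" "K \<subseteq> Z"
  shows "L2 (\<lambda>x. P x - (\<Sum>k\<in>K. c k * E k x)) \<and>
    sqnorm (\<lambda>x. P x - (\<Sum>k\<in>K. c k * E k x)) =
      sqnorm P - 2 * Re (\<Sum>k\<in>K. cnj (c k) * pair_fun P (E k)) + B * (\<Sum>k\<in>K. (cmod (c k))\<^sup>2) \<and>
    (\<forall>l\<in>Z - K. pair_fun (\<lambda>x. P x - (\<Sum>k\<in>K. c k * E k x)) (E l) = pair_fun P (E l))"
  using K
proof (induction K rule: finite_induct)
  case empty
  then show ?case using P by simp
next
  case (insert m K)
  let ?S = "\<lambda>x. P x - (\<Sum>k\<in>K. c k * E k x)"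
  have m: "m \<in> Z - K" "L2 (E m)" using insert E by auto
  have IH: "L2 ?S" "sqnorm ?S = sqnorm P - 2 * Re (\<Sum>k\<in>K. cnj (c k) * pair_fun P (E k)) + B * (\<Sum>k\<in>K. (cmod (c k))\<^sup>2)"
    "\<And>l. l \<in> Z - K \<Longrightarrow> pair_fun ?S (E l) = pair_fun P (E l)"
    using insert by auto
  have eq: "(\<lambda>x. P x - (\<Sum>k\<in>insert m K. c k * E k x)) = (\<lambda>x. ?S x + (- c m) * E m x)"
    using insert by (auto simp: algebra_simps)
  have Bm: "sqnorm (E m) = B"
    using orth[of m m] m(1) pair_fun_self[of "E m"] by (metis DiffD1 of_real_eq_iff)
  have "sqnorm (\<lambda>x. ?S x + (- c m) * E m x) = sqnorm ?S - 2 * Re (cnj (c m) * pair_fun P (E m)) + (cmod (c m))\<^sup>2 * B"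
    using sqnorm_add_expand[OF IH(1) m(2), of "- c m"] by (simp only: IH(3)[OF m(1)] Bm) simp
  then have n: "sqnorm (\<lambda>x. ?S x + (- c m) * E m x) = sqnorm P - 2 * Re (\<Sum>k\<in>insert m K. cnj (c k) * pair_fun P (E k)) + B * (\<Sum>k\<in>insert m K. (cmod (c k))\<^sup>2)"
    using insert by (simp only: IH(2) sum.insert plus_complex.sel) (simp add: algebra_simps)
  have "pair_fun (\<lambda>x. ?S x + (- c m) * E m x) (E l) = pair_fun P (E l)" if l: "l \<in> Z - insert m K" for l
  proof -
    have "pair_fun (\<lambda>x. ?S x + (- c m) * E m x) (E l) = pair_fun ?S (E l) + (- c m) * pair_fun (E m) (E l)"
      using pair_fun_add[OF IH(1) L2_cmult[OF m(2)] E, of l "- c m"] l by (simp only: pair_fun_cmult) simp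
    then show ?thesis using IH(3)[of l] orth[of m l] l m by auto
  qed
  then show ?case unfolding eq using n L2_add(1)[OF IH(1) L2_cmult[OF m(2), of "- c m"]] by blast
qed

text \<open>
  Among all linear combinations of the \<open>E k\<close> with \<open>k \<in> K\<close>, the one with the Fourier coefficients is closest to
  \<open>P\<close>. Bessel's inequality bounds the sum from above, and the assumed approximations bound it from below.
\<close>

lemma Parseval_orthogonal:
  fixes E :: "'k \<Rightarrow> 'd::finite cfun"
  assumes P: "L2 P" and E: "\<And>k. k \<in> Z \<Longrightarrow> L2 (E k)" and B: "B > 0"
    and orth: "\<And>k l. k \<in> Z \<Longrightarrow> l \<in> Z \<Longrightarrow> pair_fun (E k) (E l) = (if k = l then of_real B else 0)"
    and complete: "\<And>e. e > 0 \<Longrightarrow> \<exists>K c. finite K \<and> K \<subseteq> Z \<and> sqnorm (\<lambda>x. P x - (\<Sum>k\<in>K. c k * E k x)) < e"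
  shows "((\<lambda>k. (cmod (pair_fun P (E k)))\<^sup>2) has_sum (B * sqnorm P)) Z"
proof -
  define a where "a = (\<lambda>k. pair_fun P (E k))"
  have best: "sqnorm (\<lambda>x. P x - (\<Sum>k\<in>K. c k * E k x)) \<ge> sqnorm P - (\<Sum>k\<in>K. (cmod (a k))\<^sup>2) / B" if K: "finite K" "K \<subseteq> Z" for K c
  proof -
    have "0 \<le> (\<Sum>k\<in>K. (cmod (of_real B * c k - a k))\<^sup>2)" by (intro sum_nonneg) auto
    also have "\<dots> = (\<Sum>k\<in>K. B\<^sup>2 * (cmod (c k))\<^sup>2 - 2 * B * Re (cnj (c k) * a k) + (cmod (a k))\<^sup>2)"
      by (intro sum.cong refl) (unfold cmod_power2, simp add: power2_eq_square algebra_simps)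
    also have "\<dots> = B\<^sup>2 * (\<Sum>k\<in>K. (cmod (c k))\<^sup>2) - 2 * B * Re (\<Sum>k\<in>K. cnj (c k) * a k) + (\<Sum>k\<in>K. (cmod (a k))\<^sup>2)"
      by (simp only: sum.distrib sum_subtractf sum_distrib_left Re_sum)
    also have "\<dots> = B * (B * (\<Sum>k\<in>K. (cmod (c k))\<^sup>2) - 2 * Re (\<Sum>k\<in>K. cnj (c k) * a k) + (\<Sum>k\<in>K. (cmod (a k))\<^sup>2) / B)"
    proof -
      have "B\<^sup>2 * u - 2 * B * v + w = B * (B * u - 2 * v + w / B)" for u v w :: real
        using B by (simp add: power2_eq_square field_simps)
      then show ?thesis .
    qed
    finally have "0 \<le> B * (\<Sum>k\<in>K. (cmod (c k))\<^sup>2) - 2 * Re (\<Sum>k\<in>K. cnj (c k) * a k) + (\<Sum>k\<in>K. (cmod (a k))\<^sup>2) / B"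
      using B by (simp add: zero_le_mult_iff)
    then show ?thesis using sqnorm_orthogonal_sum[OF P E orth K, of c] unfolding a_def by linarith
  qed
  have Bessel: "(\<Sum>k\<in>K. (cmod (a k))\<^sup>2) \<le> B * sqnorm P" if K: "finite K" "K \<subseteq> Z" for K
  proof -
    let ?c = "\<lambda>k. a k / of_real B"
    have "sqnorm (\<lambda>x. P x - (\<Sum>k\<in>K. ?c k * E k x)) = sqnorm P - 2 * Re (\<Sum>k\<in>K. cnj (?c k) * a k) + B * (\<Sum>k\<in>K. (cmod (?c k))\<^sup>2)"
      using sqnorm_orthogonal_sum[OF P E orth K, of ?c] unfolding a_def by blast
    also have "(\<Sum>k\<in>K. cnj (?c k) * a k) = of_real ((\<Sum>k\<in>K. (cmod (a k))\<^sup>2) / B)"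
      by (simp add: sum_divide_distrib complex_norm_square mult.commute del: of_real_power)
    also have "B * (\<Sum>k\<in>K. (cmod (?c k))\<^sup>2) = (\<Sum>k\<in>K. (cmod (a k))\<^sup>2) / B"
      using B by (simp add: norm_divide power_divide flip: sum_divide_distrib) (simp add: power2_eq_square)
    finally have "0 \<le> sqnorm P - (\<Sum>k\<in>K. (cmod (a k))\<^sup>2) / B"
      using sqnorm_nonneg[of "\<lambda>x. P x - (\<Sum>k\<in>K. ?c k * E k x)"] by simp
    then show ?thesis using B by (simp add: field_simps)
  qed
  have summ: "(\<lambda>k. (cmod (a k))\<^sup>2) summable_on Z"
    by (rule nonneg_bounded_partial_sums_imp_summable_on[of _ _ "B * sqnorm P"]) (use Bessel in \<open>auto intro!: eventually_finite_subsets_at_top_weakI\<close>)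
  have "infsum (\<lambda>k. (cmod (a k))\<^sup>2) Z \<le> B * sqnorm P"
    by (rule infsum_le_finite_sums[OF summ]) (use Bessel in auto)
  moreover have "B * sqnorm P \<le> infsum (\<lambda>k. (cmod (a k))\<^sup>2) Z"
  proof (rule field_le_epsilon)
    fix e :: real assume "e > 0"
    then obtain K c where K: "finite K" "K \<subseteq> Z" "sqnorm (\<lambda>x. P x - (\<Sum>k\<in>K. c k * E k x)) < e / B"
      using complete[of "e / B"] B by auto
    then have "sqnorm P - (\<Sum>k\<in>K. (cmod (a k))\<^sup>2) / B < e / B" using best[OF K(1,2), of c] by linarith
    then have "sqnorm P < ((\<Sum>k\<in>K. (cmod (a k))\<^sup>2) + e) / B" unfolding add_divide_distrib by linarith
    then have "B * sqnorm P < (\<Sum>k\<in>K. (cmod (a k))\<^sup>2) + e" using B by (simp add: pos_less_divide_eq mult.commute)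
    also have "(\<Sum>k\<in>K. (cmod (a k))\<^sup>2) \<le> infsum (\<lambda>k. (cmod (a k))\<^sup>2) Z"
      by (rule finite_sum_le_infsum[OF summ]) (use K in auto)
    finally show "B * sqnorm P \<le> infsum (\<lambda>k. (cmod (a k))\<^sup>2) Z + e" by simp
  qed
  ultimately have "infsum (\<lambda>k. (cmod (a k))\<^sup>2) Z = B * sqnorm P" by simp
  then show ?thesis using has_sum_infsum[OF summ] by (simp add: a_def)
qed

lemma complex_polarization:
  "z * cnj w = (of_real ((cmod (z + w))\<^sup>2) - of_real ((cmod (z - w))\<^sup>2)
      + \<i> * of_real ((cmod (z + \<i> * w))\<^sup>2) - \<i> * of_real ((cmod (z - \<i> * w))\<^sup>2)) / 4"
  unfolding complex_norm_square by (simp add: field_simps)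

lemma pair_fun_polarization:
  assumes "L2 f" "L2 g"
  shows "pair_fun f g = (of_real (sqnorm (\<lambda>x. f x + 1 * g x)) - of_real (sqnorm (\<lambda>x. f x + (-1) * g x))
      + \<i> * of_real (sqnorm (\<lambda>x. f x + \<i> * g x)) - \<i> * of_real (sqnorm (\<lambda>x. f x + (-\<i>) * g x))) / 4"
  unfolding sqnorm_add_expand[OF assms] by (simp add: complex_eq_iff)

text \<open>
  Both Parseval's identity and the tight frame identity are first known for squared moduli and are needed for products.
\<close>

lemma has_sum_polarization:
  fixes a :: "'d::finite cfun \<Rightarrow> 'p \<Rightarrow> complex"
  assumes f: "L2 f" and g: "L2 g"
    and lin: "\<And>c p. p \<in> Z \<Longrightarrow> a (\<lambda>x. f x + c * g x) p = a f p + c * a g p"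
    and sum: "\<And>c. ((\<lambda>p. (cmod (a (\<lambda>x. f x + c * g x) p))\<^sup>2) has_sum (B * sqnorm (\<lambda>x. f x + c * g x))) Z"
  shows "((\<lambda>p. a f p * cnj (a g p)) has_sum (of_real B * pair_fun f g)) Z"
proof -
  have s: "((\<lambda>p. complex_of_real ((cmod (a f p + c * a g p))\<^sup>2)) has_sum (of_real (B * sqnorm (\<lambda>x. f x + c * g x)))) Z" for c
  proof -
    have "((\<lambda>p. (cmod (a f p + c * a g p))\<^sup>2) has_sum (B * sqnorm (\<lambda>x. f x + c * g x))) Z"
      using sum[of c] by (subst has_sum_cong[where g = "\<lambda>p. (cmod (a (\<lambda>x. f x + c * g x) p))\<^sup>2"]) (simp_all add: lin)
    then show ?thesis by (rule has_sum_of_real)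
  qed
  have "((\<lambda>p. (1/4) * (of_real ((cmod (a f p + 1 * a g p))\<^sup>2) + ((-1) * of_real ((cmod (a f p + (-1) * a g p))\<^sup>2)
      + (\<i> * of_real ((cmod (a f p + \<i> * a g p))\<^sup>2) + (-\<i>) * of_real ((cmod (a f p + (-\<i>) * a g p))\<^sup>2))))) has_sum
     (1/4) * (of_real (B * sqnorm (\<lambda>x. f x + 1 * g x)) + ((-1) * of_real (B * sqnorm (\<lambda>x. f x + (-1) * g x))
      + (\<i> * of_real (B * sqnorm (\<lambda>x. f x + \<i> * g x)) + (-\<i>) * of_real (B * sqnorm (\<lambda>x. f x + (-\<i>) * g x)))))) Z"
    by (intro has_sum_cmult_right has_sum_add s)
  moreover have "(1/4) * (of_real ((cmod (z + 1 * w))\<^sup>2) + ((-1) * of_real ((cmod (z + (-1) * w))\<^sup>2)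
      + (\<i> * of_real ((cmod (z + \<i> * w))\<^sup>2) + (-\<i>) * of_real ((cmod (z + (-\<i>) * w))\<^sup>2)))) = z * cnj w" for z w
    by (subst complex_polarization) (simp add: algebra_simps)
  moreover have "(1/4) * (of_real (B * sqnorm (\<lambda>x. f x + 1 * g x)) + ((-1) * of_real (B * sqnorm (\<lambda>x. f x + (-1) * g x))
      + (\<i> * of_real (B * sqnorm (\<lambda>x. f x + \<i> * g x)) + (-\<i>) * of_real (B * sqnorm (\<lambda>x. f x + (-\<i>) * g x)))))
     = of_real B * pair_fun f g"
    by (subst pair_fun_polarization[OF f g]) (simp add: algebra_simps)
  ultimately show ?thesis by (simp only:)
qed

section \<open>The integer lattice and the fundamental cube\<close>

lemma Zd_add: "k \<in> Zd \<Longrightarrow> l \<in> Zd \<Longrightarrow> k + l \<in> Zd"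
  and Zd_diff: "k \<in> Zd \<Longrightarrow> l \<in> Zd \<Longrightarrow> k - l \<in> Zd"
  and Zd_minus: "k \<in> Zd \<Longrightarrow> - k \<in> Zd"
  and Zd_0: "0 \<in> Zd" and Zd_axis: "axis i 1 \<in> Zd"
  by (auto simp: Zd_def axis_def)

lemma finite_Zd_bounded:
  assumes "bounded S"
  shows "finite (Zd \<inter> S :: (real^'d::finite) set)"
proof -
  obtain R where R: "\<And>x. x \<in> S \<Longrightarrow> norm x \<le> R" using assms by (auto simp: bounded_iff)
  have "Zd \<inter> S \<subseteq> (\<lambda>f. \<chi> i. of_int (f i)) ` (Pi\<^sub>E UNIV (\<lambda>_. {-\<lceil>R\<rceil>..\<lceil>R\<rceil>}))"
  proof
    fix x assume x: "x \<in> Zd \<inter> S"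
    have *: "x $ i = of_int \<lfloor>x $ i\<rfloor>" for i using x by (auto simp: Zd_def elim: Ints_cases)
    have "\<bar>x $ i\<bar> \<le> R" for i using component_le_norm_cart[of x i] R[of x] x by auto
    then have "\<lfloor>x $ i\<rfloor> \<in> {-\<lceil>R\<rceil>..\<lceil>R\<rceil>}" for i
      using *[of i] by (smt (verit) atLeastAtMost_iff ceiling_le_iff le_of_int_ceiling minus_le_iff of_int_le_iff of_int_minus abs_le_iff)
    then show "x \<in> (\<lambda>f. \<chi> i. of_int (f i)) ` (Pi\<^sub>E UNIV (\<lambda>_. {-\<lceil>R\<rceil>..\<lceil>R\<rceil>}))"
      using * by (intro image_eqI[of _ _ "\<lambda>i. \<lfloor>x $ i\<rfloor>"]) (auto simp: vec_eq_iff)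
  qed
  then show ?thesis by (rule finite_subset) (intro finite_imageI finite_PiE, auto)
qed

definition cube :: "(real^'d::finite) set" where
  "cube = {x. \<forall>i. 0 \<le> x $ i \<and> x $ i < 2 * pi}"

text \<open>
  The index of the translate of \<open>cube\<close> that contains \<open>x\<close>.
\<close>

definition lattice_part :: "real^'d::finite \<Rightarrow> real^'d" where
  "lattice_part x = (\<chi> i. of_int \<lfloor>x $ i / (2 * pi)\<rfloor>)"

lemma lattice_part_Zd: "lattice_part x \<in> Zd" by (auto simp: lattice_part_def Zd_def)

lemma cube_lattice_part: "n \<in> Zd \<Longrightarrow> x - (2 * pi) *\<^sub>R n \<in> cube \<longleftrightarrow> n = lattice_part x"
proof -
  assume n: "n \<in> Zd"
  have "0 \<le> x $ i - 2 * pi * n $ i \<and> x $ i - 2 * pi * n $ i < 2 * pi \<longleftrightarrow> n $ i = of_int \<lfloor>x $ i / (2 * pi)\<rfloor>" for i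
  proof -
    obtain z where z: "n $ i = of_int z" using n by (auto simp: Zd_def elim: Ints_cases)
    have "\<lfloor>x $ i / (2 * pi)\<rfloor> = z \<longleftrightarrow> of_int z \<le> x $ i / (2 * pi) \<and> x $ i / (2 * pi) < of_int z + 1"
      by (rule floor_eq_iff)
    also have "\<dots> \<longleftrightarrow> 0 \<le> x $ i - 2 * pi * of_int z \<and> x $ i - 2 * pi * of_int z < 2 * pi"
      using pi_gt_zero by (auto simp: field_simps)
    finally show ?thesis unfolding z by auto
  qed
  then show ?thesis by (auto simp: cube_def lattice_part_def vec_eq_iff)
qed

lemma lattice_part_unique: "x \<in> cube \<Longrightarrow> n \<in> Zd \<Longrightarrow> lattice_part (x + (2 * pi) *\<^sub>R n) = n"
  using cube_lattice_part[of n "x + (2 * pi) *\<^sub>R n"] by simp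

lemma cube_borel: "(cube :: (real^'d::finite) set) \<in> sets borel"
proof -
  have eq: "(cube :: (real^'d) set) = (\<Inter>i. {x. 0 \<le> x $ i} \<inter> {x. x $ i < 2 * pi})" by (auto simp: cube_def)
  have "closed {x::real^'d. 0 \<le> x $ i}" "open {x::real^'d. x $ i < 2 * pi}" for i
    by (auto intro!: closed_Collect_le open_Collect_less continuous_intros)
  then have "{x::real^'d. 0 \<le> x $ i} \<inter> {x. x $ i < 2 * pi} \<in> sets borel" for i
    by (intro sets.Int borel_closed borel_open)
  then show ?thesis unfolding eq by (intro sets.finite_INT) auto
qed

lemma cube_lebesgue: "(cube :: (real^'d::finite) set) \<in> sets lebesgue"
  by (rule sets_completionI_sets) (simp add: cube_borel)

lemma cube_bounded: "bounded (cube :: (real^'d::finite) set)"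
  by (rule bounded_subset[OF bounded_cbox[of 0 "\<chi> i. 2 * pi"]]) (auto simp: cube_def mem_box_cart less_imp_le)

lemma bounded_lattice_part_image:
  fixes S :: "(real^'d::finite) set"
  assumes "bounded S" shows "finite (lattice_part ` S)"
proof -
  obtain R where R: "\<And>x. x \<in> S \<Longrightarrow> norm x \<le> R" using assms by (auto simp: bounded_iff)
  obtain R' where R': "\<And>x::real^'d. x \<in> cube \<Longrightarrow> norm x \<le> R'" using cube_bounded by (auto simp: bounded_iff)
  have "norm (lattice_part x) \<le> R + R'" if "x \<in> S" for x
  proof -
    have "x - (2 * pi) *\<^sub>R lattice_part x \<in> cube" using cube_lattice_part[OF lattice_part_Zd] by blast
    then have "norm ((2 * pi) *\<^sub>R lattice_part x) \<le> norm x + norm (x - (2 * pi) *\<^sub>R lattice_part x)"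
      using norm_triangle_ineq4[of x "x - (2 * pi) *\<^sub>R lattice_part x"] by simp
    also have "\<dots> \<le> R + R'" using R[OF that] R'[OF \<open>_ \<in> cube\<close>] by simp
    finally have "2 * pi * norm (lattice_part x) \<le> R + R'" by simp
    moreover have "1 * norm (lattice_part x) \<le> 2 * pi * norm (lattice_part x)" using pi_gt3 by (intro mult_right_mono) auto
    ultimately show ?thesis by simp
  qed
  then have "lattice_part ` S \<subseteq> Zd \<inter> cball 0 (R + R')" using lattice_part_Zd by auto
  then show ?thesis using finite_Zd_bounded[OF bounded_cball] finite_subset by blast
qed

lemma integral_translate:
  fixes H :: "real^'d::finite \<Rightarrow> complex"
  assumes "H \<in> borel_measurable lebesgue"
  shows "(LINT x|lebesgue. H (x + b)) = (LINT x|lebesgue. H x)"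
  using integral_affine[of "mat 1" H b] assms by (simp add: invertible_det_nz)

lemma integrable_translate:
  fixes H :: "real^'d::finite \<Rightarrow> complex"
  assumes "integrable lebesgue H" shows "integrable lebesgue (\<lambda>x. H (x + b))"
  using integrable_affine[of "mat 1" H b] assms by (simp add: invertible_det_nz)

lemma measurable_translate:
  "f \<in> borel_measurable lebesgue \<Longrightarrow> (\<lambda>x::real^'d::finite. f (x + b)) \<in> borel_measurable lebesgue"
  using measurable_affine_comp[of "mat 1" f b] by (simp add: invertible_det_nz)

lemma indicator_cube_measurable: "(\<lambda>x. indicator cube x :: complex) \<in> borel_measurable lebesgue"
  by (rule borel_measurable_indicator[OF cube_lebesgue])

lemma integrable_cube_mult:
  fixes H :: "real^'d::finite \<Rightarrow> complex"
  assumes "integrable lebesgue H" shows "integrable lebesgue (\<lambda>x. indicator cube x * H x)"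
proof -
  have "indicator cube x * H x = indicat_real cube x *\<^sub>R H x" for x by (simp add: indicator_def)
  then show ?thesis using integrable_mult_indicator[OF cube_lebesgue assms] by simp
qed

text \<open>
  The translates of the cube tile the space, and the support condition says that only those indexed by \<open>Z\<close> matter.
\<close>

lemma integral_unfold_cube:
  fixes H :: "real^'d::finite \<Rightarrow> complex"
  assumes H: "integrable lebesgue H" and Z: "finite Z" "Z \<subseteq> Zd" and supp: "\<And>x. H x \<noteq> 0 \<Longrightarrow> lattice_part x \<in> Z"
  shows "(LINT x|lebesgue. H x) = (\<Sum>n\<in>Z. LINT x|lebesgue. indicator cube x * H (x + (2 * pi) *\<^sub>R n))"
proof -
  have i: "integrable lebesgue (\<lambda>x. indicator cube (x - (2 * pi) *\<^sub>R n) * H x)" for n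
    using integrable_translate[OF integrable_cube_mult[OF integrable_translate[OF H, of "(2 * pi) *\<^sub>R n"]], of "- (2 * pi) *\<^sub>R n"]
    by simp
  have "H x = (\<Sum>n\<in>Z. indicator cube (x - (2 * pi) *\<^sub>R n) * H x)" for x
  proof (cases "H x = 0")
    case False
    have "(\<Sum>n\<in>Z. indicator cube (x - (2 * pi) *\<^sub>R n) * H x) = (\<Sum>n\<in>Z. if n = lattice_part x then H x else 0)"
      using Z cube_lattice_part[of _ x] by (intro sum.cong refl) (auto simp: indicator_def subset_iff)
    also have "\<dots> = H x" using supp[OF False] Z by simp
    finally show ?thesis by simp
  qed simp
  then have "(LINT x|lebesgue. H x) = (LINT x|lebesgue. (\<Sum>n\<in>Z. indicator cube (x - (2 * pi) *\<^sub>R n) * H x))"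
    by (intro Bochner_Integration.integral_cong) auto
  also have "\<dots> = (\<Sum>n\<in>Z. LINT x|lebesgue. indicator cube (x - (2 * pi) *\<^sub>R n) * H x)"
    by (rule Bochner_Integration.integral_sum[OF i])
  also have "\<dots> = (\<Sum>n\<in>Z. LINT x|lebesgue. indicator cube x * H (x + (2 * pi) *\<^sub>R n))"
  proof (intro sum.cong refl)
    fix n
    show "(LINT x|lebesgue. indicator cube (x - (2 * pi) *\<^sub>R n) * H x) = (LINT x|lebesgue. indicator cube x * H (x + (2 * pi) *\<^sub>R n))"
      using integral_translate[OF borel_measurable_integrable[OF i[of n]], of "(2 * pi) *\<^sub>R n"] by simp
  qed
  finally show ?thesis .
qed

section \<open>Characters\<close>

definition character :: "real^'d::finite \<Rightarrow> 'd cfun" where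
  "character k x = exp (\<i> * of_real (k \<bullet> x))"

lemma character_norm: "cmod (character k x) = 1"
  using norm_exp_i_times[of "k \<bullet> x"] by (simp add: character_def)

lemma character_continuous: "continuous_on UNIV (character k)"
  unfolding character_def by (intro continuous_intros)

lemma character_measurable: "character k \<in> borel_measurable lebesgue"
  using borel_measurable_continuous_onI[OF character_continuous] by (intro measurable_completion) simp

lemma character_cnj: "cnj (character k x) = character (- k) x"
  by (simp add: character_def exp_cnj)

lemma character_add: "character (k + l) x = character k x * character l x"
  by (simp add: character_def inner_add_left distrib_left exp_add)

lemma character_add_right: "character k (x + y) = character k x * character k y"
  by (simp add: character_def inner_add_right distrib_left exp_add)

lemma character_0: "character 0 x = 1" by (simp add: character_def)

lemma character_period: assumes "k \<in> Zd" "n \<in> Zd" shows "character k ((2 * pi) *\<^sub>R n) = 1"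
proof -
  have "k \<bullet> n \<in> \<int>" unfolding inner_vec_def using assms by (auto simp: Zd_def intro!: Ints_sum)
  then obtain z where "k \<bullet> n = of_int z" by (auto elim: Ints_cases)
  then have "character k ((2 * pi) *\<^sub>R n) = exp (complex_of_real (2 * of_int z * pi) * \<i>)"
    by (simp add: character_def mult_ac)
  also have "\<dots> = 1" by (rule exp_integer_2pi) auto
  finally show ?thesis .
qed

lemma character_periodic: "k \<in> Zd \<Longrightarrow> n \<in> Zd \<Longrightarrow> character k (x + (2 * pi) *\<^sub>R n) = character k x"
  by (simp add: character_add_right character_period)

lemma indicator_cube_L2: "L2 (\<lambda>x. indicator cube x)"
  using L2_indicator_bounded[OF cube_lebesgue cube_bounded] by simp

lemma character_cube_integrable: "integrable lebesgue (\<lambda>x. indicator cube x * character k x)"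
proof -
  have "integrable lebesgue (\<lambda>x. indicator cube x * (character k x * indicator cube x))"
    by (rule L2_prod_integrable[OF indicator_cube_L2 L2_mult_bounded[OF indicator_cube_L2 character_measurable, of k 1]]) (simp add: character_norm)
  moreover have "(\<lambda>x. indicator cube x * (character k x * indicator cube x)) = (\<lambda>x. indicator cube x * character k x)"
    by (auto simp: indicator_def)
  ultimately show ?thesis by simp
qed

text \<open>
  For \<open>k \<noteq> 0\<close> choose \<open>a\<close> with \<open>k \<bullet> a = \<pi>\<close>. Translation by \<open>a\<close> changes the sign of the character, while the integral
  of a periodic function over a translated cube is the integral over the cube. So the integral equals its negative.
\<close>

lemma integral_character_cube:
  fixes k :: "real^'d::finite"
  assumes k: "k \<in> Zd"
  shows "(LINT x|lebesgue. indicator cube x * character k x) = (if k = 0 then of_real ((2 * pi) ^ CARD('d)) else 0)"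
proof (cases "k = 0")
  case True
  have "emeasure lborel (cube :: (real^'d) set) = ennreal ((2 * pi) ^ CARD('d))"
  proof -
    have 1: "box 0 (\<chi> i. 2 * pi) \<subseteq> (cube :: (real^'d) set)" by (auto simp: cube_def mem_box_cart less_imp_le)
    have 2: "cube \<subseteq> cbox (0::real^'d) (\<chi> i. 2 * pi)" by (auto simp: cube_def mem_box_cart less_imp_le)
    have p: "(\<Prod>b\<in>Basis. ((\<chi> i. 2 * pi) - 0) \<bullet> (b::real^'d)) = (2 * pi) ^ CARD('d)"
      by (simp add: prod_Basis_cart inner_axis)
    have nn: "\<And>b. b \<in> Basis \<Longrightarrow> (0::real^'d) \<bullet> b \<le> (\<chi> i. 2 * pi) \<bullet> b"
      by (auto simp: Basis_cart inner_axis)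
    have "emeasure lborel (box (0::real^'d) (\<chi> i. 2 * pi)) = ennreal ((2 * pi) ^ CARD('d))"
      using emeasure_lborel_box[OF nn] unfolding p by simp
    moreover have "emeasure lborel (cbox (0::real^'d) (\<chi> i. 2 * pi)) = ennreal ((2 * pi) ^ CARD('d))"
      using emeasure_lborel_cbox[OF nn] unfolding p by simp
    ultimately show ?thesis
      using emeasure_mono[OF 1, of lborel] emeasure_mono[OF 2, of lborel] by (simp add: cube_borel antisym)
  qed
  then have "measure lebesgue (cube :: (real^'d) set) = (2 * pi) ^ CARD('d)"
    by (simp add: measure_def cube_borel)
  moreover have "(LINT x|lebesgue. indicator cube x * character k x) = complex_of_real (measure lebesgue (cube :: (real^'d) set))"
  proof -
    have "indicator cube x * character k x = complex_of_real (indicator cube x)" for x :: "real^'d"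
      using True by (simp add: character_0 indicator_def)
    then show ?thesis using cube_lebesgue by (simp del: of_real_indicator)
  qed
  ultimately show ?thesis using True by simp
next
  case False
  then obtain i where i: "k $ i \<noteq> 0" by (auto simp: vec_eq_iff)
  define a :: "real^'d" where "a = axis i (pi / k $ i)"
  have "character k a = exp (\<i> * of_real pi)" using i by (simp add: character_def a_def inner_axis)
  then have ea: "character k a = -1" by (simp add: mult.commute)
  define I where "I = (LINT x|lebesgue. indicator cube x * character k x)"
  define H where "H = (\<lambda>y. indicator cube (y - a) * character k y)"
  have Hi0: "integrable lebesgue (\<lambda>x. indicator cube x * character k (x + a))"
    using integrable_mult_right[OF character_cube_integrable[of k], of "character k a"] by (simp add: character_add_right mult_ac)
  have Hi: "integrable lebesgue H"
    using integrable_translate[OF Hi0, of "- a"] by (simp add: H_def)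
  have "(LINT x|lebesgue. H x) = (LINT x|lebesgue. H (x + a))"
    by (rule integral_translate[symmetric]) (use Hi in simp)
  also have "\<dots> = (LINT x|lebesgue. character k a * (indicator cube x * character k x))"
    by (simp add: H_def character_add_right mult_ac)
  also have "\<dots> = - I" by (simp add: ea I_def)
  finally have 1: "(LINT x|lebesgue. H x) = - I" .
  have Hb: "bounded {y. H y \<noteq> 0}"
  proof (rule bounded_subset)
    show "bounded ((+) a ` cube)" by (rule bounded_translation[OF cube_bounded])
    show "{y. H y \<noteq> 0} \<subseteq> (+) a ` cube"
      by (auto simp: H_def indicator_def image_iff intro!: bexI[of _ "_ - a"] split: if_splits)
  qed
  define Z where "Z = lattice_part ` {y. H y \<noteq> 0}"
  have Z: "finite Z" "Z \<subseteq> Zd" using bounded_lattice_part_image[OF Hb] lattice_part_Zd by (auto simp: Z_def)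
  have "(LINT x|lebesgue. H x) = (\<Sum>n\<in>Z. LINT x|lebesgue. indicator cube x * H (x + (2 * pi) *\<^sub>R n))"
    by (rule integral_unfold_cube[OF Hi Z]) (auto simp: Z_def)
  also have "\<dots> = (LINT x|lebesgue. (\<Sum>n\<in>Z. indicator cube x * H (x + (2 * pi) *\<^sub>R n)))"
    by (rule Bochner_Integration.integral_sum[symmetric]) (intro integrable_cube_mult integrable_translate Hi)
  also have "\<dots> = I" unfolding I_def
  proof (intro Bochner_Integration.integral_cong refl)
    fix x :: "real^'d"
    show "(\<Sum>n\<in>Z. indicator cube x * H (x + (2 * pi) *\<^sub>R n)) = indicator cube x * character k x"
    proof (cases "x \<in> cube")
      case True
      \<comment> \<open>The only lattice translate of \<open>x\<close> that lies in \<open>a + cube\<close>.\<close>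
      define m where "m = - lattice_part (x - a)"
      have m: "m \<in> Zd" unfolding m_def by (intro Zd_minus lattice_part_Zd)
      have ind: "(x + (2 * pi) *\<^sub>R n) - a \<in> cube \<longleftrightarrow> n = m" if "n \<in> Zd" for n
        using cube_lattice_part[OF Zd_minus[OF that], of "x - a"] minus_equation_iff[of n "lattice_part (x - a)"]
        by (auto simp: algebra_simps m_def)
      have "H (x + (2 * pi) *\<^sub>R m) = character k x" using ind[OF m] character_periodic[OF k m] by (simp add: H_def)
      moreover have "character k x \<noteq> 0" using character_norm[of k x] by auto
      ultimately have "lattice_part (x + (2 * pi) *\<^sub>R m) \<in> Z" by (auto simp: Z_def)
      then have mZ: "m \<in> Z" using lattice_part_unique[OF True m] by simp
      have "(\<Sum>n\<in>Z. indicator cube x * H (x + (2 * pi) *\<^sub>R n)) = (\<Sum>n\<in>Z. if n = m then character k x else 0)"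
      proof (intro sum.cong refl)
        fix n assume "n \<in> Z"
        then have n: "n \<in> Zd" using Z by auto
        show "indicator cube x * H (x + (2 * pi) *\<^sub>R n) = (if n = m then character k x else 0)"
          using ind[OF n] character_periodic[OF k n, of x] True by (auto simp: H_def indicator_def)
      qed
      then show ?thesis using True mZ Z by simp
    qed simp
  qed
  finally have "I = - I" using 1 by simp
  then show ?thesis using False by (simp add: I_def)
qed

section \<open>Trigonometric polynomials\<close>

text \<open>
  The frequency is written \<open>- k\<close> because a pairing conjugates its second argument, and the Fourier
  coefficients below pair with \<open>character k\<close> unconjugated.
\<close>

inductive trig_polynomial :: "'d::finite cfun \<Rightarrow> bool" where
  base: "k \<in> Zd \<Longrightarrow> trig_polynomial (\<lambda>x. c * character (- k) x)"
| add: "trig_polynomial f \<Longrightarrow> trig_polynomial g \<Longrightarrow> trig_polynomial (\<lambda>x. f x + g x)"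

lemma trig_character: "k \<in> Zd \<Longrightarrow> trig_polynomial (\<lambda>x. c * character k x)"
  using trig_polynomial.base[OF Zd_minus, of k c] by simp

lemma trig_const: "trig_polynomial (\<lambda>x. c)"
  using trig_character[OF Zd_0, of c] by (simp add: character_0)

lemma trig_cmult: "trig_polynomial f \<Longrightarrow> trig_polynomial (\<lambda>x. c * f x)"
proof (induction rule: trig_polynomial.induct)
  case (base k c')
  then show ?case using trig_polynomial.base[of k "c * c'"] by (simp add: mult.assoc)
next
  case (add f g)
  then show ?case using trig_polynomial.add[of "\<lambda>x. c * f x" "\<lambda>x. c * g x"] by (simp add: distrib_left)
qed

lemma trig_mult: "trig_polynomial f \<Longrightarrow> trig_polynomial g \<Longrightarrow> trig_polynomial (\<lambda>x. f x * g x)"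
proof (induction arbitrary: g rule: trig_polynomial.induct)
  case (base k c)
  from base(2,1) show ?case
  proof (induction rule: trig_polynomial.induct)
    case (base l c')
    have "(\<lambda>x. c * character (- k) x * (c' * character (- l) x)) = (\<lambda>x. (c * c') * character (- (k + l)) x)"
      using character_add[of "-k" "-l"] by (auto simp: mult_ac add.commute)
    then show ?case using trig_polynomial.base[OF Zd_add[OF base(2,1)], of "c * c'"] by simp
  next
    case (add f g)
    then show ?case using trig_polynomial.add[of "\<lambda>x. c * character (- k) x * f x" "\<lambda>x. c * character (- k) x * g x"] by (simp add: distrib_left)
  qed
next
  case (add f f')
  then show ?case using trig_polynomial.add[of "\<lambda>x. f x * g x" "\<lambda>x. f' x * g x"] by (simp add: distrib_right)
qed

lemma trig_sum: "finite A \<Longrightarrow> (\<And>a. a \<in> A \<Longrightarrow> trig_polynomial (f a)) \<Longrightarrow> trig_polynomial (\<lambda>x. \<Sum>a\<in>A. f a x)"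
  by (induction A rule: finite_induct) (auto intro: trig_const trig_polynomial.add)

lemma trig_rep: "trig_polynomial f \<Longrightarrow> \<exists>K c. finite K \<and> K \<subseteq> Zd \<and> f = (\<lambda>x. \<Sum>k\<in>K. c k * character (- k) x)"
proof (induction rule: trig_polynomial.induct)
  case (base k c)
  then show ?case by (intro exI[of _ "{k}"] exI[of _ "\<lambda>_. c"]) auto
next
  case (add f g)
  then obtain K c L b where K: "finite K" "K \<subseteq> Zd" "f = (\<lambda>x. \<Sum>k\<in>K. c k * character (- k) x)"
    and L: "finite L" "L \<subseteq> Zd" "g = (\<lambda>x. \<Sum>k\<in>L. b k * character (- k) x)" by auto
  have "f x = (\<Sum>k\<in>K \<union> L. (if k \<in> K then c k else 0) * character (- k) x)" for x
    unfolding K(3) by (rule sum.mono_neutral_cong_left) (use K(1) L(1) in auto)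
  moreover have "g x = (\<Sum>k\<in>K \<union> L. (if k \<in> L then b k else 0) * character (- k) x)" for x
    unfolding L(3) by (rule sum.mono_neutral_cong_left) (use K(1) L(1) in auto)
  ultimately have "(\<lambda>x. f x + g x) = (\<lambda>x. \<Sum>k\<in>K \<union> L. ((if k \<in> K then c k else 0) + (if k \<in> L then b k else 0)) * character (- k) x)"
    by (auto simp: sum.distrib distrib_right)
  then show ?case using K L by (intro exI[of _ "K \<union> L"] exI[of _ "\<lambda>k. (if k \<in> K then c k else 0) + (if k \<in> L then b k else 0)"]) auto
qed

lemma trig_measurable: "trig_polynomial f \<Longrightarrow> f \<in> borel_measurable lebesgue"
  by (induction rule: trig_polynomial.induct) (auto intro!: borel_measurable_times borel_measurable_const character_measurable borel_measurable_add)

lemma trig_cube_L2: "trig_polynomial f \<Longrightarrow> L2 (\<lambda>x. indicator cube x * f x)"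
proof -
  assume t: "trig_polynomial f"
  then have "\<exists>B. \<forall>x. cmod (f x) \<le> B"
  proof (induction rule: trig_polynomial.induct)
    case (base k c)
    then show ?case by (intro exI[of _ "cmod c"]) (simp add: norm_mult character_norm)
  next
    case (add f g)
    then obtain A B where "\<And>x. cmod (f x) \<le> A" "\<And>x. cmod (g x) \<le> B" by auto
    then have "cmod (f x + g x) \<le> A + B" for x by (rule norm_triangle_le[OF add_mono])
    then show ?case by blast
  qed
  then obtain B where B: "\<And>x. cmod (f x) \<le> B" by auto
  have "L2 (\<lambda>x. f x * indicator cube x)"
    by (rule L2_mult_bounded[OF indicator_cube_L2 trig_measurable[OF t] B])
  then show ?thesis by (simp add: mult.commute)
qed

lemma trig_cos: "trig_polynomial (\<lambda>x. of_real (cos (x $ i - m)))"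
proof -
  have "complex_of_real (cos (x $ i - m)) = (exp (- \<i> * of_real m) / 2) * character (axis i 1) x + (exp (\<i> * of_real m) / 2) * character (- axis i 1) x" for x
  proof -
    have "complex_of_real (cos (x $ i - m)) = (exp (\<i> * of_real (x $ i - m)) + exp (- (\<i> * of_real (x $ i - m)))) / 2"
      unfolding cos_of_real[symmetric] cos_exp_eq by simp
    also have "exp (\<i> * of_real (x $ i - m)) = exp (- \<i> * of_real m) * character (axis i 1) x"
      unfolding character_def exp_add[symmetric] by (simp add: inner_axis' algebra_simps)
    also have "exp (- (\<i> * of_real (x $ i - m))) = exp (\<i> * of_real m) * character (- axis i 1) x"
      unfolding character_def exp_add[symmetric] by (simp add: inner_axis' algebra_simps)
    finally show ?thesis by (simp add: add_divide_distrib)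
  qed
  then show ?thesis
    by (simp only:) (rule trig_polynomial.add[OF trig_character[OF Zd_axis] trig_character[OF Zd_minus[OF Zd_axis]]])
qed

lemma trig_poly:
  fixes m :: "real^'d::finite"
  assumes "real_polynomial_function p"
  shows "trig_polynomial (\<lambda>x. of_real (p (\<chi> i. cos (x $ i - m $ i))))"
  using assms
proof (induction rule: real_polynomial_function.induct)
  case (linear f)
  have "f (\<chi> i. cos (x $ i - m $ i)) = (\<Sum>i\<in>UNIV. cos (x $ i - m $ i) * f (axis i 1))" for x :: "real^'d"
  proof -
    have "(\<chi> i. cos (x $ i - m $ i)) = (\<Sum>i\<in>UNIV. cos (x $ i - m $ i) *\<^sub>R axis i 1)"
      by (simp add: vec_eq_iff axis_def if_distrib cong: if_cong)
    then show ?thesis using linear by (simp add: linear_sum linear_scale bounded_linear.linear)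
  qed
  then have "(\<lambda>x. complex_of_real (f (\<chi> i. cos (x $ i - m $ i)))) = (\<lambda>x. \<Sum>i\<in>UNIV. of_real (cos (x $ i - m $ i)) * of_real (f (axis i 1)))"
    by simp
  moreover have "trig_polynomial (\<lambda>x::real^'d. \<Sum>i\<in>UNIV. complex_of_real (cos (x $ i - m $ i)) * of_real (f (axis i 1)))"
    by (intro trig_sum trig_mult trig_cos trig_const) auto
  ultimately show ?case by simp
next
  case (const c) then show ?case by (rule trig_const)
next
  case (add f g) then show ?case by (simp add: trig_polynomial.add)
next
  case (mult f g) then show ?case by (simp add: trig_mult)
qed

text \<open>
  Within one period an interval is a superlevel set of a cosine centred at its midpoint. Hence the indicator function of a box
  inside the cube is a step function of finitely many cosines.
\<close>

lemma cos_gt_iff: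
  assumes "0 < x" "x < 2 * pi" "0 \<le> a" "a < b" "b \<le> 2 * pi"
  shows "cos (x - (a + b) / 2) > cos ((b - a) / 2) \<longleftrightarrow> a < x \<and> x < b"
proof -
  define u where "u = \<bar>x - (a + b) / 2\<bar>"
  define d where "d = (b - a) / 2"
  have d: "0 < d" "d \<le> pi" using assms by (auto simp: d_def)
  have u: "0 \<le> u" "u < 2 * pi - d" using assms by (auto simp: u_def d_def abs_if field_simps)
  have cu: "cos (x - (a + b) / 2) = cos u" by (simp add: u_def)
  have ab: "a < x \<and> x < b \<longleftrightarrow> u < d" by (auto simp: u_def d_def abs_if field_simps)
  show ?thesis
  proof (cases "u < d")
    case True
    then have "cos u > cos d" using u d by (intro cos_monotone_0_pi) auto
    then show ?thesis using True ab cu by (simp add: d_def)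
  next
    case False
    have "cos u \<le> cos d"
    proof (cases "u \<le> pi")
      case True
      then show ?thesis using False d by (intro cos_monotone_0_pi_le) auto
    next
      \<comment> \<open>Beyond half a period the cosine is reflected.\<close>
      case f: False
      have "cos (2 * pi - u) \<le> cos d" using f u d by (intro cos_monotone_0_pi_le) auto
      then show ?thesis by simp
    qed
    then show ?thesis using False ab cu by (simp add: d_def)
  qed
qed

text \<open>
  The indicator function of an orthant is a bounded pointwise limit of the continuous functions \<open>\<rho> n\<close>, and each of these is
  uniformly close to a polynomial on the compact cube of side \<open>2\<close> by the Stone--Weierstrass theorem.
\<close>

lemma step_approx:
  fixes c :: "real^'d::finite"
  shows "\<exists>p. (\<forall>n. real_polynomial_function (p n)) \<and>
     (\<forall>n. \<forall>y\<in>cbox (\<chi> i. -1) (\<chi> i. 1). \<bar>p n y\<bar> \<le> 2) \<and>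
     (\<forall>y\<in>cbox (\<chi> i. -1) (\<chi> i. 1). (\<lambda>n. p n y) \<longlonglongrightarrow> (if \<forall>i. y $ i > c $ i then 1 else 0))"
proof -
  define S where "S = cbox (\<chi> i. -1) ((\<chi> i. 1) :: real^'d)"
  define \<rho> where "\<rho> = (\<lambda>(n::nat) y. \<Prod>i\<in>UNIV. min 1 (real n * max 0 (y $ i - c $ i)))"
  have "\<exists>p. real_polynomial_function p \<and> (\<forall>y\<in>S. \<bar>\<rho> n y - p y\<bar> < 1 / Suc n)" for n
  proof -
    have "compact S" by (simp add: S_def compact_cbox)
    moreover have "continuous_on S (\<rho> n)" unfolding \<rho>_def by (intro continuous_intros)
    ultimately show ?thesis
      by (rule Stone_Weierstrass_real_polynomial_function[where e = "1 / Suc n"]) auto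
  qed
  then obtain p where p: "\<And>n. real_polynomial_function (p n)" "\<And>n y. y \<in> S \<Longrightarrow> \<bar>\<rho> n y - p n y\<bar> < 1 / Suc n" by metis
  have \<rho>01: "0 \<le> \<rho> n y" "\<rho> n y \<le> 1" for n y
    unfolding \<rho>_def by (auto intro!: prod_nonneg prod_le_1)
  have "\<bar>p n y\<bar> \<le> 2" if "y \<in> S" for n y
  proof -
    have "1 / real (Suc n) \<le> 1" by simp
    then show ?thesis using p(2)[OF that, of n] \<rho>01[of n y] by linarith
  qed
  moreover have "(\<lambda>n. p n y) \<longlonglongrightarrow> (if \<forall>i. y $ i > c $ i then 1 else 0)" if y: "y \<in> S" for y
  proof -
    have "(\<lambda>n. min 1 (real n * max 0 (y $ i - c $ i))) \<longlonglongrightarrow> (if y $ i > c $ i then 1 else 0)" for i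
    proof (cases "y $ i > c $ i")
      case True
      obtain N :: nat where N: "1 / (y $ i - c $ i) < real N" using reals_Archimedean2 by blast
      have "min 1 (real n * max 0 (y $ i - c $ i)) = 1" if "n \<ge> N" for n
      proof -
        have "1 / (y $ i - c $ i) \<le> real n" using N that by linarith
        then have "1 \<le> real n * (y $ i - c $ i)" using True by (simp add: pos_divide_le_eq)
        then show ?thesis using True by simp
      qed
      then show ?thesis using True by (intro tendsto_eventually) (auto simp: eventually_sequentially)
    qed simp
    then have "(\<lambda>n. \<rho> n y) \<longlonglongrightarrow> (\<Prod>i\<in>UNIV. if y $ i > c $ i then 1 else 0)"
      unfolding \<rho>_def by (intro tendsto_prod)
    moreover have "(\<Prod>i\<in>UNIV. if y $ i > c $ i then 1 else 0) = (if \<forall>i. y $ i > c $ i then 1 else (0::real))"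
      by (auto simp: prod_zero_iff)
    ultimately have 1: "(\<lambda>n. \<rho> n y) \<longlonglongrightarrow> (if \<forall>i. y $ i > c $ i then 1 else 0)" by simp
    have 2: "(\<lambda>n. \<rho> n y - p n y) \<longlonglongrightarrow> 0"
      by (rule Lim_null_comparison[OF always_eventually LIMSEQ_Suc[OF lim_1_over_n]])
         (use p(2)[OF y] in \<open>auto intro: less_imp_le\<close>)
    show ?thesis using tendsto_diff[OF 1 2] by simp
  qed
  ultimately show ?thesis using p(1) unfolding S_def by blast
qed

lemma AE_component_nonzero: "AE x in lebesgue. \<forall>i. (x::real^'d::finite) $ i \<noteq> 0"
proof -
  have "AE x in lebesgue. (x::real^'d) $ i \<noteq> 0" for i
  proof -
    have "negligible {x::real^'d. x $ i = 0}" by (rule negligible_standard_hyperplane_cart)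
    then show ?thesis using AE_not_in[of "{x::real^'d. x $ i = 0}" lebesgue]
      by (simp add: negligible_iff_null_sets)
  qed
  then show ?thesis by (simp add: AE_all_countable)
qed

text \<open>
  Composing the polynomials of \<open>step_approx\<close> with cosines, one for each coordinate, gives trigonometric
  polynomials that converge boundedly, almost everywhere on the cube, to the indicator function of the box.
\<close>

lemma trig_box_approx:
  fixes a b :: "real^'d::finite"
  assumes "e > 0"
  shows "\<exists>g. (\<exists>t. trig_polynomial t \<and> g = (\<lambda>x. indicator cube x * t x)) \<and> sqnorm (\<lambda>x. indicator cube x * indicator (box a b) x - g x) < e"
proof -
  \<comment> \<open>Clip the box to the cube. Points with a zero coordinate are excluded because the cube, unlike the box
    clipped at \<open>0\<close>, contains them.\<close>
  define a' :: "real^'d" where "a' = (\<chi> i. max 0 (a $ i))"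
  define b' :: "real^'d" where "b' = (\<chi> i. min (2 * pi) (b $ i))"
  have in_box: "x \<in> box a b \<longleftrightarrow> (\<forall>i. a' $ i < x $ i \<and> x $ i < b' $ i)" if "x \<in> cube" "\<forall>i. x $ i \<noteq> 0" for x
  proof -
    have "0 < x $ i" "x $ i < 2 * pi" for i
      using that by (auto simp: cube_def less_le)
    then show ?thesis by (auto simp: mem_box_cart a'_def b'_def)
  qed
  show ?thesis
  proof (cases "\<forall>i. a' $ i < b' $ i")
    case False
    have "AE x in lebesgue. indicator cube x * indicator (box a b) x = (0::complex)"
      using AE_component_nonzero
    proof eventually_elim
      case (elim x)
      have "x \<notin> box a b" if "x \<in> cube" using in_box[OF that elim] False by (meson less_trans)
      then show ?case by (auto simp: indicator_def)
    qed
    then have "sqnorm (\<lambda>x. indicator cube x * indicator (box a b) x - 0) = 0"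
      by (rule sqnorm_diff_AE_eq_0)
         (intro borel_measurable_times indicator_cube_measurable borel_measurable_indicator borel_measurable_const; simp)+
    then show ?thesis using assms trig_const[of 0] by (intro exI[of _ "\<lambda>_. 0"]) auto
  next
    case True
    define m where "m = (\<chi> i. (a' $ i + b' $ i) / 2)"
    define c where "c = (\<chi> i. cos ((b' $ i - a' $ i) / 2))"
    define C where "C = (\<lambda>x::real^'d. \<chi> i. cos (x $ i - m $ i))"
    obtain p where p: "\<And>n. real_polynomial_function (p n)"
      "\<And>n y. y \<in> cbox (\<chi> i. -1) (\<chi> i. 1) \<Longrightarrow> \<bar>p n y\<bar> \<le> 2"
      "\<And>y. y \<in> cbox (\<chi> i. -1) (\<chi> i. 1) \<Longrightarrow> (\<lambda>n. p n y) \<longlonglongrightarrow> (if \<forall>i. y $ i > c $ i then 1 else 0)"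
      using step_approx[of c] by blast
    have CS: "C x \<in> cbox (\<chi> i. -1) (\<chi> i. 1)" for x by (simp add: C_def mem_box_cart)
    define g where "g = (\<lambda>n x. indicator cube x * complex_of_real (p n (C x)))"
    have tr: "trig_polynomial (\<lambda>x. complex_of_real (p n (C x)))" for n
      unfolding C_def by (rule trig_poly[OF p(1)])
    have "(\<lambda>n. sqnorm (\<lambda>x. indicator cube x * indicator (box a b) x - g n x)) \<longlonglongrightarrow> 0"
    proof (rule L2_dominated(3)[where w = "\<lambda>x. 2 * indicator cube x"])
      show "g n \<in> borel_measurable lebesgue" for n
        unfolding g_def by (rule L2_measurable[OF trig_cube_L2[OF tr]])
      show "(\<lambda>x. indicator cube x * indicator (box a b) x :: complex) \<in> borel_measurable lebesgue"
        by (intro borel_measurable_times indicator_cube_measurable borel_measurable_indicator) simp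
      show "AE x in lebesgue. cmod (g n x) \<le> 2 * indicator cube x" for n
        using p(2)[OF CS] by (auto simp: g_def indicator_def)
      show "(\<lambda>x. 2 * indicat_real cube x) \<in> borel_measurable lebesgue"
        by (intro borel_measurable_times borel_measurable_const borel_measurable_indicator cube_lebesgue)
      show "integrable lebesgue (\<lambda>x::real^'d. (2 * indicat_real cube x)\<^sup>2)"
      proof -
        have eq: "(2 * indicat_real cube x)\<^sup>2 = 4 * (cmod (indicator cube x))\<^sup>2" for x :: "real^'d" by (simp add: indicator_def)
        show ?thesis unfolding eq by (intro integrable_mult_right L2_integrable[OF indicator_cube_L2])
      qed
      show "AE x in lebesgue. (\<lambda>n. g n x) \<longlonglongrightarrow> indicator cube x * indicator (box a b) x"
        using AE_component_nonzero
      proof eventually_elim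
        case (elim x)
        show ?case
        proof (cases "x \<in> cube")
          case xQ: True
          have "x \<in> box a b \<longleftrightarrow> (\<forall>i. a' $ i < x $ i \<and> x $ i < b' $ i)" by (rule in_box[OF xQ elim])
          also have "\<dots> \<longleftrightarrow> (\<forall>i. C x $ i > c $ i)"
          proof -
            have "0 < x $ i" "x $ i < 2 * pi" for i
              using xQ elim by (auto simp: cube_def less_le)
            moreover have "0 \<le> a' $ i" "b' $ i \<le> 2 * pi" for i by (auto simp: a'_def b'_def)
            ultimately show ?thesis using True by (simp add: C_def c_def m_def cos_gt_iff)
          qed
          finally have "(indicator (box a b) x :: complex) = of_real (if \<forall>i. C x $ i > c $ i then 1 else 0)"
            by (simp add: indicator_def)
          then show ?thesis unfolding g_def using p(3)[OF CS[of x]]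
            by (simp only:) (intro tendsto_intros)
        qed (simp add: g_def)
      qed
    qed
    from order_tendstoD(2)[OF this assms] obtain n where "sqnorm (\<lambda>x. indicator cube x * indicator (box a b) x - g n x) < e"
      by (auto simp: eventually_sequentially)
    then show ?thesis using tr[of n] by (intro exI[of _ "g n"]) (auto simp: g_def)
  qed
qed

section \<open>Parseval's identity for compactly supported functions\<close>

text \<open>
  The exponential is not conjugated, in accordance with the factor \<open>e\<^bsup>-ik \<cdot> U\<xi>\<^esup>\<close> of the dilated generators, which is
  conjugated in a pairing.
\<close>

definition fourier_coeff :: "real^'d::finite \<Rightarrow> 'd cfun \<Rightarrow> complex" where
  "fourier_coeff k P = (LINT x|lebesgue. P x * character k x)"

lemma Parseval_cube:
  fixes P :: "'d::finite cfun"
  assumes P: "L2 P" and supp: "\<And>x. x \<notin> cube \<Longrightarrow> P x = 0"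
  shows "((\<lambda>k. (cmod (fourier_coeff k P))\<^sup>2) has_sum ((2 * pi) ^ CARD('d) * sqnorm P)) Zd"
proof -
  define E where "E = (\<lambda>k x. indicator cube x * character (- k :: real^'d) x)"
  have EL: "L2 (E k)" if "k \<in> Zd" for k
    unfolding E_def using trig_cube_L2[OF trig_polynomial.base[OF that, of 1]] by simp
  have pE: "pair_fun P (E k) = fourier_coeff k P" for k
    unfolding pair_fun_def fourier_coeff_def
    by (intro Bochner_Integration.integral_cong refl) (use supp in \<open>auto simp: E_def indicator_def character_cnj\<close>)
  have "((\<lambda>k. (cmod (pair_fun P (E k)))\<^sup>2) has_sum ((2 * pi) ^ CARD('d) * sqnorm P)) Zd"
  proof (rule Parseval_orthogonal[OF P EL])
    fix k l :: "real^'d" assume k: "k \<in> Zd" "l \<in> Zd"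
    have "pair_fun (E k) (E l) = (LINT x|lebesgue. indicator cube x * character (l - k) x)"
      unfolding pair_fun_def
    proof (intro Bochner_Integration.integral_cong refl)
      fix x
      show "E k x * cnj (E l x) = indicator cube x * character (l - k) x"
        using character_add[of l "- k" x] by (auto simp: E_def indicator_def character_cnj)
    qed
    then show "pair_fun (E k) (E l) = (if k = l then of_real ((2 * pi) ^ CARD('d)) else 0)"
      using integral_character_cube[OF Zd_diff[OF k(2,1)]] by auto
  next
    fix e :: real assume "e > 0"
    have "\<exists>g. (\<exists>t. trig_polynomial t \<and> g = (\<lambda>x. indicator cube x * t x)) \<and> sqnorm (\<lambda>x. indicator cube x * P x - g x) < e"
    proof (rule L2_approx[OF cube_lebesgue _ _ _ trig_box_approx P \<open>e > 0\<close>])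
      show "L2 f" if "\<exists>t. trig_polynomial t \<and> f = (\<lambda>x. indicator cube x * t x)" for f :: "'d cfun"
        using that trig_cube_L2 by auto
      show "\<exists>t. trig_polynomial t \<and> (\<lambda>x. f x + g x) = (\<lambda>x. indicator cube x * t x)"
        if fg: "\<exists>t. trig_polynomial t \<and> f = (\<lambda>x. indicator cube x * t x)" "\<exists>t. trig_polynomial t \<and> g = (\<lambda>x. indicator cube x * t x)" for f g :: "'d cfun"
      proof -
        obtain t u where "trig_polynomial t" "f = (\<lambda>x. indicator cube x * t x)" "trig_polynomial u" "g = (\<lambda>x. indicator cube x * u x)" using fg by blast
        then show ?thesis by (intro exI[of _ "\<lambda>x. t x + u x"]) (auto intro: trig_polynomial.add simp: distrib_left)
      qed
      show "\<exists>t. trig_polynomial t \<and> (\<lambda>x. c * f x) = (\<lambda>x. indicator cube x * t x)"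
        if fg: "\<exists>t. trig_polynomial t \<and> f = (\<lambda>x. indicator cube x * t x)" for c and f :: "'d cfun"
      proof -
        obtain t where "trig_polynomial t" "f = (\<lambda>x. indicator cube x * t x)" using fg by blast
        then show ?thesis by (intro exI[of _ "\<lambda>x. c * t x"]) (auto intro: trig_cmult simp: mult_ac)
      qed
    qed
    then obtain t where t: "trig_polynomial t" "sqnorm (\<lambda>x. indicator cube x * P x - indicator cube x * t x) < e" by blast
    obtain K c where K: "finite K" "K \<subseteq> Zd" "t = (\<lambda>x. \<Sum>k\<in>K. c k * character (- k) x)" using trig_rep[OF t(1)] by blast
    have "(\<lambda>x. indicator cube x * P x - indicator cube x * t x) = (\<lambda>x. P x - (\<Sum>k\<in>K. c k * E k x))"
    proof
      fix x
      show "indicator cube x * P x - indicator cube x * t x = P x - (\<Sum>k\<in>K. c k * E k x)"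
        using supp[of x] by (cases "x \<in> cube") (auto simp: E_def K(3))
    qed
    then show "\<exists>K c. finite K \<and> K \<subseteq> Zd \<and> sqnorm (\<lambda>x. P x - (\<Sum>k\<in>K. c k * E k x)) < e"
      using t(2) K by (intro exI[of _ K] exI[of _ c]) auto
  next
    show "0 < (2 * pi) ^ CARD('d)" by (rule zero_less_power) simp
  qed
  then show ?thesis unfolding pE .
qed

lemma L2_translate: "L2 f \<Longrightarrow> L2 (\<lambda>x. f (x + b))" for f :: "'d::finite cfun"
  unfolding L2_def using measurable_translate[of f b] integrable_affine[of "mat 1" "\<lambda>x. (cmod (f x))\<^sup>2" b]
  by (simp add: invertible_det_nz)

lemma L2_character_integrable:
  assumes "L2 F" "bounded {x. F x \<noteq> 0}"
  shows "integrable lebesgue (\<lambda>x. F x * character k x)"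
proof -
  obtain a b where ab: "{x. F x \<noteq> 0} \<subseteq> cbox a b"
    using bounded_subset_cbox_symmetric[OF assms(2)] by blast
  have "L2 (\<lambda>x. character k x * indicator (cbox a b) x)"
    by (rule L2_mult_bounded[OF L2_indicator_bounded character_measurable, of _ _ 1]) (auto simp: character_norm bounded_cbox)
  from L2_prod_integrable[OF assms(1) this]
  have "integrable lebesgue (\<lambda>x. F x * (character k x * indicator (cbox a b) x))" .
  moreover have "(\<lambda>x. F x * (character k x * indicator (cbox a b) x)) = (\<lambda>x. F x * character k x)"
  proof
    fix x show "F x * (character k x * indicator (cbox a b) x) = F x * character k x"
      using ab by (cases "x \<in> cbox a b") auto
  qed
  ultimately show ?thesis by simp
qed

text \<open>
  For a function with bounded support a finite set \<open>Z\<close> yields the whole periodization on the cube, and the sum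
  raises no question of convergence.
\<close>

definition periodize :: "(real^'d::finite) set \<Rightarrow> 'd cfun \<Rightarrow> 'd cfun" where
  "periodize Z F = (\<lambda>x. indicator cube x * (\<Sum>n\<in>Z. F (x + (2 * pi) *\<^sub>R n)))"

lemma periodize_L2:
  assumes "L2 F" "finite Z" shows "L2 (periodize Z F)"
proof -
  have "L2 (\<lambda>x. \<Sum>n\<in>Z. F (x + (2 * pi) *\<^sub>R n))"
    using assms(2) by (induction Z rule: finite_induct) (auto intro!: L2_zero L2_add(1) L2_translate assms(1))
  then show ?thesis unfolding periodize_def by (rule sqnorm_mult_indicator_le(1)[OF cube_lebesgue])
qed

text \<open>
  Characters with integer frequencies are periodic, so they do not distinguish a function from its periodization.
\<close>

lemma fourier_coeff_periodize:
  assumes F: "L2 F" "bounded {x. F x \<noteq> 0}" and Z: "finite Z" "Z \<subseteq> Zd" "\<And>x. F x \<noteq> 0 \<Longrightarrow> lattice_part x \<in> Z" and k: "k \<in> Zd"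
  shows "fourier_coeff k (periodize Z F) = fourier_coeff k F"
proof -
  note Fi = L2_character_integrable[OF F, of k]
  have "fourier_coeff k F = (\<Sum>n\<in>Z. LINT x|lebesgue. indicator cube x * (F (x + (2 * pi) *\<^sub>R n) * character k (x + (2 * pi) *\<^sub>R n)))"
    unfolding fourier_coeff_def by (rule integral_unfold_cube[OF Fi Z(1,2)]) (use Z(3) in auto)
  also have "\<dots> = (LINT x|lebesgue. (\<Sum>n\<in>Z. indicator cube x * (F (x + (2 * pi) *\<^sub>R n) * character k (x + (2 * pi) *\<^sub>R n))))"
    by (rule Bochner_Integration.integral_sum[symmetric], rule integrable_cube_mult, rule integrable_translate[OF Fi])
  also have "\<dots> = fourier_coeff k (periodize Z F)"
    unfolding fourier_coeff_def periodize_def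
  proof (intro Bochner_Integration.integral_cong refl)
    fix x
    show "(\<Sum>n\<in>Z. indicator cube x * (F (x + (2 * pi) *\<^sub>R n) * character k (x + (2 * pi) *\<^sub>R n))) = indicator cube x * (\<Sum>n\<in>Z. F (x + (2 * pi) *\<^sub>R n)) * character k x"
      unfolding sum_distrib_left sum_distrib_right
      by (intro sum.cong refl) (use Z character_periodic[OF k] in \<open>auto simp: subset_iff\<close>)
  qed
  finally show ?thesis by simp
qed

text \<open>
  Parseval's identity for the periodizations gives a double sum over pairs of translates of \<open>F\<close> and \<open>G\<close>. Unfolding the integral over
  the cube to one over the whole space absorbs one of the two sums; what remains is indexed by the difference of the translates.
\<close>

lemma Parseval_periodized:
  fixes F G :: "'d::finite cfun"
  assumes F: "L2 F" "bounded {x. F x \<noteq> 0}" and G: "L2 G" "bounded {x. G x \<noteq> 0}"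
    and Z: "finite Z" "Z \<subseteq> Zd" "\<And>x n. n \<in> Zd \<Longrightarrow> F x \<noteq> 0 \<Longrightarrow> G (x + (2 * pi) *\<^sub>R n) \<noteq> 0 \<Longrightarrow> n \<in> Z"
  shows "((\<lambda>k. fourier_coeff k F * cnj (fourier_coeff k G)) has_sum
     ((2 * pi) ^ CARD('d) * (\<Sum>n\<in>Z. pair_fun F (\<lambda>x. G (x + (2 * pi) *\<^sub>R n))))) Zd"
proof -
  define Y where "Y = lattice_part ` {x. F x \<noteq> 0} \<union> lattice_part ` {x. G x \<noteq> 0}"
  have Y: "finite Y" "Y \<subseteq> Zd" "\<And>x. F x \<noteq> 0 \<Longrightarrow> lattice_part x \<in> Y" "\<And>x. G x \<noteq> 0 \<Longrightarrow> lattice_part x \<in> Y"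
    using bounded_lattice_part_image[OF F(2)] bounded_lattice_part_image[OF G(2)] lattice_part_Zd by (auto simp: Y_def)
  define P where "P = periodize Y F"
  define R where "R = periodize Y G"
  have PL: "L2 P" "L2 R" unfolding P_def R_def by (intro periodize_L2 F G Y)+
  have P0: "P x = 0" "R x = 0" if "x \<notin> cube" for x using that by (auto simp: P_def R_def periodize_def)
  have Pb: "bounded {x. P x \<noteq> 0}" "bounded {x. R x \<noteq> 0}"
    by (rule bounded_subset[OF cube_bounded], use P0 in blast)+
  have "((\<lambda>k. (\<lambda>f k. fourier_coeff k f) P k * cnj ((\<lambda>f k. fourier_coeff k f) R k)) has_sum (of_real ((2 * pi) ^ CARD('d)) * pair_fun P R)) Zd"
  proof (rule has_sum_polarization[OF PL])
    fix c :: complex and k :: "real^'d"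
    show "fourier_coeff k (\<lambda>x. P x + c * R x) = fourier_coeff k P + c * fourier_coeff k R"
      using L2_character_integrable[OF PL(1) Pb(1)] L2_character_integrable[OF PL(2) Pb(2)]
      by (simp add: fourier_coeff_def distrib_right mult.assoc)
    show "((\<lambda>k. (cmod (fourier_coeff k (\<lambda>x. P x + c * R x)))\<^sup>2) has_sum (2 * pi) ^ CARD('d) * sqnorm (\<lambda>x. P x + c * R x)) Zd"
      by (rule Parseval_cube) (use P0 PL in \<open>auto intro: L2_add L2_cmult\<close>)
  qed
  then have "((\<lambda>k. fourier_coeff k P * cnj (fourier_coeff k R)) has_sum (of_real ((2 * pi) ^ CARD('d)) * pair_fun P R)) Zd" by simp
  then have hs: "((\<lambda>k. fourier_coeff k F * cnj (fourier_coeff k G)) has_sum (of_real ((2 * pi) ^ CARD('d)) * pair_fun P R)) Zd"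
    by (subst (asm) has_sum_cong[where g = "\<lambda>k. fourier_coeff k F * cnj (fourier_coeff k G)"])
       (simp_all add: P_def R_def fourier_coeff_periodize[OF F Y(1,2,3)] fourier_coeff_periodize[OF G Y(1,2,4)])
  have FGi: "integrable lebesgue (\<lambda>x. F x * cnj (G (x + (2 * pi) *\<^sub>R n)))" for n
    by (intro pair_fun_integrable F L2_translate G)
  define H where "H = (\<lambda>x. \<Sum>n\<in>Z. F x * cnj (G (x + (2 * pi) *\<^sub>R n)))"
  have Hi: "integrable lebesgue H" unfolding H_def by (intro Bochner_Integration.integrable_sum FGi)
  have "(\<Sum>n\<in>Z. pair_fun F (\<lambda>x. G (x + (2 * pi) *\<^sub>R n))) = (LINT x|lebesgue. H x)"
    unfolding H_def pair_fun_def by (rule Bochner_Integration.integral_sum[symmetric, OF FGi])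
  also have "\<dots> = (\<Sum>n\<in>Y. LINT x|lebesgue. indicator cube x * H (x + (2 * pi) *\<^sub>R n))"
    by (rule integral_unfold_cube[OF Hi Y(1,2)]) (rule Y(3), auto simp: H_def)
  also have "\<dots> = (LINT x|lebesgue. (\<Sum>n\<in>Y. indicator cube x * H (x + (2 * pi) *\<^sub>R n)))"
    by (rule Bochner_Integration.integral_sum[symmetric], rule integrable_cube_mult, rule integrable_translate[OF Hi])
  also have "\<dots> = pair_fun P R"
    unfolding pair_fun_def
  proof (intro Bochner_Integration.integral_cong refl)
    fix x
    show "(\<Sum>n\<in>Y. indicator cube x * H (x + (2 * pi) *\<^sub>R n)) = P x * cnj (R x)"
    proof (cases "x \<in> cube")
      case True
      have "H (x + (2 * pi) *\<^sub>R n) = F (x + (2 * pi) *\<^sub>R n) * (\<Sum>m\<in>Y. cnj (G (x + (2 * pi) *\<^sub>R m)))" if n: "n \<in> Y" for n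
      proof (cases "F (x + (2 * pi) *\<^sub>R n) = 0")
        case True
        then show ?thesis by (simp add: H_def)
      next
        case False
        have shift: "x + (2 * pi) *\<^sub>R n + (2 * pi) *\<^sub>R m = x + (2 * pi) *\<^sub>R (n + m)" for m
          by (simp add: scaleR_add_right)
        have nZ: "n \<in> Zd" using n Y by auto
        have "(\<Sum>m\<in>Z. cnj (G (x + (2 * pi) *\<^sub>R n + (2 * pi) *\<^sub>R m))) = (\<Sum>m\<in>Y. cnj (G (x + (2 * pi) *\<^sub>R m)))"
          unfolding shift
        \<comment> \<open>Both index sets are finite and contain all lattice points that contribute, so shifting by \<open>n\<close> matches the
          nonzero terms.\<close>
        proof (rule sum.reindex_bij_witness_not_neutral[of "{m\<in>Z. G (x + (2 * pi) *\<^sub>R (n + m)) = 0}" "{m\<in>Y. G (x + (2 * pi) *\<^sub>R m) = 0}" _ "\<lambda>m. m - n" "\<lambda>m. n + m"])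
          fix m assume m: "m \<in> Z - {m\<in>Z. G (x + (2 * pi) *\<^sub>R (n + m)) = 0}"
          then have "n + m \<in> Zd" using Z nZ by (auto intro: Zd_add)
          moreover have "lattice_part (x + (2 * pi) *\<^sub>R (n + m)) \<in> Y" using m Y(4) by auto
          ultimately show "n + m \<in> Y - {m\<in>Y. G (x + (2 * pi) *\<^sub>R m) = 0}"
            using lattice_part_unique[OF \<open>x \<in> cube\<close>, of "n + m"] m by auto
        next
          fix m assume m: "m \<in> Y - {m\<in>Y. G (x + (2 * pi) *\<^sub>R m) = 0}"
          have "m - n \<in> Z"
          proof (rule Z(3)[OF _ False])
            show "m - n \<in> Zd" using m Y nZ by (auto intro: Zd_diff)
            show "G (x + (2 * pi) *\<^sub>R n + (2 * pi) *\<^sub>R (m - n)) \<noteq> 0" unfolding shift using m by auto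
          qed
          then show "m - n \<in> Z - {m\<in>Z. G (x + (2 * pi) *\<^sub>R (n + m)) = 0}" using m by auto
        qed (use Z Y in auto)
        then show ?thesis by (simp only: H_def sum_distrib_left[symmetric])
      qed
      then have "(\<Sum>n\<in>Y. indicator cube x * H (x + (2 * pi) *\<^sub>R n)) = (\<Sum>n\<in>Y. F (x + (2 * pi) *\<^sub>R n) * (\<Sum>m\<in>Y. cnj (G (x + (2 * pi) *\<^sub>R m))))"
        using True by (intro sum.cong) auto
      then show ?thesis using True by (simp add: P_def R_def periodize_def sum_distrib_right)
    qed (simp add: P_def periodize_def)
  qed
  finally show ?thesis using hs by simp
qed

section \<open>Fiberization of one level\<close>

lemma idx_finite: "r \<noteq> \<infinity> \<Longrightarrow> finite (idx r)"
  by (cases r) (auto simp: idx_def)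

lemma L2_loc_measurable: "L2_loc \<phi> \<Longrightarrow> \<phi> \<in> borel_measurable lebesgue"
  by (simp add: L2_loc_def)

text \<open>
  The function whose Fourier coefficients are, up to a scalar, the pairings of \<open>f\<close> with the modulated \<open>U\<close>-dilations of \<open>\<phi>\<close>.
\<close>

definition pull :: "real^'d^'d \<Rightarrow> 'd::finite cfun \<Rightarrow> 'd cfun \<Rightarrow> 'd cfun" where
  "pull U \<phi> f = (\<lambda>\<eta>. f (matrix_inv U *v \<eta>) * cnj (\<phi> \<eta>))"

lemma measurable_cnj: "f \<in> borel_measurable lebesgue \<Longrightarrow> (\<lambda>x. cnj (f x)) \<in> borel_measurable lebesgue"
  by (rule measurable_compose[OF _ borel_measurable_continuous_onI[OF continuous_on_cnj[OF continuous_on_id]]])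

lemma invertible_matrix_inv:
  fixes U :: "real^'d^'d::finite"
  assumes "invertible U" shows "invertible (matrix_inv U)"
proof -
  have "U ** matrix_inv U = mat 1 \<and> matrix_inv U ** U = mat 1"
    using assms unfolding matrix_inv_def invertible_def by (rule someI_ex)
  then show ?thesis unfolding invertible_def by blast
qed

lemma test_fun_linear:
  fixes U :: "real^'d^'d::finite"
  assumes "test_fun f" "invertible U" shows "test_fun (\<lambda>x. f (U *v x))"
  using test_fun_affine[OF assms, of 0] by simp

lemma test_fun_dil:
  fixes U :: "real^'d^'d::finite"
  assumes "invertible U" "test_fun f"
  shows "test_fun (\<lambda>\<eta>. of_real (1 / sqrt \<bar>det U\<bar>) * exp (- \<i> * of_real (k \<bullet> \<eta>)) * f (matrix_inv U *v \<eta>))"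
  by (rule test_fun_mult_left[OF smooth_mult[OF smooth_const smooth_exp] test_fun_linear[OF assms(2) invertible_matrix_inv[OF assms(1)]]])

context
  fixes U :: "real^'d^'d::finite" and T :: "'d functional" and \<phi> :: "'d cfun"
  assumes U: "invertible U" and m: "\<phi> \<in> borel_measurable lebesgue" and repr: "represents \<phi> T"
begin

lemma pair_fun_dist_fourier_coeff:
  assumes f: "test_fun f"
  shows "pair_fun_dist f (dist_dil U k T) = of_real (1 / sqrt \<bar>det U\<bar>) * fourier_coeff k (pull U \<phi> f)"
proof -
  let ?c = "complex_of_real (1 / sqrt \<bar>det U\<bar>)"
  let ?h = "\<lambda>\<eta>. ?c * exp (- \<i> * of_real (k \<bullet> \<eta>)) * cnj (f (matrix_inv U *v \<eta>))"
  have "T ?h = (LINT \<eta>|lebesgue. \<phi> \<eta> * ?h \<eta>)"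
    using repr test_fun_dil[OF U test_fun_cnj[OF f]] by (auto simp: represents_def)
  then have "pair_fun_dist f (dist_dil U k T) = cnj (LINT \<eta>|lebesgue. \<phi> \<eta> * ?h \<eta>)"
    by (simp add: pair_fun_dist_def pair_dist_fun_def dist_dil_def)
  also have "\<dots> = (LINT \<eta>|lebesgue. cnj (\<phi> \<eta> * ?h \<eta>))"
    by (rule Bochner_Integration.integral_cnj[symmetric])
  also have "\<dots> = (LINT \<eta>|lebesgue. ?c * (pull U \<phi> f \<eta> * character k \<eta>))"
    by (intro Bochner_Integration.integral_cong refl) (simp add: pull_def character_def exp_cnj mult_ac)
  also have "\<dots> = ?c * fourier_coeff k (pull U \<phi> f)"
    unfolding fourier_coeff_def by (rule integral_mult_right_zero)
  finally show ?thesis .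
qed

lemma pair_fun_dist_represents:
  assumes f: "test_fun f"
  shows "pair_fun_dist f (dist_dil U k T) = pair_fun f (fun_dil U k \<phi>)"
proof -
  let ?c = "complex_of_real (1 / sqrt \<bar>det U\<bar>)"
  let ?H = "\<lambda>\<eta>. ?c * (pull U \<phi> f \<eta> * character k \<eta>)"
  have fm: "f \<in> borel_measurable lebesgue" using f by (rule test_fun_measurable)
  have mH: "?H \<in> borel_measurable lebesgue"
    unfolding pull_def using measurable_affine_comp[OF invertible_matrix_inv[OF U] fm, of 0] measurable_cnj[OF m] character_measurable[of k]
    by (intro borel_measurable_times borel_measurable_const) auto
  have d: "det U \<noteq> 0" using U by (simp add: invertible_det_nz)
  have "of_real (1 / sqrt \<bar>det U\<bar>) * fourier_coeff k (pull U \<phi> f) = (LINT \<eta>|lebesgue. ?H \<eta>)"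
    unfolding fourier_coeff_def by (rule integral_mult_right_zero[symmetric])
  also have "\<dots> = of_real \<bar>det U\<bar> * (LINT \<xi>|lebesgue. ?H (U *v \<xi>))"
    using integral_affine[OF U mH, of 0] d by (simp add: scaleR_conv_of_real)
  also have "\<dots> = (LINT \<xi>|lebesgue. of_real \<bar>det U\<bar> * ?H (U *v \<xi>))"
    by (rule integral_mult_right_zero[symmetric])
  also have "\<dots> = pair_fun f (fun_dil U k \<phi>)"
    unfolding pair_fun_def
  proof (intro Bochner_Integration.integral_cong refl)
    fix \<xi>
    have "\<bar>det U\<bar> * (1 / sqrt \<bar>det U\<bar>) = sqrt \<bar>det U\<bar>"
      using d by (simp add: real_div_sqrt)
    then have "of_real \<bar>det U\<bar> * ?c = of_real (sqrt \<bar>det U\<bar>)"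
      unfolding of_real_mult[symmetric] by simp
    then have "of_real \<bar>det U\<bar> * ?H (U *v \<xi>) = of_real (sqrt \<bar>det U\<bar>) * (pull U \<phi> f (U *v \<xi>) * character k (U *v \<xi>))"
      by (simp only: mult.assoc[symmetric])
    also have "\<dots> = f \<xi> * cnj (fun_dil U k \<phi> \<xi>)"
      by (simp add: pull_def fun_dil_def character_def exp_cnj matrix_inv_cancel[OF U])
    finally show "of_real \<bar>det U\<bar> * ?H (U *v \<xi>) = f \<xi> * cnj (fun_dil U k \<phi> \<xi>)" .
  qed
  finally show ?thesis using pair_fun_dist_fourier_coeff[OF f] by simp
qed

end

context
  fixes U :: "real^'d^'d::finite" and \<phi> :: "'d cfun"
  assumes U: "invertible U" and loc: "L2_loc \<phi>"
begin

lemma pull_bounded_support: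
  assumes f: "test_fun f"
  shows "bounded {\<eta>. pull U \<phi> f \<eta> \<noteq> 0}"
proof (rule bounded_subset)
  show "bounded {\<eta>. f (matrix_inv U *v \<eta>) \<noteq> 0}"
    using test_fun_linear[OF f invertible_matrix_inv[OF U]] by (simp add: test_fun_iff)
qed (auto simp: pull_def)

text \<open>
  This is where local square integrability enters: only the values of \<open>\<phi>\<close> on the support of a test function matter.
\<close>

lemma pull_L2:
  assumes f: "test_fun f"
  shows "L2 (pull U \<phi> f)"
proof -
  let ?f = "\<lambda>\<eta>. f (matrix_inv U *v \<eta>)"
  have tf: "test_fun ?f" by (rule test_fun_linear[OF f invertible_matrix_inv[OF U]])
  obtain B where B: "B > 0" "\<And>x. cmod (?f x) \<le> B" using test_fun_bounded[OF tf] by blast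
  obtain a b where ab: "{x. ?f x \<noteq> 0} \<subseteq> cbox a b"
  proof -
    have "bounded {x. ?f x \<noteq> 0}" using tf by (simp add: test_fun_iff)
    from bounded_subset_cbox_symmetric[OF this] show thesis using that by blast
  qed
  have "integrable lebesgue (\<lambda>x. B\<^sup>2 * (indicat_real (cbox a b) x *\<^sub>R (cmod (\<phi> x))\<^sup>2))"
    using loc compact_cbox[of a b] by (intro integrable_mult_right) (auto simp: L2_loc_def set_integrable_def)
  moreover have "(cmod (pull U \<phi> f x))\<^sup>2 \<le> B\<^sup>2 * (indicat_real (cbox a b) x *\<^sub>R (cmod (\<phi> x))\<^sup>2)" for x
  proof (cases "x \<in> cbox a b")
    case True
    then show ?thesis using B(2)[of x]
      by (simp add: pull_def norm_mult power_mult_distrib mult_right_mono power_mono)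
  next
    case False
    then have "?f x = 0" using ab by auto
    then show ?thesis using False by (simp add: pull_def)
  qed
  moreover have "pull U \<phi> f \<in> borel_measurable lebesgue"
    unfolding pull_def by (intro borel_measurable_times test_fun_measurable[OF tf] measurable_cnj L2_loc_measurable loc)
  ultimately show ?thesis by (intro L2_bound[where w = "\<lambda>x. B\<^sup>2 * (indicat_real (cbox a b) x *\<^sub>R (cmod (\<phi> x))\<^sup>2)"] AE_I2)
qed

lemma pair_fun_pull:
  assumes f: "test_fun f" and g: "test_fun g"
  shows "integrable lebesgue (\<lambda>\<xi>. f \<xi> * cnj (g (\<xi> + (2 * pi) *\<^sub>R \<kappa>)) * (cnj (\<phi> (U *v \<xi>)) * \<phi> (U *v \<xi> + (2 * pi) *\<^sub>R (U *v \<kappa>))))"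
    and "pair_fun (pull U \<phi> f) (\<lambda>\<eta>. pull U \<phi> g (\<eta> + (2 * pi) *\<^sub>R (U *v \<kappa>)))
      = of_real \<bar>det U\<bar> * (LINT \<xi>|lebesgue. f \<xi> * cnj (g (\<xi> + (2 * pi) *\<^sub>R \<kappa>)) * (cnj (\<phi> (U *v \<xi>)) * \<phi> (U *v \<xi> + (2 * pi) *\<^sub>R (U *v \<kappa>))))"
proof -
  let ?H = "\<lambda>\<eta>. pull U \<phi> f \<eta> * cnj (pull U \<phi> g (\<eta> + (2 * pi) *\<^sub>R (U *v \<kappa>)))"
  have Hi: "integrable lebesgue ?H"
    by (intro pair_fun_integrable pull_L2 L2_translate f g)
  have eq: "?H (U *v \<xi>) = f \<xi> * cnj (g (\<xi> + (2 * pi) *\<^sub>R \<kappa>)) * (cnj (\<phi> (U *v \<xi>)) * \<phi> (U *v \<xi> + (2 * pi) *\<^sub>R (U *v \<kappa>)))" for \<xi>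
  proof -
    have "U *v \<xi> + (2 * pi) *\<^sub>R (U *v \<kappa>) = U *v (\<xi> + (2 * pi) *\<^sub>R \<kappa>)"
      by (simp add: matrix_vector_right_distrib matrix_vector_mult_scaleR)
    then have "matrix_inv U *v (U *v \<xi> + (2 * pi) *\<^sub>R (U *v \<kappa>)) = \<xi> + (2 * pi) *\<^sub>R \<kappa>"
      by (simp only: matrix_inv_cancel[OF U])
    then show ?thesis by (simp add: pull_def matrix_inv_cancel[OF U] mult_ac)
  qed
  show "integrable lebesgue (\<lambda>\<xi>. f \<xi> * cnj (g (\<xi> + (2 * pi) *\<^sub>R \<kappa>)) * (cnj (\<phi> (U *v \<xi>)) * \<phi> (U *v \<xi> + (2 * pi) *\<^sub>R (U *v \<kappa>))))"
    using integrable_affine[OF U Hi, of 0] unfolding add_0_right eq .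
  have d: "det U \<noteq> 0" using U by (simp add: invertible_det_nz)
  have "(LINT \<xi>|lebesgue. ?H (U *v \<xi> + 0)) = (1 / \<bar>det U\<bar>) *\<^sub>R (LINT \<eta>|lebesgue. ?H \<eta>)"
    by (rule integral_affine[OF U]) (use Hi in simp)
  then have "pair_fun (pull U \<phi> f) (\<lambda>\<eta>. pull U \<phi> g (\<eta> + (2 * pi) *\<^sub>R (U *v \<kappa>))) = of_real \<bar>det U\<bar> * (LINT \<xi>|lebesgue. ?H (U *v \<xi>))"
    using d by (simp add: pair_fun_def scaleR_conv_of_real)
  then show "pair_fun (pull U \<phi> f) (\<lambda>\<eta>. pull U \<phi> g (\<eta> + (2 * pi) *\<^sub>R (U *v \<kappa>)))
      = of_real \<bar>det U\<bar> * (LINT \<xi>|lebesgue. f \<xi> * cnj (g (\<xi> + (2 * pi) *\<^sub>R \<kappa>)) * (cnj (\<phi> (U *v \<xi>)) * \<phi> (U *v \<xi> + (2 * pi) *\<^sub>R (U *v \<kappa>))))"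
    unfolding eq .
qed

text \<open>
  \<open>Parseval_periodized\<close> for the two pulled back functions, followed by the substitutions \<open>\<eta> = U \<xi>\<close> in the integrals and
  \<open>n = U \<kappa>\<close> in the sum over lattice vectors. The Jacobian cancels the normalization of the dilations.
\<close>

lemma dual_term_has_sum_single:
  assumes repr: "represents \<phi> T" and f: "test_fun f" and g: "test_fun g"
    and L: "finite L" "\<And>\<kappa> \<xi>. U *v \<kappa> \<in> Zd \<Longrightarrow> f \<xi> \<noteq> 0 \<Longrightarrow> g (\<xi> + (2 * pi) *\<^sub>R \<kappa>) \<noteq> 0 \<Longrightarrow> \<kappa> \<in> L"
  shows "((\<lambda>k. pair_fun_dist f (dist_dil U k T) * pair_dist_fun (dist_dil U k T) g) has_sum
     ((2 * pi) ^ CARD('d) * (\<Sum>\<kappa>\<in>{\<kappa>\<in>L. U *v \<kappa> \<in> Zd}. LINT \<xi>|lebesgue. f \<xi> * cnj (g (\<xi> + (2 * pi) *\<^sub>R \<kappa>)) * (cnj (\<phi> (U *v \<xi>)) * \<phi> (U *v \<xi> + (2 * pi) *\<^sub>R (U *v \<kappa>)))))) Zd"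
proof -
  note m = L2_loc_measurable[OF loc]
  define c where "c = complex_of_real (1 / sqrt \<bar>det U\<bar>)"
  let ?L = "{\<kappa>\<in>L. U *v \<kappa> \<in> Zd}"
  have d: "\<bar>det U\<bar> > 0" using U by (simp add: invertible_det_nz)
  have inj: "inj_on ((*v) U) A" for A
    by (rule inj_on_inverseI[of _ "(*v) (matrix_inv U)"]) (simp add: matrix_inv_cancel[OF U])
  have "((\<lambda>k. fourier_coeff k (pull U \<phi> f) * cnj (fourier_coeff k (pull U \<phi> g))) has_sum
     ((2 * pi) ^ CARD('d) * (\<Sum>n\<in>(*v) U ` ?L. pair_fun (pull U \<phi> f) (\<lambda>x. pull U \<phi> g (x + (2 * pi) *\<^sub>R n))))) Zd"
  proof (rule Parseval_periodized)
    show "finite ((*v) U ` ?L)" using L(1) by simp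
    fix x and n :: "real^'d" assume n: "n \<in> Zd" and F: "pull U \<phi> f x \<noteq> 0" and G: "pull U \<phi> g (x + (2 * pi) *\<^sub>R n) \<noteq> 0"
    let ?\<kappa> = "matrix_inv U *v n"
    have "?\<kappa> \<in> L"
    proof (rule L(2))
      show "U *v ?\<kappa> \<in> Zd" using n by (simp add: matrix_inv_cancel[OF U])
      show "f (matrix_inv U *v x) \<noteq> 0" using F by (auto simp: pull_def)
      show "g (matrix_inv U *v x + (2 * pi) *\<^sub>R ?\<kappa>) \<noteq> 0"
        using G by (auto simp: pull_def matrix_vector_right_distrib matrix_vector_mult_scaleR)
    qed
    then show "n \<in> (*v) U ` ?L" using n by (intro image_eqI[of _ _ ?\<kappa>]) (auto simp: matrix_inv_cancel[OF U])
  qed (auto intro: pull_L2 pull_bounded_support f g)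
  then have "((\<lambda>k. (c * cnj c) * (fourier_coeff k (pull U \<phi> f) * cnj (fourier_coeff k (pull U \<phi> g)))) has_sum
     ((c * cnj c) * ((2 * pi) ^ CARD('d) * (\<Sum>n\<in>(*v) U ` ?L. pair_fun (pull U \<phi> f) (\<lambda>x. pull U \<phi> g (x + (2 * pi) *\<^sub>R n)))))) Zd"
    by (rule has_sum_cmult_right)
  moreover have "(c * cnj c) * (fourier_coeff k (pull U \<phi> f) * cnj (fourier_coeff k (pull U \<phi> g))) = pair_fun_dist f (dist_dil U k T) * pair_dist_fun (dist_dil U k T) g" for k
  proof -
    have "pair_dist_fun (dist_dil U k T) g = cnj (pair_fun_dist g (dist_dil U k T))"
      by (simp add: pair_fun_dist_def)
    then show ?thesis
      by (simp add: pair_fun_dist_fourier_coeff[OF U m repr f] pair_fun_dist_fourier_coeff[OF U m repr g] c_def mult_ac)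
  qed
  moreover have "(c * cnj c) * (\<Sum>n\<in>(*v) U ` ?L. pair_fun (pull U \<phi> f) (\<lambda>x. pull U \<phi> g (x + (2 * pi) *\<^sub>R n)))
    = (\<Sum>\<kappa>\<in>?L. LINT \<xi>|lebesgue. f \<xi> * cnj (g (\<xi> + (2 * pi) *\<^sub>R \<kappa>)) * (cnj (\<phi> (U *v \<xi>)) * \<phi> (U *v \<xi> + (2 * pi) *\<^sub>R (U *v \<kappa>))))"
  proof -
    have "c * cnj c = of_real ((1 / sqrt \<bar>det U\<bar>) * (1 / sqrt \<bar>det U\<bar>))" by (simp only: c_def complex_cnj_complex_of_real of_real_mult)
    also have "(1 / sqrt \<bar>det U\<bar>) * (1 / sqrt \<bar>det U\<bar>) = 1 / \<bar>det U\<bar>" using d by simp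
    finally have cc: "c * cnj c * of_real \<bar>det U\<bar> = 1" using d by (simp flip: of_real_mult)
    show ?thesis
      unfolding sum.reindex[OF inj] o_def pair_fun_pull(2)[OF f g] sum_distrib_left mult.assoc[symmetric] cc by simp
  qed
  ultimately show ?thesis by (simp only: mult.left_commute[of "c * cnj c"])
qed

end

lemma has_sum_finite_Times:
  fixes h :: "'i \<times> 'k \<Rightarrow> complex"
  assumes "finite A" "\<And>l. l \<in> A \<Longrightarrow> ((\<lambda>k. h (l, k)) has_sum S l) Z"
  shows "(h has_sum (\<Sum>l\<in>A. S l)) (A \<times> Z)"
  using assms
proof (induction A rule: finite_induct)
  case (insert l A)
  have "(h has_sum S l) (Pair l ` Z)"
    using insert.prems[of l] by (subst has_sum_reindex) (auto simp: inj_on_def o_def)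
  moreover have "(h has_sum (\<Sum>l\<in>A. S l)) (A \<times> Z)" using insert by auto
  moreover have "Pair l ` Z \<inter> A \<times> Z = {}" using insert(2) by auto
  ultimately have "(h has_sum (S l + (\<Sum>l\<in>A. S l))) (Pair l ` Z \<union> A \<times> Z)" by (rule has_sum_Un_disjoint)
  moreover have "insert l A \<times> Z = Pair l ` Z \<union> A \<times> Z" by auto
  ultimately show ?case using insert by simp
qed simp

text \<open>
  The fiberization formula for all generators of one level. The set \<open>L\<close> may be any finite set containing the relevant shifts,
  because the fibers \<open>I_op\<close> vanish off the lattice and the product of \<open>f\<close> and the shifted \<open>g\<close> vanishes otherwise; this allows one set to be used for all levels.
\<close>

lemma dual_term_has_sum:
  fixes U :: "real^'d^'d::finite"
  assumes U: "invertible U" and r: "r \<noteq> \<infinity>"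
    and \<phi>: "\<And>l. l \<in> idx r \<Longrightarrow> L2_loc (\<phi> l) \<and> represents (\<phi> l) (\<Phi> l)"
    and f: "test_fun f" and g: "test_fun g"
    and L: "finite L" "\<And>\<kappa> \<xi>. U *v \<kappa> \<in> Zd \<Longrightarrow> f \<xi> \<noteq> 0 \<Longrightarrow> g (\<xi> + (2 * pi) *\<^sub>R \<kappa>) \<noteq> 0 \<Longrightarrow> \<kappa> \<in> L"
  shows "(dual_term U \<Phi> \<Phi> f g has_sum ((2 * pi) ^ CARD('d) * (\<Sum>\<kappa>\<in>L. LINT \<xi>|lebesgue. f \<xi> * cnj (g (\<xi> + (2 * pi) *\<^sub>R \<kappa>)) * I_op r \<phi> (U *v \<kappa>) (U *v \<xi>)))) (idx r \<times> Zd)"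
    and "\<And>\<kappa>. integrable lebesgue (\<lambda>\<xi>. f \<xi> * cnj (g (\<xi> + (2 * pi) *\<^sub>R \<kappa>)) * I_op r \<phi> (U *v \<kappa>) (U *v \<xi>))"
proof -
  let ?t = "\<lambda>l \<kappa> \<xi>. f \<xi> * cnj (g (\<xi> + (2 * pi) *\<^sub>R \<kappa>)) * (cnj (\<phi> l (U *v \<xi>)) * \<phi> l (U *v \<xi> + (2 * pi) *\<^sub>R (U *v \<kappa>)))"
  note fin = idx_finite[OF r]
  have int: "integrable lebesgue (?t l \<kappa>)" if "l \<in> idx r" for l \<kappa>
    using pair_fun_pull(1)[OF U _ f g] \<phi>[OF that] by blast
  have eq: "f \<xi> * cnj (g (\<xi> + (2 * pi) *\<^sub>R \<kappa>)) * I_op r \<phi> (U *v \<kappa>) (U *v \<xi>) = (if U *v \<kappa> \<in> Zd then \<Sum>l\<in>idx r. ?t l \<kappa> \<xi> else 0)" for \<kappa> \<xi>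
    by (simp add: I_op_def sum_distrib_left)
  show "integrable lebesgue (\<lambda>\<xi>. f \<xi> * cnj (g (\<xi> + (2 * pi) *\<^sub>R \<kappa>)) * I_op r \<phi> (U *v \<kappa>) (U *v \<xi>))" for \<kappa>
    unfolding eq using int by (cases "U *v \<kappa> \<in> Zd") (auto intro!: Bochner_Integration.integrable_sum)
  have "(dual_term U \<Phi> \<Phi> f g has_sum (\<Sum>l\<in>idx r. (2 * pi) ^ CARD('d) * (\<Sum>\<kappa>\<in>{\<kappa>\<in>L. U *v \<kappa> \<in> Zd}. LINT \<xi>|lebesgue. ?t l \<kappa> \<xi>))) (idx r \<times> Zd)"
  proof (rule has_sum_finite_Times[OF fin])
    fix l assume "l \<in> idx r"
    then show "((\<lambda>k. dual_term U \<Phi> \<Phi> f g (l, k)) has_sum ((2 * pi) ^ CARD('d) * (\<Sum>\<kappa>\<in>{\<kappa>\<in>L. U *v \<kappa> \<in> Zd}. LINT \<xi>|lebesgue. ?t l \<kappa> \<xi>))) Zd"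
      using dual_term_has_sum_single[OF U _ _ f g L] \<phi> by (simp add: dual_term_def)
  qed
  also have "(\<Sum>l\<in>idx r. (2 * pi) ^ CARD('d) * (\<Sum>\<kappa>\<in>{\<kappa>\<in>L. U *v \<kappa> \<in> Zd}. LINT \<xi>|lebesgue. ?t l \<kappa> \<xi>))
    = (2 * pi) ^ CARD('d) * (\<Sum>\<kappa>\<in>{\<kappa>\<in>L. U *v \<kappa> \<in> Zd}. \<Sum>l\<in>idx r. LINT \<xi>|lebesgue. ?t l \<kappa> \<xi>)"
    unfolding sum_distrib_left[symmetric] by (subst sum.swap) simp
  also have "(\<Sum>\<kappa>\<in>{\<kappa>\<in>L. U *v \<kappa> \<in> Zd}. \<Sum>l\<in>idx r. LINT \<xi>|lebesgue. ?t l \<kappa> \<xi>)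
    = (\<Sum>\<kappa>\<in>L. LINT \<xi>|lebesgue. f \<xi> * cnj (g (\<xi> + (2 * pi) *\<^sub>R \<kappa>)) * I_op r \<phi> (U *v \<kappa>) (U *v \<xi>))"
  proof -
    have "(\<Sum>\<kappa>\<in>L. LINT \<xi>|lebesgue. f \<xi> * cnj (g (\<xi> + (2 * pi) *\<^sub>R \<kappa>)) * I_op r \<phi> (U *v \<kappa>) (U *v \<xi>))
      = (\<Sum>\<kappa>\<in>L. if U *v \<kappa> \<in> Zd then \<Sum>l\<in>idx r. LINT \<xi>|lebesgue. ?t l \<kappa> \<xi> else 0)"
      unfolding eq by (intro sum.cong refl) (simp add: Bochner_Integration.integral_sum int)
    then show ?thesis using L(1) by (simp add: sum.inter_filter)
  qed
  finally show "(dual_term U \<Phi> \<Phi> f g has_sum ((2 * pi) ^ CARD('d) * (\<Sum>\<kappa>\<in>L. LINT \<xi>|lebesgue. f \<xi> * cnj (g (\<xi> + (2 * pi) *\<^sub>R \<kappa>)) * I_op r \<phi> (U *v \<kappa>) (U *v \<xi>)))) (idx r \<times> Zd)" .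
qed

section \<open>Unordered sums and limits over levels\<close>

lemma finite_sum_le_infsum_ennreal:
  fixes f :: "'a \<Rightarrow> ennreal"
  shows "finite F \<Longrightarrow> F \<subseteq> A \<Longrightarrow> sum f F \<le> infsum f A"
  by (subst nonneg_infsum_complete) (auto intro: SUP_upper)

text \<open>
  Extended nonnegative sums are suprema over finite sets, so iterated and joint summation agree without any
  summability assumption.
\<close>

lemma infsum_Sigma_ennreal:
  fixes f :: "'a \<times> 'b \<Rightarrow> ennreal"
  shows "infsum f (Sigma A B) = (\<Sum>\<^sub>\<infinity>x\<in>A. \<Sum>\<^sub>\<infinity>y\<in>B x. f (x, y))"
proof (rule antisym)
  show "infsum f (Sigma A B) \<le> (\<Sum>\<^sub>\<infinity>x\<in>A. \<Sum>\<^sub>\<infinity>y\<in>B x. f (x, y))"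
  proof (subst nonneg_infsum_complete, simp, rule SUP_least)
    fix F assume "F \<in> {F. finite F \<and> F \<subseteq> Sigma A B}"
    then have F: "finite F" "F \<subseteq> Sigma A B" by auto
    have eq: "F = (SIGMA x:fst ` F. {y. (x, y) \<in> F})" by force
    have fin: "finite {y. (x, y) \<in> F}" for x
      by (rule finite_subset[of _ "snd ` F"]) (use F in force)+
    have "(\<Sum>x\<in>fst ` F. \<Sum>y\<in>{y. (x, y) \<in> F}. f (x, y)) = (\<Sum>(x, y)\<in>(SIGMA x:fst ` F. {y. (x, y) \<in> F}). f (x, y))"
      by (rule sum.Sigma) (use F fin in auto)
    then have "sum f F = (\<Sum>x\<in>fst ` F. \<Sum>y\<in>{y. (x, y) \<in> F}. f (x, y))"
      unfolding eq[symmetric] by (simp add: case_prod_unfold)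
    also have "\<dots> \<le> (\<Sum>x\<in>fst ` F. \<Sum>\<^sub>\<infinity>y\<in>B x. f (x, y))"
      using F fin by (intro sum_mono finite_sum_le_infsum_ennreal) auto
    also have "\<dots> \<le> (\<Sum>\<^sub>\<infinity>x\<in>A. \<Sum>\<^sub>\<infinity>y\<in>B x. f (x, y))"
      using F by (intro finite_sum_le_infsum_ennreal) auto
    finally show "sum f F \<le> (\<Sum>\<^sub>\<infinity>x\<in>A. \<Sum>\<^sub>\<infinity>y\<in>B x. f (x, y))" .
  qed
  show "(\<Sum>\<^sub>\<infinity>x\<in>A. \<Sum>\<^sub>\<infinity>y\<in>B x. f (x, y)) \<le> infsum f (Sigma A B)"
  proof (subst nonneg_infsum_complete, simp, rule SUP_least)
    fix A0 assume "A0 \<in> {F. finite F \<and> F \<subseteq> A}"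
    then have A0: "finite A0" "A0 \<subseteq> A" by auto
    have "(\<Sum>x\<in>A0. \<Sum>\<^sub>\<infinity>y\<in>B x. f (x, y)) = infsum f (Sigma A0 B)"
      using A0(1)
    proof (induction A0 rule: finite_induct)
      case (insert x A0)
      have "Sigma (insert x A0) B = Pair x ` B x \<union> Sigma A0 B" by auto
      moreover have "infsum f (Pair x ` B x \<union> Sigma A0 B) = infsum f (Pair x ` B x) + infsum f (Sigma A0 B)"
        by (rule infsum_Un_disjoint) (use insert in \<open>auto intro!: nonneg_summable_on_complete\<close>)
      moreover have "infsum f (Pair x ` B x) = (\<Sum>\<^sub>\<infinity>y\<in>B x. f (x, y))"
        by (subst infsum_reindex) (auto simp: inj_on_def o_def)
      ultimately show ?case using insert by simp
    qed simp
    also have "\<dots> \<le> infsum f (Sigma A B)"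
      by (rule infsum_mono_neutral) (use A0 in \<open>auto intro!: nonneg_summable_on_complete\<close>)
    finally show "(\<Sum>x\<in>A0. \<Sum>\<^sub>\<infinity>y\<in>B x. f (x, y)) \<le> infsum f (Sigma A B)" .
  qed
qed

lemma infsum_ennreal_iff_has_sum:
  fixes g :: "'a \<Rightarrow> real"
  assumes g: "\<And>x. x \<in> A \<Longrightarrow> g x \<ge> 0" and c: "c \<ge> 0"
  shows "(\<Sum>\<^sub>\<infinity>x\<in>A. ennreal (g x)) = ennreal c \<longleftrightarrow> (g has_sum c) A"
proof -
  have sup: "(\<Sum>\<^sub>\<infinity>x\<in>A. ennreal (g x)) = (SUP F\<in>{F. finite F \<and> F \<subseteq> A}. ennreal (sum g F))"
  proof -
    have "(\<Sum>\<^sub>\<infinity>x\<in>A. ennreal (g x)) = (SUP F\<in>{F. finite F \<and> F \<subseteq> A}. \<Sum>x\<in>F. ennreal (g x))"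
      by (rule nonneg_infsum_complete) simp
    also have "\<dots> = (SUP F\<in>{F. finite F \<and> F \<subseteq> A}. ennreal (sum g F))"
      using g by (intro SUP_cong refl sum_ennreal) auto
    finally show ?thesis .
  qed
  have eq: "(\<Sum>\<^sub>\<infinity>x\<in>A. ennreal (g x)) = ennreal (infsum g A)" if "g summable_on A"
    unfolding sup using infsum_nonneg_is_SUPREMUM_ennreal[OF that g] by simp
  show ?thesis
  proof
    assume h: "(\<Sum>\<^sub>\<infinity>x\<in>A. ennreal (g x)) = ennreal c"
    have "sum g F \<le> c" if "finite F" "F \<subseteq> A" for F
    proof -
      have "ennreal (sum g F) \<le> ennreal c" unfolding h[symmetric] sup by (rule SUP_upper) (use that in auto)
      then show ?thesis using c by (simp add: ennreal_le_iff)
    qed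
    then have s: "g summable_on A"
      by (intro nonneg_bounded_partial_sums_imp_summable_on[of _ _ c]) (use g in \<open>auto intro!: eventually_finite_subsets_at_top_weakI\<close>)
    then have "infsum g A = c" using eq[OF s] h c infsum_nonneg[of A g] g by simp
    then show "(g has_sum c) A" using has_sum_infsum[OF s] by simp
  next
    assume "(g has_sum c) A"
    then show "(\<Sum>\<^sub>\<infinity>x\<in>A. ennreal (g x)) = ennreal c"
      using eq by (auto simp: has_sum_imp_summable infsumI)
  qed
qed

lemma finite_int_bound: "finite X \<Longrightarrow> \<exists>m::int. \<forall>x\<in>X. x < m"
proof (intro exI ballI)
  fix x assume "finite X" "x \<in> X"
  then have "x \<le> Max (insert 0 X)" by (intro Max_ge) auto
  then show "x < Max (insert 0 X) + 1" by simp
qed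

lemma filterlim_int_intervals:
  "filterlim (\<lambda>J'::int. {J0..<J'}) (finite_subsets_at_top {J0..}) at_top"
  unfolding filterlim_iff eventually_finite_subsets_at_top
proof (intro allI impI, elim exE conjE)
  fix P :: "int set \<Rightarrow> bool" and X :: "int set"
  assume X: "finite X" "X \<subseteq> {J0..}" and P: "\<forall>Y. finite Y \<and> X \<subseteq> Y \<and> Y \<subseteq> {J0..} \<longrightarrow> P Y"
  obtain m where m: "\<And>x. x \<in> X \<Longrightarrow> x < m" using finite_int_bound[OF X(1)] by blast
  show "\<forall>\<^sub>F J' in at_top. P {J0..<J'}"
    using eventually_ge_at_top[of m]
  proof eventually_elim
    case (elim J')
    have "X \<subseteq> {J0..<J'}"
    proof
      fix x assume "x \<in> X"
      then show "x \<in> {J0..<J'}" using m[of x] X(2) elim by auto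
    qed
    moreover have "{J0..<J'} \<subseteq> {J0..}" by auto
    ultimately show ?case using P by blast
  qed
qed

lemma has_sum_imp_int_limit:
  "(S has_sum c) {J0..} \<Longrightarrow> ((\<lambda>J'::int. \<Sum>j\<in>{J0..<J'}. S j) \<longlongrightarrow> c) at_top"
  unfolding has_sum_def by (rule filterlim_compose[OF _ filterlim_int_intervals])

text \<open>
  For nonnegative terms the limit of the partial sums bounds all finite sums.
\<close>

lemma int_limit_imp_has_sum:
  fixes S :: "int \<Rightarrow> real"
  assumes S: "\<And>j. j \<ge> J0 \<Longrightarrow> S j \<ge> 0" and lim: "((\<lambda>J'. \<Sum>j\<in>{J0..<J'}. S j) \<longlongrightarrow> c) at_top"
  shows "(S has_sum c) {J0..}"
proof -
  have mono: "(\<Sum>j\<in>{J0..<J'}. S j) \<le> (\<Sum>j\<in>{J0..<J''}. S j)" if "J' \<le> J''" for J' J''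
    by (rule sum_mono2) (use S that in auto)
  have le: "(\<Sum>j\<in>{J0..<J'}. S j) \<le> c" for J'
    by (rule tendsto_lowerbound[OF lim]) (use mono in \<open>auto intro: eventually_mono[OF eventually_ge_at_top]\<close>)
  have "sum S F \<le> c" if F: "finite F" "F \<subseteq> {J0..}" for F
  proof -
    obtain m where "\<And>x. x \<in> F \<Longrightarrow> x < m"
      using finite_int_bound[OF F(1)] by blast
    then have "F \<subseteq> {J0..<m}" using F by auto
    then have "sum S F \<le> (\<Sum>j\<in>{J0..<m}. S j)" by (intro sum_mono2) (use S in auto)
    then show ?thesis using le[of m] by simp
  qed
  then have s: "S summable_on {J0..}"
    by (intro nonneg_bounded_partial_sums_imp_summable_on[of _ _ c]) (use S in \<open>auto intro!: eventually_finite_subsets_at_top_weakI\<close>)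
  have "infsum S {J0..} = c"
    using tendsto_unique[OF _ has_sum_imp_int_limit[OF has_sum_infsum[OF s]] lim] by simp
  then show ?thesis using has_sum_infsum[OF s] by simp
qed

section \<open>Extending a frame identity from test functions\<close>

lemma test_fun_sequence:
  assumes "L2 f"
  obtains g where "\<And>n::nat. test_fun (g n)" "(\<lambda>n. sqnorm (\<lambda>x. f x - g n x)) \<longlonglongrightarrow> 0"
proof -
  have "\<forall>n::nat. \<exists>g. test_fun g \<and> sqnorm (\<lambda>x. f x - g x) < 1 / Suc n"
    using test_fun_dense[OF assms] by simp
  then obtain g where g: "\<And>n. test_fun (g n)" "\<And>n::nat. sqnorm (\<lambda>x. f x - g n x) < 1 / Suc n" by metis
  have "(\<lambda>n. sqnorm (\<lambda>x. f x - g n x)) \<longlonglongrightarrow> 0"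
    by (rule Lim_null_comparison[OF always_eventually LIMSEQ_Suc[OF lim_1_over_n]])
       (use g(2) in \<open>simp add: abs_of_nonneg sqnorm_nonneg less_imp_le\<close>)
  then show thesis using g(1) that by blast
qed

lemma norm_add_sq_eps:
  assumes "t > 0"
  shows "(cmod (a + b))\<^sup>2 \<le> (1 + t) * (cmod a)\<^sup>2 + (1 + 1 / t) * (cmod b)\<^sup>2"
proof -
  have "(cmod (a + b))\<^sup>2 \<le> (cmod a + cmod b)\<^sup>2" by (intro power_mono norm_triangle_ineq) auto
  also have "2 * (cmod a * cmod b) \<le> t * (cmod a)\<^sup>2 + (cmod b)\<^sup>2 / t"
  proof -
    have "0 \<le> (t * cmod a - cmod b)\<^sup>2 / t" using assms by simp
    also have "\<dots> = t * (cmod a)\<^sup>2 + (cmod b)\<^sup>2 / t - 2 * (cmod a * cmod b)"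
      using assms by (simp add: power2_eq_square field_simps)
    finally show ?thesis by simp
  qed
  then have "(cmod a + cmod b)\<^sup>2 \<le> (1 + t) * (cmod a)\<^sup>2 + (1 + 1 / t) * (cmod b)\<^sup>2"
    unfolding power2_sum by (simp add: algebra_simps)
  finally show ?thesis .
qed

text \<open>
  The upper bound passes to limits of finite partial sums. For the lower bound, a test function \<open>g n\<close> near \<open>f\<close> has
  coefficients close to those of \<open>f\<close>: the upper bound applied to \<open>f - g n\<close> controls the difference, and
  \<open>norm_add_sq_eps\<close> separates the two contributions at the cost of a factor \<open>1 + t\<close> that tends to \<open>1\<close>.
\<close>

lemma frame_extend:
  fixes E :: "'p \<Rightarrow> 'd::finite cfun"
  assumes E: "\<And>p. p \<in> I \<Longrightarrow> L2 (E p)" and C: "C \<ge> 0"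
    and frame: "\<And>f. test_fun f \<Longrightarrow> ((\<lambda>p. (cmod (pair_fun f (E p)))\<^sup>2) has_sum (C * sqnorm f)) I"
    and f: "L2 f"
  shows "((\<lambda>p. (cmod (pair_fun f (E p)))\<^sup>2) has_sum (C * sqnorm f)) I"
proof -
  have upper: "(\<Sum>p\<in>F. (cmod (pair_fun h (E p)))\<^sup>2) \<le> C * sqnorm h" if h: "L2 h" and F: "finite F" "F \<subseteq> I" for h F
  proof -
    obtain g where g: "\<And>n::nat. test_fun (g n)" "(\<lambda>n. sqnorm (\<lambda>x. h x - g n x)) \<longlonglongrightarrow> 0"
      using test_fun_sequence[OF h] by blast
    have "(\<lambda>n. \<Sum>p\<in>F. (cmod (pair_fun (g n) (E p)))\<^sup>2) \<longlonglongrightarrow> (\<Sum>p\<in>F. (cmod (pair_fun h (E p)))\<^sup>2)"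
      using F by (intro tendsto_intros pair_fun_tendsto L2_test_fun g h E) auto
    moreover have "(\<lambda>n. C * sqnorm (g n)) \<longlonglongrightarrow> C * sqnorm h"
      by (intro tendsto_intros sqnorm_tendsto L2_test_fun g h)
    moreover have "(\<Sum>p\<in>F. (cmod (pair_fun (g n) (E p)))\<^sup>2) \<le> C * sqnorm (g n)" for n
    proof -
      note hs = frame[OF g(1)[of n]]
      show ?thesis
        using finite_sum_le_infsum[OF has_sum_imp_summable[OF hs] F] infsumI[OF hs] by simp
    qed
    ultimately show ?thesis by (intro LIMSEQ_le[where X = "\<lambda>n. \<Sum>p\<in>F. (cmod (pair_fun (g n) (E p)))\<^sup>2"]) auto
  qed
  have s: "(\<lambda>p. (cmod (pair_fun f (E p)))\<^sup>2) summable_on I"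
    by (intro nonneg_bounded_partial_sums_imp_summable_on[of _ _ "C * sqnorm f"])
       (use upper[OF f] in \<open>auto intro!: eventually_finite_subsets_at_top_weakI\<close>)
  define S where "S = infsum (\<lambda>p. (cmod (pair_fun f (E p)))\<^sup>2) I"
  have "S \<le> C * sqnorm f"
    unfolding S_def by (rule infsum_le_finite_sums[OF s]) (use upper[OF f] in auto)
  moreover have "C * sqnorm f \<le> S"
  proof -
    obtain g where g: "\<And>n::nat. test_fun (g n)" "(\<lambda>n. sqnorm (\<lambda>x. f x - g n x)) \<longlonglongrightarrow> 0"
      using test_fun_sequence[OF f] by blast
    have gL: "L2 (g n)" for n using g(1) by (rule L2_test_fun)
    have S0: "S \<ge> 0" unfolding S_def by (rule infsum_nonneg) auto
    have key: "C * sqnorm f \<le> (1 + t) * S" if t: "t > 0" for t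
    proof -
      have "C * sqnorm (g n) \<le> (1 + t) * S + (1 + 1 / t) * (C * sqnorm (\<lambda>x. f x - g n x))" for n
      proof -
        note hs = frame[OF g(1)[of n]]
        have dL: "L2 (\<lambda>x. g n x - f x)" by (intro L2_diff gL f)
        have "infsum (\<lambda>p. (cmod (pair_fun (g n) (E p)))\<^sup>2) I \<le> (1 + t) * S + (1 + 1 / t) * (C * sqnorm (\<lambda>x. f x - g n x))"
        proof (rule infsum_le_finite_sums[OF has_sum_imp_summable[OF hs]])
          fix F assume F: "finite F" "F \<subseteq> I"
          have "(\<Sum>p\<in>F. (cmod (pair_fun (g n) (E p)))\<^sup>2) \<le> (\<Sum>p\<in>F. (1 + t) * (cmod (pair_fun f (E p)))\<^sup>2 + (1 + 1 / t) * (cmod (pair_fun (\<lambda>x. g n x - f x) (E p)))\<^sup>2)"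
          proof (rule sum_mono)
            fix p assume "p \<in> F"
            then have "pair_fun (g n) (E p) = pair_fun f (E p) + pair_fun (\<lambda>x. g n x - f x) (E p)"
              using F E by (subst pair_fun_diff[OF gL f]) auto
            then show "(cmod (pair_fun (g n) (E p)))\<^sup>2 \<le> (1 + t) * (cmod (pair_fun f (E p)))\<^sup>2 + (1 + 1 / t) * (cmod (pair_fun (\<lambda>x. g n x - f x) (E p)))\<^sup>2"
              using norm_add_sq_eps[OF t] by simp
          qed
          also have "\<dots> = (1 + t) * (\<Sum>p\<in>F. (cmod (pair_fun f (E p)))\<^sup>2) + (1 + 1 / t) * (\<Sum>p\<in>F. (cmod (pair_fun (\<lambda>x. g n x - f x) (E p)))\<^sup>2)"
            by (simp add: sum.distrib sum_distrib_left)
          also have "\<dots> \<le> (1 + t) * S + (1 + 1 / t) * (C * sqnorm (\<lambda>x. f x - g n x))"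
          proof (intro add_mono mult_left_mono)
            show "(\<Sum>p\<in>F. (cmod (pair_fun f (E p)))\<^sup>2) \<le> S"
              unfolding S_def by (rule finite_sum_le_infsum[OF s F]) auto
            show "(\<Sum>p\<in>F. (cmod (pair_fun (\<lambda>x. g n x - f x) (E p)))\<^sup>2) \<le> C * sqnorm (\<lambda>x. f x - g n x)"
              using upper[OF dL F] sqnorm_diff_commute[of f "g n"] by simp
          qed (use t in auto)
          finally show "(\<Sum>p\<in>F. (cmod (pair_fun (g n) (E p)))\<^sup>2) \<le> (1 + t) * S + (1 + 1 / t) * (C * sqnorm (\<lambda>x. f x - g n x))" .
        qed
        then show ?thesis using infsumI[OF hs] by simp
      qed
      moreover have "(\<lambda>n. C * sqnorm (g n)) \<longlonglongrightarrow> C * sqnorm f"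
        by (intro tendsto_intros sqnorm_tendsto gL g f)
      moreover have "(\<lambda>n. (1 + t) * S + (1 + 1 / t) * (C * sqnorm (\<lambda>x. f x - g n x))) \<longlonglongrightarrow> (1 + t) * S + (1 + 1 / t) * (C * 0)"
        by (intro tendsto_intros g)
      ultimately have "C * sqnorm f \<le> (1 + t) * S + (1 + 1 / t) * (C * 0)"
        by (intro LIMSEQ_le[where X = "\<lambda>n. C * sqnorm (g n)"]) auto
      then show ?thesis by simp
    qed
    show ?thesis
    \<comment> \<open>Let \<open>t\<close> tend to \<open>0\<close>; the summand \<open>1\<close> guards against \<open>S = 0\<close>.\<close>
    proof (rule field_le_epsilon)
      fix e :: real assume e: "e > 0"
      have "C * sqnorm f \<le> S + e / (S + 1) * S"
        using key[of "e / (S + 1)"] e S0 by (simp add: distrib_right)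
      also have "e / (S + 1) * S \<le> e" using e S0 by (simp add: field_simps)
      finally show "C * sqnorm f \<le> S + e" by simp
    qed
  qed
  ultimately have "S = C * sqnorm f" by simp
  then show ?thesis using has_sum_infsum[OF s] by (simp add: S_def)
qed

section \<open>Frame conditions in terms of test functions\<close>

definition frame_index :: "int \<Rightarrow> (int \<Rightarrow> enat) \<Rightarrow> (int \<times> nat \<times> (real^'d::finite)) set" where
  "frame_index J0 \<sigma> = (SIGMA j:{J0..}. idx (\<sigma> j) \<times> Zd)"

definition frame_coeff :: "(int \<Rightarrow> real^'d^'d) \<Rightarrow> (int \<Rightarrow> nat \<Rightarrow> 'd::finite functional) \<Rightarrow> 'd cfun \<Rightarrow> int \<times> nat \<times> (real^'d) \<Rightarrow> complex" where
  "frame_coeff M G f = (\<lambda>(j, l, k). pair_fun_dist f (dist_dil (M j) k (G j l)))"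

lemma fun_dil_L2:
  fixes U :: "real^'d^'d::finite"
  assumes U: "invertible U" and \<phi>: "L2 \<phi>"
  shows "L2 (fun_dil U k \<phi>)"
proof -
  have "integrable lebesgue (\<lambda>x. (cmod (\<phi> (U *v x)))\<^sup>2)" "(\<lambda>x. \<phi> (U *v x)) \<in> borel_measurable lebesgue"
    using integrable_affine[OF U L2_integrable[OF \<phi>], of 0] measurable_affine_comp[OF U L2_measurable[OF \<phi>], of 0] by auto
  then have c: "L2 (\<lambda>x. \<phi> (U *v x))" by (simp add: L2_def)
  have "continuous_on UNIV (\<lambda>\<xi>. complex_of_real (sqrt \<bar>det U\<bar>) * exp (- \<i> * of_real (k \<bullet> (U *v \<xi>))))"
    by (intro continuous_intros)
  then have "(\<lambda>\<xi>. complex_of_real (sqrt \<bar>det U\<bar>) * exp (- \<i> * of_real (k \<bullet> (U *v \<xi>)))) \<in> borel_measurable lebesgue"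
    using borel_measurable_continuous_onI by (intro measurable_completion) auto
  moreover have "cmod (complex_of_real (sqrt \<bar>det U\<bar>) * exp (- \<i> * of_real (k \<bullet> (U *v \<xi>)))) \<le> sqrt \<bar>det U\<bar>" for \<xi>
    by (simp add: norm_mult)
  ultimately show ?thesis unfolding fun_dil_def by (rule L2_mult_bounded[OF c])
qed

text \<open>
  The factor \<open>sqrt |det U|\<close> makes the dilation unitary.
\<close>

lemma sqnorm_dilate:
  fixes U :: "real^'d^'d::finite"
  assumes U: "invertible U" and h: "L2 h"
  shows "sqnorm (\<lambda>x. of_real (sqrt \<bar>det U\<bar>) * cnj (h (U *v x))) = sqnorm h"
proof -
  have d: "det U \<noteq> 0" using U by (simp add: invertible_det_nz)
  have "(\<lambda>x. (cmod (h x))\<^sup>2) \<in> borel_measurable lebesgue" using L2_integrable[OF h] by simp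
  from integral_affine[OF U this, of 0]
  have "(LINT x|lebesgue. (cmod (h (U *v x)))\<^sup>2) = (1 / \<bar>det U\<bar>) * sqnorm h" by (simp add: sqnorm_def)
  then show ?thesis unfolding sqnorm_cmult using d by (simp add: sqnorm_def)
qed

context
  fixes J0 :: int and M :: "int \<Rightarrow> real^'d^'d::finite" and \<sigma> :: "int \<Rightarrow> enat" and G :: "int \<Rightarrow> nat \<Rightarrow> 'd functional"
  assumes inv: "\<And>j. j \<ge> J0 \<Longrightarrow> invertible (M j)"
    and dist: "\<And>j l. j \<ge> J0 \<Longrightarrow> l \<in> idx (\<sigma> j) \<Longrightarrow> distribution (G j l)"
begin

lemma frame_coeff_linear:
  assumes f: "test_fun f" and g: "test_fun g" and p: "p \<in> frame_index J0 \<sigma>"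
  shows "frame_coeff M G (\<lambda>x. f x + c * g x) p = frame_coeff M G f p + c * frame_coeff M G g p"
proof -
  obtain j l k where jlk: "p = (j, l, k)" "j \<ge> J0" "l \<in> idx (\<sigma> j)" using p by (auto simp: frame_index_def)
  let ?E = "\<lambda>f \<eta>. of_real (1 / sqrt \<bar>det (M j)\<bar>) * exp (- \<i> * of_real (k \<bullet> \<eta>)) * cnj (f (matrix_inv (M j) *v \<eta>))"
  note D = dist[OF jlk(2,3), unfolded distribution_def]
  have t: "test_fun (?E f)" "test_fun (?E g)"
    using test_fun_dil[OF inv[OF jlk(2)] test_fun_cnj] f g by auto
  have "?E (\<lambda>x. f x + c * g x) = (\<lambda>\<eta>. ?E f \<eta> + cnj c * ?E g \<eta>)"
    by (auto simp: algebra_simps)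
  moreover have "G j l (\<lambda>\<eta>. ?E f \<eta> + cnj c * ?E g \<eta>) = G j l (?E f) + G j l (\<lambda>\<eta>. cnj c * ?E g \<eta>)"
    using D t(1) test_fun_cmult[OF t(2), of "cnj c"] by blast
  moreover have "G j l (\<lambda>\<eta>. cnj c * ?E g \<eta>) = cnj c * G j l (?E g)" using D t(2) by blast
  ultimately show ?thesis
    unfolding jlk(1) frame_coeff_def by (simp add: pair_fun_dist_def pair_dist_fun_def dist_dil_def)
qed

text \<open>
  The coefficient with \<open>k = 0\<close> determines the functional: every test function \<open>h\<close> arises from a test function \<open>f\<close> of the same
  norm by undoing the dilation.
\<close>

lemma represents_of_bound:
  assumes j: "j \<ge> J0" "l \<in> idx (\<sigma> j)" and C: "C \<ge> 0"
    and bound: "\<And>f. test_fun f \<Longrightarrow> (cmod (frame_coeff M G f (j, l, 0)))\<^sup>2 \<le> C * sqnorm f"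
  shows "\<exists>\<phi>. L2 \<phi> \<and> represents \<phi> (G j l)"
proof (rule Riesz_test[OF _ _ _ C])
  note D = dist[OF j, unfolded distribution_def]
  show "G j l (\<lambda>x. f x + g x) = G j l f + G j l g" if "test_fun f" "test_fun g" for f g using D that by blast
  show "G j l (\<lambda>x. c * f x) = c * G j l f" if "test_fun f" for f c using D that by blast
  fix h :: "'d cfun" assume h: "test_fun h"
  define f where "f = (\<lambda>x. of_real (sqrt \<bar>det (M j)\<bar>) * cnj (h (M j *v x)))"
  have f: "test_fun f" unfolding f_def
    by (intro test_fun_cmult test_fun_cnj test_fun_linear h inv j)
  have d: "det (M j) \<noteq> 0" using inv[OF j(1)] by (simp add: invertible_det_nz)
  have "(\<lambda>\<eta>. of_real (1 / sqrt \<bar>det (M j)\<bar>) * exp (- \<i> * of_real ((0::real^'d) \<bullet> \<eta>)) * cnj (f (matrix_inv (M j) *v \<eta>))) = h"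
    using d by (auto simp: f_def matrix_inv_cancel[OF inv[OF j(1)]] simp flip: of_real_mult)
  then have "frame_coeff M G f (j, l, 0) = cnj (G j l h)"
    by (simp add: frame_coeff_def pair_fun_dist_def pair_dist_fun_def dist_dil_def)
  then show "(cmod (G j l h))\<^sup>2 \<le> C * sqnorm h"
    using bound[OF f] sqnorm_dilate[OF inv[OF j(1)] L2_test_fun[OF h]] by (simp add: f_def)
qed

text \<open>
  The functions \<open>\<gamma>\<close> on the left are not given on the right: one term of the sum is at most the whole sum, so
  \<open>represents_of_bound\<close> produces them.
\<close>

lemma tight_iff_test:
  assumes C: "C \<ge> 0"
  shows "(\<exists>\<gamma>. (\<forall>j\<ge>J0. \<forall>l\<in>idx (\<sigma> j). L2 (\<gamma> j l) \<and> represents (\<gamma> j l) (G j l)) \<and>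
      (\<forall>f. L2 f \<longrightarrow> ((\<lambda>(j, l, k). (cmod (pair_fun f (fun_dil (M j) k (\<gamma> j l))))\<^sup>2) has_sum (C * sqnorm f)) (frame_index J0 \<sigma>)))
    \<longleftrightarrow> (\<forall>f. test_fun f \<longrightarrow> ((\<lambda>p. (cmod (frame_coeff M G f p))\<^sup>2) has_sum (C * sqnorm f)) (frame_index J0 \<sigma>))"
    (is "?L \<longleftrightarrow> ?R")
proof -
  have conv: "((\<lambda>p. (cmod (frame_coeff M G f p))\<^sup>2) has_sum a) (frame_index J0 \<sigma>) \<longleftrightarrow>
     ((\<lambda>(j, l, k). (cmod (pair_fun f (fun_dil (M j) k (\<gamma> j l))))\<^sup>2) has_sum a) (frame_index J0 \<sigma>)"
    if \<gamma>: "\<forall>j\<ge>J0. \<forall>l\<in>idx (\<sigma> j). L2 (\<gamma> j l) \<and> represents (\<gamma> j l) (G j l)" and f: "test_fun f" for \<gamma> f a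
  proof (rule has_sum_cong)
    fix p :: "int \<times> nat \<times> (real^'d)" assume "p \<in> frame_index J0 \<sigma>"
    then obtain j l k where p: "p = (j, l, k)" "j \<ge> J0" "l \<in> idx (\<sigma> j)" by (auto simp: frame_index_def)
    then show "(cmod (frame_coeff M G f p))\<^sup>2 = (case p of (j, l, k) \<Rightarrow> (cmod (pair_fun f (fun_dil (M j) k (\<gamma> j l))))\<^sup>2)"
      using pair_fun_dist_represents[OF inv[OF p(2)] L2_measurable _ f, of "\<gamma> j l" "G j l" k] \<gamma>
      by (simp add: frame_coeff_def)
  qed
  show ?thesis
  proof
    assume ?L
    then show ?R using conv L2_test_fun by blast
  next
    assume R: ?R
    have "\<exists>\<phi>. L2 \<phi> \<and> represents \<phi> (G j l)" if j: "j \<ge> J0" "l \<in> idx (\<sigma> j)" for j l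
    proof (rule represents_of_bound[OF j C])
      fix f :: "'d cfun" assume "test_fun f"
      then have hs: "((\<lambda>p. (cmod (frame_coeff M G f p))\<^sup>2) has_sum (C * sqnorm f)) (frame_index J0 \<sigma>)" using R by blast
      have "{(j, l, 0)} \<subseteq> (frame_index J0 \<sigma> :: (int \<times> nat \<times> (real^'d)) set)" using j Zd_0 by (auto simp: frame_index_def)
      from finite_sum_le_infsum[OF has_sum_imp_summable[OF hs] _ this]
      show "(cmod (frame_coeff M G f (j, l, 0)))\<^sup>2 \<le> C * sqnorm f" using infsumI[OF hs] by simp
    qed
    then obtain \<gamma> where \<gamma>: "\<forall>j\<ge>J0. \<forall>l\<in>idx (\<sigma> j). L2 (\<gamma> j l) \<and> represents (\<gamma> j l) (G j l)" by metis
    have "((\<lambda>(j, l, k). (cmod (pair_fun f (fun_dil (M j) k (\<gamma> j l))))\<^sup>2) has_sum (C * sqnorm f)) (frame_index J0 \<sigma>)" if f: "L2 f" for f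
    proof -
      have "((\<lambda>p. (cmod (pair_fun f ((\<lambda>(j, l, k). fun_dil (M j) k (\<gamma> j l)) p)))\<^sup>2) has_sum (C * sqnorm f)) (frame_index J0 \<sigma>)"
      proof (rule frame_extend[OF _ C _ f])
        fix p :: "int \<times> nat \<times> (real^'d)" assume "p \<in> frame_index J0 \<sigma>"
        then show "L2 ((\<lambda>(j, l, k). fun_dil (M j) k (\<gamma> j l)) p)"
          using \<gamma> inv by (auto simp: frame_index_def intro!: fun_dil_L2)
      next
        fix g :: "'d cfun" assume g: "test_fun g"
        show "((\<lambda>p. (cmod (pair_fun g ((\<lambda>(j, l, k). fun_dil (M j) k (\<gamma> j l)) p)))\<^sup>2) has_sum (C * sqnorm g)) (frame_index J0 \<sigma>)"
          using conv[OF \<gamma> g, THEN iffD1, OF R[rule_format, OF g]] by (simp add: case_prod_unfold)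
      qed
      then show ?thesis by (simp add: case_prod_unfold)
    qed
    then show ?L using \<gamma> by blast
  qed
qed

lemma dual_term_frame_coeff: "dual_term (M j) (G j) (G j) f g (l, k) = frame_coeff M G f (j, l, k) * cnj (frame_coeff M G g (j, l, k))"
  by (simp add: dual_term_def frame_coeff_def pair_fun_dist_def)

text \<open>
  On the diagonal \<open>f = g\<close> the terms are squared moduli, so convergence along levels is already unordered
  convergence. Off the diagonal the sum is recovered by polarization.
\<close>

lemma dual_iff_test:
  assumes C: "C \<ge> 0"
  shows "(\<forall>f g. test_fun f \<longrightarrow> test_fun g \<longrightarrow>
      (\<forall>j\<ge>J0. (\<lambda>p. norm (dual_term (M j) (G j) (G j) f g p)) summable_on idx (\<sigma> j) \<times> Zd) \<and>
      ((\<lambda>J'. \<Sum>j\<in>{J0..<J'}. \<Sum>\<^sub>\<infinity>p\<in>idx (\<sigma> j) \<times> Zd. dual_term (M j) (G j) (G j) f g p) \<longlongrightarrow> of_real C * pair_fun f g) at_top)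
    \<longleftrightarrow> (\<forall>f. test_fun f \<longrightarrow> ((\<lambda>p. (cmod (frame_coeff M G f p))\<^sup>2) has_sum (C * sqnorm f)) (frame_index J0 \<sigma>))"
    (is "?L \<longleftrightarrow> ?R")
proof
  assume L: ?L
  show ?R
  proof (intro allI impI)
    fix f :: "'d cfun" assume f: "test_fun f"
    define S where "S = (\<lambda>j. \<Sum>\<^sub>\<infinity>p\<in>idx (\<sigma> j) \<times> Zd. (cmod (frame_coeff M G f (j, p)))\<^sup>2)"
    have dt: "dual_term (M j) (G j) (G j) f f p = of_real ((cmod (frame_coeff M G f (j, p)))\<^sup>2)" for j p
      by (cases p) (simp only: dual_term_frame_coeff complex_norm_square)
    have sj: "(\<lambda>p. (cmod (frame_coeff M G f (j, p)))\<^sup>2) summable_on idx (\<sigma> j) \<times> Zd" if "j \<ge> J0" for j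
    proof -
      have "(\<lambda>p. norm (dual_term (M j) (G j) (G j) f f p)) summable_on idx (\<sigma> j) \<times> Zd"
        using L f that by blast
      then show ?thesis by (simp only: dt norm_of_real abs_power2)
    qed
    have "(\<Sum>\<^sub>\<infinity>p\<in>idx (\<sigma> j) \<times> Zd. dual_term (M j) (G j) (G j) f f p) = of_real (S j)" if "j \<ge> J0" for j
      unfolding dt S_def by (rule infsumI[OF has_sum_of_real[OF has_sum_infsum[OF sj[OF that]]]])
    moreover have "((\<lambda>J'. \<Sum>j\<in>{J0..<J'}. \<Sum>\<^sub>\<infinity>p\<in>idx (\<sigma> j) \<times> Zd. dual_term (M j) (G j) (G j) f f p) \<longlongrightarrow> of_real C * pair_fun f f) at_top"
      using L f by blast
    ultimately have "((\<lambda>J'. complex_of_real (\<Sum>j\<in>{J0..<J'}. S j)) \<longlongrightarrow> of_real (C * sqnorm f)) at_top"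
      by (simp add: pair_fun_self)
    then have lim: "((\<lambda>J'. \<Sum>j\<in>{J0..<J'}. S j) \<longlongrightarrow> C * sqnorm f) at_top"
      unfolding tendsto_of_real_iff .
    have outer: "(S has_sum (C * sqnorm f)) {J0..}"
      by (rule int_limit_imp_has_sum[OF _ lim]) (auto simp: S_def intro: infsum_nonneg)
    have inner: "((\<lambda>p. (cmod (frame_coeff M G f (j, p)))\<^sup>2) has_sum S j) (idx (\<sigma> j) \<times> Zd)" if "j \<in> {J0..}" for j
      unfolding S_def using sj that by (intro has_sum_infsum) auto
    have s: "(\<lambda>p. (cmod (frame_coeff M G f p))\<^sup>2) summable_on (SIGMA j:{J0..}. idx (\<sigma> j) \<times> Zd)"
      by (rule summable_on_SigmaI[OF inner has_sum_imp_summable[OF outer]]) auto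
    show "((\<lambda>p. (cmod (frame_coeff M G f p))\<^sup>2) has_sum (C * sqnorm f)) (frame_index J0 \<sigma>)"
      unfolding frame_index_def by (rule has_sum_SigmaI[OF inner outer s])
  qed
next
  assume R: ?R
  show ?L
  proof (intro allI impI conjI)
    fix f g :: "'d cfun" assume f: "test_fun f" and g: "test_fun g"
    have hs: "((\<lambda>p. frame_coeff M G f p * cnj (frame_coeff M G g p)) has_sum (of_real C * pair_fun f g)) (frame_index J0 \<sigma>)"
    proof (rule has_sum_polarization[OF L2_test_fun[OF f] L2_test_fun[OF g]])
      fix c :: complex
      show "((\<lambda>p. (cmod (frame_coeff M G (\<lambda>x. f x + c * g x) p))\<^sup>2) has_sum (C * sqnorm (\<lambda>x. f x + c * g x))) (frame_index J0 \<sigma>)"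
        using R test_fun_add[OF f test_fun_cmult[OF g]] by blast
    qed (rule frame_coeff_linear[OF f g])
    have sj: "(\<lambda>p. frame_coeff M G f (j, p) * cnj (frame_coeff M G g (j, p))) summable_on idx (\<sigma> j) \<times> Zd" if "j \<ge> J0" for j
    proof -
      have "(\<lambda>p. frame_coeff M G f p * cnj (frame_coeff M G g p)) summable_on Pair j ` (idx (\<sigma> j) \<times> Zd)"
        by (rule summable_on_subset_banach[OF has_sum_imp_summable[OF hs]]) (use that in \<open>auto simp: frame_index_def\<close>)
      then show ?thesis by (subst (asm) summable_on_reindex) (auto simp: inj_on_def o_def)
    qed
    have dt: "dual_term (M j) (G j) (G j) f g p = frame_coeff M G f (j, p) * cnj (frame_coeff M G g (j, p))" for j p
      by (cases p) (simp only: dual_term_frame_coeff)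
    show "(\<lambda>p. norm (dual_term (M j) (G j) (G j) f g p)) summable_on idx (\<sigma> j) \<times> Zd" if "J0 \<le> j" for j
      unfolding dt by (rule summable_on_iff_abs_summable_on_complex[THEN iffD1, OF sj[OF that]])
    have "((\<lambda>j. \<Sum>\<^sub>\<infinity>p\<in>idx (\<sigma> j) \<times> Zd. dual_term (M j) (G j) (G j) f g p) has_sum (of_real C * pair_fun f g)) {J0..}"
      unfolding dt
      by (rule has_sum_SigmaD[OF hs[unfolded frame_index_def]]) (use sj in \<open>auto intro: has_sum_infsum\<close>)
    then show "((\<lambda>J'. \<Sum>j\<in>{J0..<J'}. \<Sum>\<^sub>\<infinity>p\<in>idx (\<sigma> j) \<times> Zd. dual_term (M j) (G j) (G j) f g p) \<longlongrightarrow> of_real C * pair_fun f g) at_top"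
      by (rule has_sum_imp_int_limit)
  qed
qed

end

section \<open>Functions with vanishing integrals over small boxes\<close>

lemma AE_zero_of_set_integrals:
  fixes F :: "'a \<Rightarrow> real"
  assumes F: "integrable M F" and zero: "\<And>E. E \<in> sets M \<Longrightarrow> (LINT x|M. indicator E x * F x) = 0"
  shows "AE x in M. F x = 0"
proof -
  have fm[measurable]: "F \<in> borel_measurable M" using F by simp
  have half: "AE x in M. \<not> F' x > 0"
    if F': "integrable M F'" "\<And>E. E \<in> sets M \<Longrightarrow> (LINT x|M. indicator E x * F' x) = 0" for F' :: "'a \<Rightarrow> real"
  proof -
    have [measurable]: "F' \<in> borel_measurable M" using F' by simp
    define E where "E = {x \<in> space M. F' x > 0}"
    have E: "E \<in> sets M" unfolding E_def by measurable
    have i: "integrable M (\<lambda>x. indicator E x * F' x)"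
      using integrable_real_mult_indicator[OF E F'(1)] by (simp add: mult.commute)
    have "AE x in M. indicator E x * F' x = 0"
      using integral_nonneg_eq_0_iff_AE[OF i] F'(2)[OF E] by (auto simp: E_def indicator_def)
    then show ?thesis
    proof (rule AE_mp, intro AE_I2 impI)
      fix x assume "x \<in> space M" "indicator E x * F' x = 0"
      then show "\<not> F' x > 0" by (auto simp: E_def indicator_def split: if_splits)
    qed
  qed
  have "AE x in M. \<not> F x > 0" by (rule half[OF F zero])
  moreover have "AE x in M. \<not> - F x > 0"
    by (rule half) (use F zero in auto)
  ultimately show ?thesis by eventually_elim auto
qed

text \<open>
  Boxes are stable under intersection and generate the Borel sets, and the sets over which the cut-off function has integral zero form a
  Dynkin system. So the integrals over all Lebesgue sets vanish.
\<close>

lemma box_integrals_zero: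
  fixes B :: "'d::finite cfun"
  assumes B: "integrable lebesgue (\<lambda>x. indicator (box a b) x * B x)"
    and zero: "\<And>c d. box c d \<subseteq> box a b \<Longrightarrow> (LINT x|lebesgue. indicator (box c d) x * B x) = 0"
  shows "AE x in lebesgue. x \<in> box a b \<longrightarrow> B x = 0"
proof -
  define F where "F = (\<lambda>x. indicator (box a b) x * B x)"
  have iE: "integrable lebesgue (\<lambda>x. indicator E x * F x)" if "E \<in> sets lebesgue" for E
  proof -
    have "indicator E x * F x = indicat_real E x *\<^sub>R F x" for x by (simp add: indicator_def)
    then show ?thesis using integrable_mult_indicator[OF that B] by (simp add: F_def)
  qed
  have Fi: "integrable lebesgue F" using B by (simp add: F_def)
  have borel: "(LINT x|lebesgue. indicator E x * F x) = 0" if E: "E \<in> sets borel" for E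
  proof -
    have sb: "sets borel = sigma_sets UNIV (range (\<lambda>(a, b). box a b :: (real^'d) set))"
      by (subst borel_eq_box) (auto simp: sets_measure_of)
    have 3: "E \<in> sigma_sets UNIV (range (\<lambda>(a, b). box a b))" using E sb by simp
    have 1: "Int_stable (range (\<lambda>(a, b). box a b :: (real^'d) set))"
      by (auto simp: Int_stable_def box_Int_box)
    have 2: "range (\<lambda>(a, b). box a b :: (real^'d) set) \<subseteq> Pow UNIV" by simp
    have bl: "A \<in> sets lebesgue" if "A \<in> sigma_sets UNIV (range (\<lambda>(a, b). box a b :: (real^'d) set))" for A
      using that sb by auto
    have F0: "(LINT x|lebesgue. F x) = 0" using zero[of a b] by (simp add: F_def)
    from 1 2 3 show ?thesis
    proof (induction rule: sigma_sets_induct_disjoint)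
      case (basic A)
      then obtain p where p: "A = (case p of (a, b) \<Rightarrow> box a b)" by auto
      obtain c d where cd: "A \<inter> box a b = box c d" by (cases p) (auto simp: p box_Int_box)
      have "indicator A x * F x = indicator (box c d) x * B x" for x
        using cd by (auto simp: F_def indicator_def split: if_splits)
      moreover have "box c d \<subseteq> box a b" using cd by blast
      ultimately show ?case using zero[of c d] by simp
    next
      case empty
      then show ?case by simp
    next
      case (compl A)
      have "indicator (UNIV - A) x * F x = F x - indicator A x * F x" for x by (auto simp: indicator_def)
      then show ?case using compl F0 iE[OF bl[OF compl(1)]] Fi by simp
    next
      case (union A)
      have Al: "A i \<in> sets lebesgue" for i using union(2) bl by auto
      have UN: "(\<Union>i. A i) \<in> sets lebesgue" using Al by auto
      have "(\<lambda>n. LINT x|lebesgue. (\<Sum>i<n. indicator (A i) x * F x)) \<longlonglongrightarrow> (LINT x|lebesgue. indicator (\<Union>i. A i) x * F x)"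
      proof (rule integral_dominated_convergence[where w = "\<lambda>x. cmod (F x)"])
        show "(\<lambda>x. indicator (\<Union> (range A)) x * F x) \<in> borel_measurable lebesgue"
          using iE[OF UN] by simp
        show "(\<lambda>x. \<Sum>i<n. indicator (A i) x * F x) \<in> borel_measurable lebesgue" for n
          by (rule borel_measurable_sum) (rule borel_measurable_integrable[OF iE[OF Al]])
        show "integrable lebesgue (\<lambda>x. cmod (F x))" using Fi by simp
        have eq: "(\<Sum>i<n. indicator (A i) x * F x) = indicator (\<Union>i<n. A i) x * F x" for n x
        proof -
          have "(\<Sum>i<n. indicator (A i) x) = (indicator (\<Union>i<n. A i) x :: complex)"
            using union(1) by (intro indicator_UN_disjoint[symmetric]) (auto simp: disjoint_family_on_def)
          then show ?thesis by (simp add: sum_distrib_right[symmetric])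
        qed
        show "AE x in lebesgue. (\<lambda>n. \<Sum>i<n. indicator (A i) x * F x) \<longlonglongrightarrow> indicator (\<Union> (range A)) x * F x"
          unfolding eq by (intro AE_I2 tendsto_mult_right LIMSEQ_indicator_UN)
        show "AE x in lebesgue. cmod (\<Sum>i<n. indicator (A i) x * F x) \<le> cmod (F x)" for n
          unfolding eq by (intro AE_I2) (simp add: indicator_def)
      qed
      moreover have "(LINT x|lebesgue. (\<Sum>i<n. indicator (A i) x * F x)) = 0" for n
        using union(3) by (subst Bochner_Integration.integral_sum) (auto intro: iE[OF Al])
      ultimately have "(\<lambda>n. 0) \<longlonglongrightarrow> (LINT x|lebesgue. indicator (\<Union>i. A i) x * F x)" by simp
      from LIMSEQ_unique[OF this tendsto_const] show ?case .
    qed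
  qed
  have leb: "(LINT x|lebesgue. indicator E x * F x) = 0" if E: "E \<in> sets lebesgue" for E
  proof -
    obtain A N N' where A: "E = A \<union> N" "N \<subseteq> N'" "N' \<in> null_sets lborel" "A \<in> sets lborel"
      using E by (rule sets_completionE)
    have "AE x in lebesgue. x \<notin> N'" using A(3) by (intro AE_not_in) (auto intro: null_sets_completionI)
    then have "AE x in lebesgue. indicator E x * F x = indicator A x * F x"
      by eventually_elim (use A in \<open>auto simp: indicator_def\<close>)
    then have "(LINT x|lebesgue. indicator E x * F x) = (LINT x|lebesgue. indicator A x * F x)"
      by (rule integral_cong_AE[rotated -1]) (use iE[OF E] iE[of A] A in auto)
    then show ?thesis using borel A by simp
  qed
  have "AE x in lebesgue. Re (F x) = 0"
  proof (rule AE_zero_of_set_integrals)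
    fix E :: "(real^'d) set" assume E: "E \<in> sets lebesgue"
    have "(LINT x|lebesgue. indicator E x * Re (F x)) = (LINT x|lebesgue. Re (indicator E x * F x))"
      by (intro Bochner_Integration.integral_cong) (auto simp: indicator_def)
    also have "\<dots> = Re (LINT x|lebesgue. indicator E x * F x)" by (rule integral_Re[OF iE[OF E]])
    finally show "(LINT x|lebesgue. indicator E x * Re (F x)) = 0" using leb[OF E] by simp
  qed (use Fi in simp)
  moreover have "AE x in lebesgue. Im (F x) = 0"
  proof (rule AE_zero_of_set_integrals)
    fix E :: "(real^'d) set" assume E: "E \<in> sets lebesgue"
    have "(LINT x|lebesgue. indicator E x * Im (F x)) = (LINT x|lebesgue. Im (indicator E x * F x))"
      by (intro Bochner_Integration.integral_cong) (auto simp: indicator_def)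
    also have "\<dots> = Im (LINT x|lebesgue. indicator E x * F x)" by (rule integral_Im[OF iE[OF E]])
    finally show "(LINT x|lebesgue. indicator E x * Im (F x)) = 0" using leb[OF E] by simp
  qed (use Fi in simp)
  ultimately show ?thesis
    by eventually_elim (auto simp: F_def complex_eq_iff)
qed

text \<open>
  Smallness is a condition on the points, not on the side lengths, so that it passes to all boxes contained in
  a small box; an empty box may be given by vectors that are far apart.
\<close>

definition small_box :: "real \<Rightarrow> real^'d::finite \<Rightarrow> real^'d \<Rightarrow> bool" where
  "small_box e a b \<longleftrightarrow> (\<forall>x\<in>box a b. \<forall>y\<in>box a b. dist x y < e)"

lemma countable_Zd: "countable (Zd :: (real^'d::finite) set)"
proof -
  have "Zd \<subseteq> range (\<lambda>f::'d \<Rightarrow> int. \<chi> i. of_int (f i))"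
  proof
    fix x :: "real^'d" assume "x \<in> Zd"
    then have "x $ i = of_int \<lfloor>x $ i\<rfloor>" for i by (auto simp: Zd_def elim: Ints_cases)
    then show "x \<in> range (\<lambda>f::'d \<Rightarrow> int. \<chi> i. of_int (f i))"
      by (intro range_eqI[of _ _ "\<lambda>i. \<lfloor>x $ i\<rfloor>"]) (auto simp: vec_eq_iff)
  qed
  then show ?thesis by (rule countable_subset) auto
qed

text \<open>
  Countably many small boxes cover the space.
\<close>

lemma local_zero:
  fixes B :: "'d::finite cfun"
  assumes e: "e > 0"
    and B: "\<And>a b. small_box e a b \<Longrightarrow> integrable lebesgue (\<lambda>x. indicator (box a b) x * B x)"
    and zero: "\<And>a b. small_box e a b \<Longrightarrow> (LINT x|lebesgue. indicator (box a b) x * B x) = 0"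
  shows "AE x in lebesgue. B x = 0"
proof -
  \<comment> \<open>The boxes around \<open>\<delta> k\<close> with half side \<open>\<delta>\<close> overlap, so that they cover the space although they are open. Their
    diameter in the sum norm is less than \<open>2 \<delta> CARD('d) = e\<close>.\<close>
  define \<delta> where "\<delta> = e / (2 * real CARD('d))"
  have d: "\<delta> > 0" using e by (simp add: \<delta>_def)
  define lo hi :: "real^'d \<Rightarrow> real^'d" where "lo = (\<lambda>k. \<chi> i. \<delta> * (k $ i - 1))" and "hi = (\<lambda>k. \<chi> i. \<delta> * (k $ i + 1))"
  have small: "small_box e (lo k) (hi k)" for k
    unfolding small_box_def
  proof (intro ballI)
    fix x y assume xy: "x \<in> box (lo k) (hi k)" "y \<in> box (lo k) (hi k)"
    have "dist x y \<le> (\<Sum>i\<in>UNIV. \<bar>(x - y) $ i\<bar>)" unfolding dist_norm by (rule norm_le_l1_cart)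
    also have "\<dots> < (\<Sum>i\<in>(UNIV::'d set). 2 * \<delta>)"
    proof (rule sum_strict_mono)
      fix i
      have "\<delta> * (k $ i - 1) < x $ i" "x $ i < \<delta> * (k $ i + 1)" "\<delta> * (k $ i - 1) < y $ i" "y $ i < \<delta> * (k $ i + 1)"
        using xy by (auto simp: mem_box_cart lo_def hi_def)
      then show "\<bar>(x - y) $ i\<bar> < 2 * \<delta>" by (auto simp: abs_less_iff algebra_simps)
    qed auto
    also have "\<dots> = e" by (simp add: \<delta>_def)
    finally show "dist x y < e" .
  qed
  have "AE x in lebesgue. x \<in> box (lo k) (hi k) \<longrightarrow> B x = 0" for k
  proof (rule box_integrals_zero[OF B[OF small]])
    fix c d assume "box c d \<subseteq> box (lo k) (hi k)"
    then have "small_box e c d" using small[of k] unfolding small_box_def by blast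
    then show "(LINT x|lebesgue. indicator (box c d) x * B x) = 0" by (rule zero)
  qed
  then have "AE x in lebesgue. \<forall>k\<in>Zd. x \<in> box (lo k) (hi k) \<longrightarrow> B x = 0"
    using countable_Zd by (subst AE_ball_countable) auto
  then show ?thesis
  proof eventually_elim
    case (elim x)
    define k :: "real^'d" where "k = (\<chi> i. of_int \<lfloor>x $ i / \<delta>\<rfloor>)"
    have "k \<in> Zd" by (auto simp: k_def Zd_def)
    moreover have "x \<in> box (lo k) (hi k)"
      unfolding mem_box_cart lo_def hi_def k_def
    proof (intro allI, simp)
      fix i
      have "of_int \<lfloor>x $ i / \<delta>\<rfloor> * \<delta> \<le> x $ i"
        by (rule pos_le_divide_eq[OF d, THEN iffD1, OF of_int_floor_le])
      moreover have "x $ i < (of_int \<lfloor>x $ i / \<delta>\<rfloor> + 1) * \<delta>"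
        by (rule pos_divide_less_eq[OF d, THEN iffD1]) (rule real_of_int_floor_add_one_gt)
      ultimately show "\<delta> * (of_int \<lfloor>x $ i / \<delta>\<rfloor> - 1) < x $ i \<and> x $ i < \<delta> * (of_int \<lfloor>x $ i / \<delta>\<rfloor> + 1)"
        using d by (simp add: algebra_simps)
    qed
    ultimately show ?case using elim by blast
  qed
qed

section \<open>Bumps over boxes\<close>

text \<open>
  A bump over a larger box has a positive minimum on the closed box; divide by it.
\<close>

lemma test_fun_above_box:
  "\<exists>h :: 'd::finite cfun. test_fun h \<and> (\<forall>x\<in>box a b. cmod (h x) \<ge> 1)"
proof -
  let ?a = "a - (\<chi> i. 1)" and ?b = "b + (\<chi> i. 1)"
  let ?h = "bump ?a ?b 0"
  show ?thesis
  proof (cases "box a b = {}")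
    case True
    then show ?thesis using test_fun_zero by auto
  next
    case False
    have pos: "cmod (?h x) > 0" if "x \<in> cbox a b" for x
    proof -
      have "0 < x $ i - ?a $ i" "0 < ?b $ i - x $ i" for i
        using that by (auto simp: mem_box_cart) (smt (verit))+
      then have "0 < real_bump ?a ?b 0 x" unfolding real_bump_def flat_def by (intro prod_pos) auto
      then show ?thesis by (simp add: bump_def)
    qed
    have "continuous_on (cbox a b) (\<lambda>x. cmod (?h x))"
      by (intro continuous_on_norm continuous_on_subset[OF test_fun_continuous[OF test_fun_bump]]) auto
    moreover have "cbox a b \<noteq> {}" using False box_subset_cbox[of a b] by auto
    ultimately obtain y where y: "y \<in> cbox a b" "\<forall>x\<in>cbox a b. cmod (?h y) \<le> cmod (?h x)"
      using continuous_attains_inf[of "cbox a b" "\<lambda>x. cmod (?h x)"] compact_cbox by blast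
    define c where "c = cmod (?h y)"
    have c: "c > 0" using pos y by (simp add: c_def)
    have "cmod (of_real (1 / c) * ?h x) \<ge> 1" if "x \<in> box a b" for x
    proof -
      have "c \<le> cmod (?h x)" using y(2) that box_subset_cbox[of a b] by (auto simp: c_def)
      then show ?thesis using c by (simp add: norm_divide le_divide_eq)
    qed
    then show ?thesis using test_fun_cmult[OF test_fun_bump] by blast
  qed
qed

lemma test_fun_integrable: "test_fun h \<Longrightarrow> integrable lebesgue h"
proof -
  assume h: "test_fun h"
  then have "bounded {x. h x \<noteq> 0}" by (simp add: test_fun_iff)
  from bounded_subset_cbox_symmetric[OF this] obtain a b where ab: "{x. h x \<noteq> 0} \<subseteq> cbox a b" by blast
  have "integrable lebesgue (\<lambda>x. h x * indicator (cbox a b) x)"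
    by (rule L2_prod_integrable[OF L2_test_fun[OF h] L2_indicator_bounded]) (auto simp: bounded_cbox)
  moreover have "h x * indicator (cbox a b) x = h x" for x using ab by (auto simp: indicator_def)
  ultimately show ?thesis by simp
qed

lemma I_op_measurable:
  fixes U :: "real^'d^'d::finite"
  assumes U: "invertible U" and \<phi>: "\<And>l. l \<in> idx r \<Longrightarrow> \<phi> l \<in> borel_measurable lebesgue"
  shows "(\<lambda>\<xi>. I_op r \<phi> k (U *v \<xi>)) \<in> borel_measurable lebesgue"
proof (cases "k \<in> Zd")
  case True
  have "(\<lambda>\<xi>. \<Sum>l\<in>idx r. cnj (\<phi> l (U *v \<xi>)) * \<phi> l (U *v \<xi> + (2 * pi) *\<^sub>R k)) \<in> borel_measurable lebesgue"
  proof (intro borel_measurable_sum borel_measurable_times measurable_cnj)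
    fix l assume l: "l \<in> idx r"
    show "(\<lambda>\<xi>. \<phi> l (U *v \<xi>)) \<in> borel_measurable lebesgue"
      using measurable_affine_comp[OF U \<phi>[OF l], of 0] by simp
    show "(\<lambda>\<xi>. \<phi> l (U *v \<xi> + (2 * pi) *\<^sub>R k)) \<in> borel_measurable lebesgue"
      by (rule measurable_affine_comp[OF U \<phi>[OF l]])
  qed
  then show ?thesis using True by (simp add: I_op_def)
qed (simp add: I_op_def)

text \<open>
  The convergence theorems for integrals speak of sequences, whereas levels are integers; this and the next lemma translate.
\<close>

lemma tendsto_int_of_nat:
  fixes F :: "int \<Rightarrow> 'a::topological_space"
  assumes "(\<lambda>n::nat. F (J0 + int n)) \<longlonglongrightarrow> L"
  shows "(F \<longlongrightarrow> L) at_top"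
proof -
  have "filterlim (\<lambda>J'. nat (J' - J0)) sequentially at_top"
    unfolding filterlim_at_top
  proof
    fix Z :: nat
    show "\<forall>\<^sub>F J' in at_top. Z \<le> nat (J' - J0)"
      using eventually_ge_at_top[of "J0 + int Z"] by eventually_elim auto
  qed
  from filterlim_compose[OF assms this]
  have "((\<lambda>J'. F (J0 + int (nat (J' - J0)))) \<longlongrightarrow> L) at_top" .
  moreover have "\<forall>\<^sub>F J' in at_top. F (J0 + int (nat (J' - J0))) = F J'"
    using eventually_ge_at_top[of J0] by eventually_elim simp
  ultimately show ?thesis by (rule Lim_transform_eventually)
qed

lemma tendsto_nat_of_int:
  fixes F :: "int \<Rightarrow> 'a::topological_space"
  assumes "(F \<longlongrightarrow> L) at_top"
  shows "(\<lambda>n::nat. F (J0 + int n)) \<longlonglongrightarrow> L"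
proof (rule filterlim_compose[OF assms])
  show "filterlim (\<lambda>n. J0 + int n) at_top sequentially"
    unfolding filterlim_at_top
  proof
    fix Z :: int
    show "\<forall>\<^sub>F n in sequentially. Z \<le> J0 + int n"
      using eventually_ge_at_top[of "nat (Z - J0)"] by eventually_elim auto
  qed
qed

lemma Zd_norm_ge_1: "k \<in> Zd \<Longrightarrow> k \<noteq> 0 \<Longrightarrow> norm k \<ge> 1"
proof -
  assume k: "k \<in> Zd" "k \<noteq> 0"
  then obtain i where i: "k $ i \<noteq> 0" by (auto simp: vec_eq_iff)
  then have "1 \<le> \<bar>k $ i\<bar>" using k(1) Ints_nonzero_abs_ge1[of "k $ i"] by (auto simp: Zd_def)
  then show ?thesis using component_le_norm_cart[of k i] by linarith
qed

lemma SUP_eq_of_tendsto: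
  fixes f :: "nat \<Rightarrow> ennreal"
  assumes "incseq f" "f \<longlonglongrightarrow> L"
  shows "(SUP n. f n) = L"
  using LIMSEQ_unique[OF LIMSEQ_SUP[OF assms(1)] assms(2)] .

lemma SUP_real_bump: "(SUP n. ennreal ((real_bump a b n x)\<^sup>2)) = indicator (box a b) x"
proof (rule SUP_eq_of_tendsto)
  show "incseq (\<lambda>n. ennreal ((real_bump a b n x)\<^sup>2))"
    by (intro incseq_SucI ennreal_leI power_mono real_bump_mono real_bump_01)
  have "(\<lambda>n. ennreal ((real_bump a b n x)\<^sup>2)) \<longlonglongrightarrow> ennreal ((indicator (box a b) x)\<^sup>2)"
    by (intro tendsto_ennrealI tendsto_intros real_bump_lim)
  then show "(\<lambda>n. ennreal ((real_bump a b n x)\<^sup>2)) \<longlonglongrightarrow> indicator (box a b) x"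
    by (cases "x \<in> box a b") auto
qed

lemma real_bump_measurable: "real_bump a b n \<in> borel_measurable lebesgue"
proof -
  have "(\<lambda>x. Re (bump a b n x)) \<in> borel_measurable lebesgue"
    using test_fun_measurable[OF test_fun_bump] by (intro measurable_compose[OF _ borel_measurable_Re]) auto
  then show ?thesis by (simp add: bump_def)
qed

lemma nn_integral_SUP_real_bump:
  assumes [measurable]: "A \<in> borel_measurable lebesgue"
  shows "(SUP n. \<integral>\<^sup>+x. ennreal ((real_bump a b n x)\<^sup>2) * A x \<partial>lebesgue) = (\<integral>\<^sup>+x. indicator (box a b) x * A x \<partial>lebesgue)"
proof -
  note [measurable] = real_bump_measurable
  have "(\<integral>\<^sup>+x. (SUP n. ennreal ((real_bump a b n x)\<^sup>2) * A x) \<partial>lebesgue) = (SUP n. \<integral>\<^sup>+x. ennreal ((real_bump a b n x)\<^sup>2) * A x \<partial>lebesgue)"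
  proof (rule nn_integral_monotone_convergence_SUP)
    show "incseq (\<lambda>n x. ennreal ((real_bump a b n x)\<^sup>2) * A x)"
      by (intro incseq_SucI le_funI mult_right_mono ennreal_leI power_mono real_bump_mono real_bump_01) auto
  qed measurable
  moreover have "(SUP n. ennreal ((real_bump a b n x)\<^sup>2) * A x) = indicator (box a b) x * A x" for x
    by (subst SUP_mult_right_ennreal[symmetric]) (simp add: SUP_real_bump)
  ultimately show ?thesis by simp
qed

lemma real_bump_sq_integrable: "integrable lebesgue (\<lambda>x. (real_bump a b n x)\<^sup>2)"
  using L2_integrable[OF L2_test_fun[OF test_fun_bump[of a b n]]] by (simp add: bump_def)

lemma I_op_0: "I_op r \<phi> 0 x = of_real (\<Sum>l\<in>idx r. (cmod (\<phi> l x))\<^sup>2)"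
  unfolding of_real_sum by (simp add: I_op_def Zd_0 complex_norm_square mult.commute del: of_real_power)

section \<open>Fibers and dual frames\<close>

definition fiber_sum :: "int \<Rightarrow> (int \<Rightarrow> real^'d^'d::finite) \<Rightarrow> (int \<Rightarrow> enat) \<Rightarrow> (int \<Rightarrow> nat \<Rightarrow> 'd cfun) \<Rightarrow> int \<Rightarrow> real^'d \<Rightarrow> 'd cfun" where
  "fiber_sum J0 M \<sigma> \<gamma> J' \<kappa> = (\<lambda>\<xi>. \<Sum>j\<in>{J0..<J'}. I_op (\<sigma> j) (\<gamma> j) (M j *v \<kappa>) (M j *v \<xi>))"

definition fiber_limit :: "int \<Rightarrow> (int \<Rightarrow> real^'d^'d::finite) \<Rightarrow> (int \<Rightarrow> enat) \<Rightarrow> (int \<Rightarrow> nat \<Rightarrow> 'd cfun) \<Rightarrow> bool" where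
  "fiber_limit J0 M \<sigma> \<gamma> \<longleftrightarrow>
     (\<forall>h. test_fun h \<longrightarrow> ((\<lambda>J'. pair_fun (fiber_sum J0 M \<sigma> \<gamma> J' 0) h) \<longlongrightarrow> pair_fun (\<lambda>\<xi>. 1) h) at_top) \<and>
     (\<forall>\<kappa>\<in>Lam J0 M - {0}. AE \<xi> in lebesgue. ((\<lambda>J'. fiber_sum J0 M \<sigma> \<gamma> J' \<kappa> \<xi>) \<longlongrightarrow> 0) at_top)"

definition dual_limit :: "int \<Rightarrow> (int \<Rightarrow> real^'d^'d::finite) \<Rightarrow> (int \<Rightarrow> enat) \<Rightarrow> (int \<Rightarrow> nat \<Rightarrow> 'd functional) \<Rightarrow> bool" where
  "dual_limit J0 M \<sigma> G \<longleftrightarrow> (\<forall>f g. test_fun f \<longrightarrow> test_fun g \<longrightarrow>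
      (\<forall>j\<ge>J0. (\<lambda>p. norm (dual_term (M j) (G j) (G j) f g p)) summable_on idx (\<sigma> j) \<times> Zd) \<and>
      ((\<lambda>J'. \<Sum>j\<in>{J0..<J'}. \<Sum>\<^sub>\<infinity>p\<in>idx (\<sigma> j) \<times> Zd. dual_term (M j) (G j) (G j) f g p) \<longlongrightarrow> (2 * pi) ^ CARD('d) * pair_fun f g) at_top)"

context
  fixes J0 :: int and M :: "int \<Rightarrow> real^'d^'d::finite" and \<sigma> :: "int \<Rightarrow> enat"
    and G :: "int \<Rightarrow> nat \<Rightarrow> 'd functional" and \<gamma> :: "int \<Rightarrow> nat \<Rightarrow> 'd cfun"
  assumes inv: "\<And>j. j \<ge> J0 \<Longrightarrow> invertible (M j)"
    and discrete: "\<And>x. \<not> x islimpt Lam J0 M"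
    and contract: "\<And>k. k \<in> Lam J0 M \<Longrightarrow> ((\<lambda>j. norm (M j *v k)) \<longlongrightarrow> 0) at_top"
    and fin: "\<And>j. j \<ge> J0 \<Longrightarrow> \<sigma> j \<noteq> \<infinity>"
    and gam: "\<And>j l. j \<ge> J0 \<Longrightarrow> l \<in> idx (\<sigma> j) \<Longrightarrow> L2_loc (\<gamma> j l) \<and> represents (\<gamma> j l) (G j l)"
begin

abbreviation "fiber \<equiv> fiber_sum J0 M \<sigma> \<gamma>"
abbreviation "fiber_cond \<equiv> fiber_limit J0 M \<sigma> \<gamma>"
abbreviation "dual_cond \<equiv> dual_limit J0 M \<sigma> G"

lemma mem_Lam: "j \<ge> J0 \<Longrightarrow> M j *v \<kappa> \<in> Zd \<Longrightarrow> \<kappa> \<in> Lam J0 M"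
proof -
  assume j: "j \<ge> J0" "M j *v \<kappa> \<in> Zd"
  have "\<kappa> = matrix_inv (M j) *v (M j *v \<kappa>)" by (simp add: matrix_inv_cancel[OF inv[OF j(1)]])
  then show ?thesis using j by (auto simp: Lam_def)
qed

lemma zero_Lam: "0 \<in> Lam J0 M"
  by (rule mem_Lam[of J0]) (auto simp: Zd_0)

lemma fiber_measurable: "fiber J' \<kappa> \<in> borel_measurable lebesgue"
  unfolding fiber_sum_def
  by (intro borel_measurable_sum I_op_measurable inv) (use gam L2_loc_measurable in auto)

text \<open>
  The fiberization formulas of all levels below \<open>J'\<close>, added up over one common finite set of shifts.
\<close>

lemma dual_sum_fiber:
  assumes f: "test_fun f" and g: "test_fun g"
    and L: "finite L" "{\<kappa> \<in> Lam J0 M. \<exists>\<xi>. f \<xi> \<noteq> 0 \<and> g (\<xi> + (2 * pi) *\<^sub>R \<kappa>) \<noteq> 0} \<subseteq> L"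
  shows "j \<ge> J0 \<Longrightarrow> (\<lambda>p. norm (dual_term (M j) (G j) (G j) f g p)) summable_on idx (\<sigma> j) \<times> Zd"
    and "(\<Sum>j\<in>{J0..<J'}. \<Sum>\<^sub>\<infinity>p\<in>idx (\<sigma> j) \<times> Zd. dual_term (M j) (G j) (G j) f g p)
       = (2 * pi) ^ CARD('d) * (\<Sum>\<kappa>\<in>L. LINT \<xi>|lebesgue. f \<xi> * cnj (g (\<xi> + (2 * pi) *\<^sub>R \<kappa>)) * fiber J' \<kappa> \<xi>)"
    and "\<And>\<kappa>. integrable lebesgue (\<lambda>\<xi>. f \<xi> * cnj (g (\<xi> + (2 * pi) *\<^sub>R \<kappa>)) * fiber J' \<kappa> \<xi>)"
proof -
  have L': "\<kappa> \<in> L" if "j \<ge> J0" "M j *v \<kappa> \<in> Zd" "f \<xi> \<noteq> 0" "g (\<xi> + (2 * pi) *\<^sub>R \<kappa>) \<noteq> 0" for j \<kappa> \<xi>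
    using L(2) mem_Lam[OF that(1,2)] that(3,4) by blast
  have hs: "(dual_term (M j) (G j) (G j) f g has_sum ((2 * pi) ^ CARD('d) * (\<Sum>\<kappa>\<in>L. LINT \<xi>|lebesgue. f \<xi> * cnj (g (\<xi> + (2 * pi) *\<^sub>R \<kappa>)) * I_op (\<sigma> j) (\<gamma> j) (M j *v \<kappa>) (M j *v \<xi>)))) (idx (\<sigma> j) \<times> Zd)"
    if "j \<ge> J0" for j
    by (rule dual_term_has_sum(1)[OF inv[OF that] fin[OF that] gam[OF that] f g L(1) L'[OF that]])
  have int: "integrable lebesgue (\<lambda>\<xi>. f \<xi> * cnj (g (\<xi> + (2 * pi) *\<^sub>R \<kappa>)) * I_op (\<sigma> j) (\<gamma> j) (M j *v \<kappa>) (M j *v \<xi>))"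
    if "j \<ge> J0" for j \<kappa>
    by (rule dual_term_has_sum(2)[OF inv[OF that] fin[OF that] gam[OF that] f g L(1) L'[OF that]])
  show "(\<lambda>p. norm (dual_term (M j) (G j) (G j) f g p)) summable_on idx (\<sigma> j) \<times> Zd" if "j \<ge> J0"
    by (rule summable_on_iff_abs_summable_on_complex[THEN iffD1, OF has_sum_imp_summable[OF hs[OF that]]])
  have eq: "f \<xi> * cnj (g (\<xi> + (2 * pi) *\<^sub>R \<kappa>)) * fiber J' \<kappa> \<xi> = (\<Sum>j\<in>{J0..<J'}. f \<xi> * cnj (g (\<xi> + (2 * pi) *\<^sub>R \<kappa>)) * I_op (\<sigma> j) (\<gamma> j) (M j *v \<kappa>) (M j *v \<xi>))" for \<kappa> \<xi>
    by (simp add: fiber_sum_def sum_distrib_left)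
  show "integrable lebesgue (\<lambda>\<xi>. f \<xi> * cnj (g (\<xi> + (2 * pi) *\<^sub>R \<kappa>)) * fiber J' \<kappa> \<xi>)" for \<kappa>
    unfolding eq by (intro Bochner_Integration.integrable_sum int) auto
  have "(\<Sum>j\<in>{J0..<J'}. \<Sum>\<^sub>\<infinity>p\<in>idx (\<sigma> j) \<times> Zd. dual_term (M j) (G j) (G j) f g p)
     = (\<Sum>j\<in>{J0..<J'}. (2 * pi) ^ CARD('d) * (\<Sum>\<kappa>\<in>L. LINT \<xi>|lebesgue. f \<xi> * cnj (g (\<xi> + (2 * pi) *\<^sub>R \<kappa>)) * I_op (\<sigma> j) (\<gamma> j) (M j *v \<kappa>) (M j *v \<xi>)))"
    by (intro sum.cong refl infsumI hs) auto
  also have "\<dots> = (2 * pi) ^ CARD('d) * (\<Sum>\<kappa>\<in>L. \<Sum>j\<in>{J0..<J'}. LINT \<xi>|lebesgue. f \<xi> * cnj (g (\<xi> + (2 * pi) *\<^sub>R \<kappa>)) * I_op (\<sigma> j) (\<gamma> j) (M j *v \<kappa>) (M j *v \<xi>))"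
    unfolding sum_distrib_left[symmetric] by (subst sum.swap) simp
  also have "\<dots> = (2 * pi) ^ CARD('d) * (\<Sum>\<kappa>\<in>L. LINT \<xi>|lebesgue. f \<xi> * cnj (g (\<xi> + (2 * pi) *\<^sub>R \<kappa>)) * fiber J' \<kappa> \<xi>)"
    unfolding eq by (subst Bochner_Integration.integral_sum) (auto intro: int)
  finally show "(\<Sum>j\<in>{J0..<J'}. \<Sum>\<^sub>\<infinity>p\<in>idx (\<sigma> j) \<times> Zd. dual_term (M j) (G j) (G j) f g p)
       = (2 * pi) ^ CARD('d) * (\<Sum>\<kappa>\<in>L. LINT \<xi>|lebesgue. f \<xi> * cnj (g (\<xi> + (2 * pi) *\<^sub>R \<kappa>)) * fiber J' \<kappa> \<xi>)" .
qed

text \<open>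
  The shifts in question are bounded, and a set without accumulation points meets every compact set in a finite set.
\<close>

lemma finite_overlap:
  assumes f: "test_fun f" and g: "test_fun g"
  shows "finite {\<kappa> \<in> Lam J0 M. \<exists>\<xi>. f \<xi> \<noteq> 0 \<and> g (\<xi> + (2 * pi) *\<^sub>R \<kappa>) \<noteq> 0}"
proof -
  obtain R where R: "\<And>x. f x \<noteq> 0 \<Longrightarrow> norm x \<le> R" using f by (auto simp: test_fun_iff bounded_iff)
  obtain R' where R': "\<And>x. g x \<noteq> 0 \<Longrightarrow> norm x \<le> R'" using g by (auto simp: test_fun_iff bounded_iff)
  have "{\<kappa> \<in> Lam J0 M. \<exists>\<xi>. f \<xi> \<noteq> 0 \<and> g (\<xi> + (2 * pi) *\<^sub>R \<kappa>) \<noteq> 0} \<subseteq> cball 0 (R + R') \<inter> Lam J0 M"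
  proof clarsimp
    fix \<kappa> \<xi> assume "f \<xi> \<noteq> 0" "g (\<xi> + (2 * pi) *\<^sub>R \<kappa>) \<noteq> 0"
    then have "norm \<xi> \<le> R" "norm (\<xi> + (2 * pi) *\<^sub>R \<kappa>) \<le> R'" using R R' by auto
    then have "norm ((2 * pi) *\<^sub>R \<kappa>) \<le> R + R'"
      using norm_triangle_ineq4[of "\<xi> + (2 * pi) *\<^sub>R \<kappa>" \<xi>] by simp
    moreover have "1 * norm \<kappa> \<le> (2 * pi) * norm \<kappa>" using pi_gt3 by (intro mult_right_mono) auto
    ultimately show "norm \<kappa> \<le> R + R'" by simp
  qed
  moreover have "finite (cball 0 (R + R') \<inter> Lam J0 M)"
    by (rule finite_not_islimpt_in_compact) (use discrete in auto)
  ultimately show ?thesis by (rule finite_subset)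
qed

text \<open>
  The vector \<open>M j \<kappa>\<close> is nonzero and eventually shorter than \<open>1\<close>, hence not a lattice vector, and the level contributes nothing.
\<close>

lemma fiber_stationary:
  assumes \<kappa>: "\<kappa> \<in> Lam J0 M" "\<kappa> \<noteq> 0"
  shows "\<exists>m\<ge>J0. \<forall>J'\<ge>m. fiber J' \<kappa> = fiber m \<kappa>"
proof -
  have "\<forall>\<^sub>F j in at_top. norm (M j *v \<kappa>) < 1"
    using order_tendstoD(2)[OF contract[OF \<kappa>(1)]] by simp
  then obtain m0 where m0: "\<And>j. j \<ge> m0 \<Longrightarrow> norm (M j *v \<kappa>) < 1" by (auto simp: eventually_at_top_linorder)
  define m where "m = max m0 J0"
  have zero: "I_op (\<sigma> j) (\<gamma> j) (M j *v \<kappa>) \<xi> = 0" if j: "j \<ge> m" for j \<xi>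
  proof -
    have jJ: "j \<ge> J0" "j \<ge> m0" using j by (auto simp: m_def)
    have "M j *v \<kappa> \<noteq> 0"
    proof
      assume "M j *v \<kappa> = 0"
      then have "matrix_inv (M j) *v (M j *v \<kappa>) = 0" by simp
      then show False using \<kappa>(2) by (simp add: matrix_inv_cancel[OF inv[OF jJ(1)]])
    qed
    then have "M j *v \<kappa> \<notin> Zd" using Zd_norm_ge_1 m0[OF jJ(2)] by fastforce
    then show ?thesis by (simp add: I_op_def)
  qed
  have "fiber J' \<kappa> = fiber m \<kappa>" if "J' \<ge> m" for J'
    unfolding fiber_sum_def by (intro ext sum.mono_neutral_right) (use zero that in auto)
  moreover have "J0 \<le> m" by (simp add: m_def)
  ultimately show ?thesis by blast
qed

text \<open>
  Finitely many shifts occur, so the limit can be taken for each of them. For \<open>\<kappa> = 0\<close> it is the first fiber condition tested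
  against the test function \<open>cnj f g\<close>; for \<open>\<kappa> \<noteq> 0\<close> the eventually constant fiber vanishes almost everywhere.
\<close>

lemma fiber_limit_imp_dual_limit:
  assumes fib: fiber_cond
  shows dual_cond
  unfolding dual_limit_def
proof (intro allI impI)
  fix f g :: "'d cfun" assume f: "test_fun f" and g: "test_fun g"
  define L where "L = insert 0 {\<kappa> \<in> Lam J0 M. \<exists>\<xi>. f \<xi> \<noteq> 0 \<and> g (\<xi> + (2 * pi) *\<^sub>R \<kappa>) \<noteq> 0}"
  have L: "finite L" "{\<kappa> \<in> Lam J0 M. \<exists>\<xi>. f \<xi> \<noteq> 0 \<and> g (\<xi> + (2 * pi) *\<^sub>R \<kappa>) \<noteq> 0} \<subseteq> L"
    using finite_overlap[OF f g] by (auto simp: L_def)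
  note D = dual_sum_fiber[OF f g L]
  let ?t = "\<lambda>J' \<kappa>. LINT \<xi>|lebesgue. f \<xi> * cnj (g (\<xi> + (2 * pi) *\<^sub>R \<kappa>)) * fiber J' \<kappa> \<xi>"
  have lim: "((\<lambda>J'. ?t J' \<kappa>) \<longlongrightarrow> (if \<kappa> = 0 then pair_fun f g else 0)) at_top" if \<kappa>: "\<kappa> \<in> L" for \<kappa>
  proof (cases "\<kappa> = 0")
    case True
    define h where "h = (\<lambda>\<xi>. cnj (f \<xi>) * g \<xi>)"
    have h: "test_fun h" unfolding h_def by (rule test_fun_mult_left[OF smooth_cnj[OF test_fun_smooth[OF f]] g])
    have "?t J' 0 = pair_fun (fiber J' 0) h" for J'
      unfolding pair_fun_def by (intro Bochner_Integration.integral_cong) (auto simp: h_def mult_ac)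
    moreover have "pair_fun (\<lambda>\<xi>. 1) h = pair_fun f g"
      unfolding pair_fun_def by (intro Bochner_Integration.integral_cong) (auto simp: h_def)
    moreover have "((\<lambda>J'. pair_fun (fiber J' 0) h) \<longlongrightarrow> pair_fun (\<lambda>\<xi>. 1) h) at_top"
      using fib h unfolding fiber_limit_def by blast
    ultimately show ?thesis using True by simp
  next
    case False
    then have \<kappa>L: "\<kappa> \<in> Lam J0 M" using \<kappa> by (auto simp: L_def)
    obtain m where m: "\<And>J'. J' \<ge> m \<Longrightarrow> fiber J' \<kappa> = fiber m \<kappa>" using fiber_stationary[OF \<kappa>L False] by blast
    have ev: "\<forall>\<^sub>F J' in at_top. fiber J' \<kappa> = fiber m \<kappa>"
      using eventually_ge_at_top[of m] by eventually_elim (rule m)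
    have "AE \<xi> in lebesgue. ((\<lambda>J'. fiber J' \<kappa> \<xi>) \<longlongrightarrow> 0) at_top"
      using fib \<kappa>L False unfolding fiber_limit_def by blast
    then have z: "AE \<xi> in lebesgue. fiber m \<kappa> \<xi> = 0"
    proof eventually_elim
      case (elim \<xi>)
      have "((\<lambda>J'. fiber J' \<kappa> \<xi>) \<longlongrightarrow> fiber m \<kappa> \<xi>) at_top"
        by (rule tendsto_eventually) (use ev in eventually_elim, simp)
      then show ?case using tendsto_unique[OF _ _ elim] by simp
    qed
    have "?t m \<kappa> = (LINT \<xi>|(lebesgue :: (real^'d) measure). 0)"
      by (rule integral_cong_AE) (use z D(3)[where \<kappa> = \<kappa> and J' = m] in auto)
    then have "\<forall>\<^sub>F J' in at_top. ?t J' \<kappa> = 0" using ev by (auto elim: eventually_mono)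
    then show ?thesis using False by (simp add: tendsto_eventually)
  qed
  have "((\<lambda>J'. (2 * pi) ^ CARD('d) * (\<Sum>\<kappa>\<in>L. ?t J' \<kappa>)) \<longlongrightarrow> (2 * pi) ^ CARD('d) * (\<Sum>\<kappa>\<in>L. if \<kappa> = 0 then pair_fun f g else 0)) at_top"
    by (intro tendsto_intros lim)
  moreover have "(\<Sum>\<kappa>\<in>L. if \<kappa> = 0 then pair_fun f g else 0) = pair_fun f g" using L(1) by (simp add: L_def)
  ultimately show "(\<forall>j\<ge>J0. (\<lambda>p. norm (dual_term (M j) (G j) (G j) f g p)) summable_on idx (\<sigma> j) \<times> Zd) \<and>
      ((\<lambda>J'. \<Sum>j\<in>{J0..<J'}. \<Sum>\<^sub>\<infinity>p\<in>idx (\<sigma> j) \<times> Zd. dual_term (M j) (G j) (G j) f g p) \<longlongrightarrow> (2 * pi) ^ CARD('d) * pair_fun f g) at_top"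
    using D(1) by (simp only: D(2)) simp
qed

text \<open>
  Take for \<open>f\<close> a bump over a box and for \<open>g\<close> its translate by \<open>2 \<pi> \<kappa>0\<close>. Since \<open>\<Lambda>\<close> is discrete, a small enough box
  excludes all shifts except \<open>\<kappa>0\<close>, and the fiberization formula has only one term. Fibers are only locally integrable, hence the first part.
\<close>

lemma local_limit:
  assumes dual: dual_cond and \<kappa>: "\<kappa>0 \<in> Lam J0 M"
  shows "\<exists>e>0. \<forall>a b. small_box e a b \<longrightarrow>
     (\<forall>J'. integrable lebesgue (\<lambda>\<xi>. indicator (box a b) \<xi> * fiber J' \<kappa>0 \<xi>)) \<and>
     (\<forall>n. ((\<lambda>J'. LINT \<xi>|lebesgue. of_real ((real_bump a b n \<xi>)\<^sup>2) * fiber J' \<kappa>0 \<xi>) \<longlongrightarrow>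
        (if \<kappa>0 = 0 then LINT \<xi>|lebesgue. of_real ((real_bump a b n \<xi>)\<^sup>2) else 0)) at_top)"
proof -
  obtain e0 where e0: "e0 > 0" "\<And>\<kappa>. \<kappa> \<in> Lam J0 M \<Longrightarrow> \<kappa> \<noteq> \<kappa>0 \<Longrightarrow> dist \<kappa> \<kappa>0 \<ge> e0"
    using discrete[of \<kappa>0] unfolding islimpt_approachable by (metis not_less)
  \<comment> \<open>Shifts act on frequencies with the factor \<open>2 \<pi>\<close>.\<close>
  define e where "e = 2 * pi * e0"
  have e: "e > 0" using e0 by (simp add: e_def)
  have tt: "test_fun (\<lambda>x. h (x - (2 * pi) *\<^sub>R \<kappa>0))" if "test_fun h" for h :: "'d cfun"
    using test_fun_affine[OF that, of "mat 1" "- (2 * pi) *\<^sub>R \<kappa>0"] by (simp add: invertible_det_nz)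
  show ?thesis
  proof (intro exI[of _ e] conjI allI impI e)
    fix a b :: "real^'d" and J' assume sb: "small_box e a b"
    obtain h :: "'d cfun" where h: "test_fun h" "\<And>x. x \<in> box a b \<Longrightarrow> cmod (h x) \<ge> 1"
      using test_fun_above_box[of a b] by blast
    note D = dual_sum_fiber(3)[OF h(1) tt[OF h(1)] finite_overlap[OF h(1) tt[OF h(1)]] order_refl, where \<kappa> = \<kappa>0 and J' = J']
    have int: "integrable lebesgue (\<lambda>\<xi>. h \<xi> * cnj (h \<xi>) * fiber J' \<kappa>0 \<xi>)"
      using D by auto
    show "integrable lebesgue (\<lambda>\<xi>. indicator (box a b) \<xi> * fiber J' \<kappa>0 \<xi>)"
    proof (rule Bochner_Integration.integrable_bound[OF int])
      show "(\<lambda>\<xi>. indicator (box a b) \<xi> * fiber J' \<kappa>0 \<xi>) \<in> borel_measurable lebesgue"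
        by (intro borel_measurable_times borel_measurable_indicator fiber_measurable) simp
      show "AE \<xi> in lebesgue. norm (indicator (box a b) \<xi> * fiber J' \<kappa>0 \<xi>) \<le> norm (h \<xi> * cnj (h \<xi>) * fiber J' \<kappa>0 \<xi>)"
      proof (rule AE_I2)
        fix \<xi>
        show "norm (indicator (box a b) \<xi> * fiber J' \<kappa>0 \<xi>) \<le> norm (h \<xi> * cnj (h \<xi>) * fiber J' \<kappa>0 \<xi>)"
        proof (cases "\<xi> \<in> box a b")
          case True
          have "1 * 1 \<le> cmod (h \<xi>) * cmod (h \<xi>)" using h(2)[OF True] by (intro mult_mono) auto
          then have "1 * cmod (fiber J' \<kappa>0 \<xi>) \<le> (cmod (h \<xi>) * cmod (h \<xi>)) * cmod (fiber J' \<kappa>0 \<xi>)"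
            by (intro mult_right_mono) auto
          then show ?thesis using True by (simp add: norm_mult)
        qed simp
      qed
    qed
  next
    fix a b :: "real^'d" and n assume sb: "small_box e a b"
    let ?f = "bump a b n" and ?g = "\<lambda>x. bump a b n (x - (2 * pi) *\<^sub>R \<kappa>0)"
    have f: "test_fun ?f" and g: "test_fun ?g" using test_fun_bump tt by auto
    have L: "\<kappa> \<in> {\<kappa>0}" if "\<kappa> \<in> Lam J0 M" "?f \<xi> \<noteq> 0" "?g (\<xi> + (2 * pi) *\<^sub>R \<kappa>) \<noteq> 0" for \<kappa> \<xi>
    proof (rule ccontr)
      assume "\<kappa> \<notin> {\<kappa>0}"
      then have "dist \<kappa> \<kappa>0 \<ge> e0" using e0 that by auto
      have "\<xi> \<in> box a b" "\<xi> + (2 * pi) *\<^sub>R \<kappa> - (2 * pi) *\<^sub>R \<kappa>0 \<in> box a b"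
        using that bump_outside by blast+
      then have "dist (\<xi> + (2 * pi) *\<^sub>R \<kappa> - (2 * pi) *\<^sub>R \<kappa>0) \<xi> < e" using sb unfolding small_box_def by blast
      moreover have "dist (\<xi> + (2 * pi) *\<^sub>R \<kappa> - (2 * pi) *\<^sub>R \<kappa>0) \<xi> = 2 * pi * dist \<kappa> \<kappa>0"
      proof -
        have "\<xi> + (2 * pi) *\<^sub>R \<kappa> - (2 * pi) *\<^sub>R \<kappa>0 - \<xi> = (2 * pi) *\<^sub>R (\<kappa> - \<kappa>0)" by (simp add: algebra_simps)
        then show ?thesis unfolding dist_norm by simp
      qed
      ultimately show False using \<open>dist \<kappa> \<kappa>0 \<ge> e0\<close> by (simp add: e_def)
    qed
    have fs: "finite {\<kappa>0}" by simp
    have Ls: "{\<kappa> \<in> Lam J0 M. \<exists>\<xi>. ?f \<xi> \<noteq> 0 \<and> ?g (\<xi> + (2 * pi) *\<^sub>R \<kappa>) \<noteq> 0} \<subseteq> {\<kappa>0}"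
      using L by blast
    define c where "c = complex_of_real ((2 * pi) ^ CARD('d))"
    have c: "c \<noteq> 0" by (simp add: c_def)
    have eq: "?f \<xi> * cnj (?g (\<xi> + (2 * pi) *\<^sub>R \<kappa>0)) = of_real ((real_bump a b n \<xi>)\<^sup>2)" for \<xi>
      by (simp add: bump_def power2_eq_square)
    have D: "(\<Sum>j\<in>{J0..<J'}. \<Sum>\<^sub>\<infinity>p\<in>idx (\<sigma> j) \<times> Zd. dual_term (M j) (G j) (G j) ?f ?g p)
       = c * (LINT \<xi>|lebesgue. of_real ((real_bump a b n \<xi>)\<^sup>2) * fiber J' \<kappa>0 \<xi>)" for J'
      using dual_sum_fiber(2)[OF f g fs Ls, where J' = J']
      by (simp add: c_def bump_def power2_eq_square)
    have "((\<lambda>J'. \<Sum>j\<in>{J0..<J'}. \<Sum>\<^sub>\<infinity>p\<in>idx (\<sigma> j) \<times> Zd. dual_term (M j) (G j) (G j) ?f ?g p) \<longlongrightarrow> c * pair_fun ?f ?g) at_top"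
      using dual f g unfolding dual_limit_def c_def by blast
    then have "((\<lambda>J'. c * (LINT \<xi>|lebesgue. of_real ((real_bump a b n \<xi>)\<^sup>2) * fiber J' \<kappa>0 \<xi>)) \<longlongrightarrow> c * pair_fun ?f ?g) at_top"
      unfolding D .
    then have "((\<lambda>J'. (LINT \<xi>|lebesgue. of_real ((real_bump a b n \<xi>)\<^sup>2) * fiber J' \<kappa>0 \<xi>)) \<longlongrightarrow> pair_fun ?f ?g) at_top"
      using c tendsto_mult_left_iff by blast
    moreover have "pair_fun ?f ?g = (if \<kappa>0 = 0 then LINT \<xi>|lebesgue. of_real ((real_bump a b n \<xi>)\<^sup>2) else 0)"
    proof (cases "\<kappa>0 = 0")
      case True
      then show ?thesis using eq by (simp add: pair_fun_def)
    next
      case False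
      have "?f \<xi> * cnj (?g \<xi>) = 0" for \<xi>
        using L[OF zero_Lam, of \<xi>] False by auto
      then have "pair_fun ?f ?g = 0" unfolding pair_fun_def by (simp only: Bochner_Integration.integral_zero)
      then show ?thesis using False by simp
    qed
    ultimately show "((\<lambda>J'. LINT \<xi>|lebesgue. of_real ((real_bump a b n \<xi>)\<^sup>2) * fiber J' \<kappa>0 \<xi>) \<longlongrightarrow>
        (if \<kappa>0 = 0 then LINT \<xi>|lebesgue. of_real ((real_bump a b n \<xi>)\<^sup>2) else 0)) at_top" by simp
  qed
qed

text \<open>
  The fiber at \<open>\<kappa>\<close> is eventually constant in \<open>J'\<close>, so \<open>local_limit\<close> computes its integrals against squared bumps: they are zero.
  Letting the bumps increase to the indicator function of the box, the integrals of the fiber over small boxes are zero as well.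
\<close>

lemma dual_limit_imp_off_diagonal:
  assumes dual: dual_cond and \<kappa>: "\<kappa> \<in> Lam J0 M - {0}"
  shows "AE \<xi> in lebesgue. ((\<lambda>J'. fiber J' \<kappa> \<xi>) \<longlongrightarrow> 0) at_top"
proof -
  have \<kappa>': "\<kappa> \<in> Lam J0 M" "\<kappa> \<noteq> 0" using \<kappa> by auto
  obtain m where m: "\<And>J'. J' \<ge> m \<Longrightarrow> fiber J' \<kappa> = fiber m \<kappa>" using fiber_stationary[OF \<kappa>'] by blast
  have ev: "\<forall>\<^sub>F J' in at_top. fiber J' \<kappa> = fiber m \<kappa>"
    using eventually_ge_at_top[of m] by eventually_elim (rule m)
  obtain e where e: "e > 0" and int: "\<And>a b. small_box e a b \<Longrightarrow> integrable lebesgue (\<lambda>\<xi>. indicator (box a b) \<xi> * fiber m \<kappa> \<xi>)"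
    and lim: "\<And>a b n. small_box e a b \<Longrightarrow> ((\<lambda>J'. LINT \<xi>|lebesgue. of_real ((real_bump a b n \<xi>)\<^sup>2) * fiber J' \<kappa> \<xi>) \<longlongrightarrow> 0) at_top"
    using local_limit[OF dual \<kappa>'(1)] \<kappa>'(2) by (auto simp only: if_False)
  have "AE \<xi> in lebesgue. fiber m \<kappa> \<xi> = 0"
  proof (rule local_zero[OF e int])
    fix a b :: "real^'d" assume sb: "small_box e a b"
    have z: "(LINT \<xi>|lebesgue. of_real ((real_bump a b n \<xi>)\<^sup>2) * fiber m \<kappa> \<xi>) = 0" for n
    proof -
      have "((\<lambda>J'. LINT \<xi>|lebesgue. of_real ((real_bump a b n \<xi>)\<^sup>2) * fiber J' \<kappa> \<xi>) \<longlongrightarrow> (LINT \<xi>|lebesgue. of_real ((real_bump a b n \<xi>)\<^sup>2) * fiber m \<kappa> \<xi>)) at_top"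
        by (rule tendsto_eventually) (use ev in eventually_elim, simp)
      then show ?thesis using tendsto_unique[OF _ _ lim[OF sb, of n]] by simp
    qed
    have "(\<lambda>n. LINT \<xi>|lebesgue. of_real ((real_bump a b n \<xi>)\<^sup>2) * fiber m \<kappa> \<xi>) \<longlonglongrightarrow> (LINT \<xi>|lebesgue. indicator (box a b) \<xi> * fiber m \<kappa> \<xi>)"
    proof (rule integral_dominated_convergence[where w = "\<lambda>\<xi>. norm (indicator (box a b) \<xi> * fiber m \<kappa> \<xi>)"])
      show "(\<lambda>\<xi>. indicator (box a b) \<xi> * fiber m \<kappa> \<xi>) \<in> borel_measurable lebesgue" using int[OF sb] by simp
      show "integrable lebesgue (\<lambda>\<xi>. norm (indicator (box a b) \<xi> * fiber m \<kappa> \<xi>))" using int[OF sb] by (rule integrable_norm)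
      have rm: "(\<lambda>\<xi>. complex_of_real ((real_bump a b n \<xi>)\<^sup>2)) \<in> borel_measurable lebesgue" for n
      proof -
        have "complex_of_real ((real_bump a b n \<xi>)\<^sup>2) = bump a b n \<xi> * bump a b n \<xi>" for \<xi> by (simp add: bump_def power2_eq_square)
        then show ?thesis using borel_measurable_times[OF test_fun_measurable[OF test_fun_bump] test_fun_measurable[OF test_fun_bump]] by simp
      qed
      show "(\<lambda>\<xi>. of_real ((real_bump a b n \<xi>)\<^sup>2) * fiber m \<kappa> \<xi>) \<in> borel_measurable lebesgue" for n
        by (intro borel_measurable_times rm fiber_measurable)
      show "AE \<xi> in lebesgue. (\<lambda>n. of_real ((real_bump a b n \<xi>)\<^sup>2) * fiber m \<kappa> \<xi>) \<longlonglongrightarrow> indicator (box a b) \<xi> * fiber m \<kappa> \<xi>"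
      proof (intro AE_I2 tendsto_mult_right)
        fix \<xi>
        have "(\<lambda>n. complex_of_real ((real_bump a b n \<xi>)\<^sup>2)) \<longlonglongrightarrow> of_real ((indicator (box a b) \<xi>)\<^sup>2)"
          by (intro tendsto_intros real_bump_lim)
        then show "(\<lambda>n. complex_of_real ((real_bump a b n \<xi>)\<^sup>2)) \<longlonglongrightarrow> indicator (box a b) \<xi>"
          by (cases "\<xi> \<in> box a b") auto
      qed
      show "AE \<xi> in lebesgue. norm (of_real ((real_bump a b n \<xi>)\<^sup>2) * fiber m \<kappa> \<xi>) \<le> norm (indicator (box a b) \<xi> * fiber m \<kappa> \<xi>)" for n
      proof (rule AE_I2)
        fix \<xi>
        have "(real_bump a b n \<xi>)\<^sup>2 \<le> 1" using real_bump_01[of a b n \<xi>] by (simp add: power_le_one)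
        then show "norm (of_real ((real_bump a b n \<xi>)\<^sup>2) * fiber m \<kappa> \<xi>) \<le> norm (indicator (box a b) \<xi> * fiber m \<kappa> \<xi>)"
          using real_bump_outside[of \<xi> a b n] by (cases "\<xi> \<in> box a b") (auto simp: norm_mult norm_power intro!: mult_left_le_one_le)
      qed
    qed
    then have "(\<lambda>n::nat. 0) \<longlonglongrightarrow> (LINT \<xi>|lebesgue. indicator (box a b) \<xi> * fiber m \<kappa> \<xi>)"
      unfolding z .
    from LIMSEQ_unique[OF this tendsto_const]
    show "(LINT \<xi>|lebesgue. indicator (box a b) \<xi> * fiber m \<kappa> \<xi>) = 0" .
  qed
  then show ?thesis
  proof eventually_elim
    case (elim \<xi>)
    show ?case by (rule tendsto_eventually) (use ev in eventually_elim, simp add: elim)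
  qed
qed

text \<open>
  The real form of the fiber at \<open>0\<close>, for use with monotone convergence.
\<close>

definition mass :: "int \<Rightarrow> real^'d \<Rightarrow> real" where
  "mass J' \<xi> = (\<Sum>j\<in>{J0..<J'}. \<Sum>l\<in>idx (\<sigma> j). (cmod (\<gamma> j l (M j *v \<xi>)))\<^sup>2)"

lemma fiber_0: "fiber J' 0 \<xi> = of_real (mass J' \<xi>)"
  by (simp add: fiber_sum_def mass_def I_op_0)

lemma mass_nonneg: "0 \<le> mass J' \<xi>"
  by (auto simp: mass_def intro!: sum_nonneg)

lemma mass_mono: "J1 \<le> J2 \<Longrightarrow> mass J1 \<xi> \<le> mass J2 \<xi>"
  unfolding mass_def by (rule sum_mono2) (auto intro!: sum_nonneg)

lemma mass_measurable: "mass J' \<in> borel_measurable lebesgue"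
proof -
  have "(\<lambda>\<xi>. Re (fiber J' 0 \<xi>)) \<in> borel_measurable lebesgue"
    using fiber_measurable by (intro measurable_compose[OF _ borel_measurable_Re]) auto
  then show ?thesis by (simp add: fiber_0)
qed

text \<open>
  Partial sums with nonnegative terms have a pointwise supremum \<open>A\<close>. By monotone convergence, in \<open>J'\<close> and then along the bumps,
  \<open>A\<close> has over every small box the same integral as the constant \<open>1\<close>; in particular it is finite almost everywhere.
\<close>

lemma dual_limit_imp_mass_one:
  assumes dual: "dual_cond"
  shows "AE \<xi> in lebesgue. (SUP m::nat. ennreal (mass (J0 + int m) \<xi>)) = 1"
proof -
  define A where "A = (\<lambda>\<xi>. SUP m::nat. ennreal (mass (J0 + int m) \<xi>))"
  note [measurable] = mass_measurable real_bump_measurable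
  have Am[measurable]: "A \<in> borel_measurable lebesgue" unfolding A_def by measurable
  obtain e where e: "e > 0" and int: "\<And>a b J'. small_box e a b \<Longrightarrow> integrable lebesgue (\<lambda>\<xi>. indicator (box a b) \<xi> * fiber J' 0 \<xi>)"
    and lim: "\<And>a b n. small_box e a b \<Longrightarrow> ((\<lambda>J'. LINT \<xi>|lebesgue. of_real ((real_bump a b n \<xi>)\<^sup>2) * fiber J' 0 \<xi>) \<longlongrightarrow>
      (LINT \<xi>|lebesgue. of_real ((real_bump a b n \<xi>)\<^sup>2))) at_top"
    using local_limit[OF dual zero_Lam] by (auto simp only: refl if_True simp_thms)
  have nnA: "(\<integral>\<^sup>+\<xi>. indicator (box a b) \<xi> * A \<xi> \<partial>lebesgue) = emeasure lebesgue (box a b)" if sb: "small_box e a b" for a b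
  proof -
    have step: "(\<integral>\<^sup>+\<xi>. ennreal ((real_bump a b n \<xi>)\<^sup>2) * A \<xi> \<partial>lebesgue) = (\<integral>\<^sup>+\<xi>. ennreal ((real_bump a b n \<xi>)\<^sup>2) * 1 \<partial>lebesgue)" for n
    proof -
      let ?\<beta> = "\<lambda>\<xi>. (real_bump a b n \<xi>)\<^sup>2"
      have bi: "integrable lebesgue (\<lambda>\<xi>. ?\<beta> \<xi> * mass J' \<xi>)" for J'
      proof (rule Bochner_Integration.integrable_bound[OF int[OF sb, of J']])
        show "AE \<xi> in lebesgue. norm (?\<beta> \<xi> * mass J' \<xi>) \<le> norm (indicator (box a b) \<xi> * fiber J' 0 \<xi>)"
        proof (rule AE_I2)
          fix \<xi>
          have "?\<beta> \<xi> \<le> 1" using real_bump_01[of a b n \<xi>] by (simp add: power_le_one)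
          then show "norm (?\<beta> \<xi> * mass J' \<xi>) \<le> norm (indicator (box a b) \<xi> * fiber J' 0 \<xi>)"
            using real_bump_outside[of \<xi> a b n] mass_nonneg[of J' \<xi>]
            by (cases "\<xi> \<in> box a b") (auto simp: fiber_0 abs_mult intro!: mult_left_le_one_le)
        qed
      qed measurable
      have "(\<integral>\<^sup>+\<xi>. ennreal (?\<beta> \<xi>) * A \<xi> \<partial>lebesgue) = (\<integral>\<^sup>+\<xi>. (SUP m::nat. ennreal (?\<beta> \<xi> * mass (J0 + int m) \<xi>)) \<partial>lebesgue)"
        unfolding A_def by (intro nn_integral_cong) (simp add: SUP_mult_left_ennreal ennreal_mult mass_nonneg)
      also have "\<dots> = (SUP m::nat. \<integral>\<^sup>+\<xi>. ennreal (?\<beta> \<xi> * mass (J0 + int m) \<xi>) \<partial>lebesgue)"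
      proof (rule nn_integral_monotone_convergence_SUP)
        show "incseq (\<lambda>m \<xi>. ennreal (?\<beta> \<xi> * mass (J0 + int m) \<xi>))"
          by (intro incseq_SucI le_funI ennreal_leI mult_left_mono mass_mono) auto
      qed measurable
      also have "\<dots> = (SUP m::nat. ennreal (LINT \<xi>|lebesgue. ?\<beta> \<xi> * mass (J0 + int m) \<xi>))"
        by (intro SUP_cong refl nn_integral_eq_integral bi) (simp add: mass_nonneg)
      also have "\<dots> = ennreal (LINT \<xi>|lebesgue. ?\<beta> \<xi>)"
      proof (rule SUP_eq_of_tendsto)
        show "incseq (\<lambda>m. ennreal (LINT \<xi>|lebesgue. ?\<beta> \<xi> * mass (J0 + int m) \<xi>))"
          by (intro incseq_SucI ennreal_leI integral_mono bi mult_left_mono mass_mono) auto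
        have "(LINT \<xi>|lebesgue. of_real (?\<beta> \<xi>) * fiber J' 0 \<xi>) = complex_of_real (LINT \<xi>|lebesgue. ?\<beta> \<xi> * mass J' \<xi>)" for J'
          unfolding fiber_0 of_real_mult[symmetric] by (rule integral_complex_of_real)
        then have "((\<lambda>J'. complex_of_real (LINT \<xi>|lebesgue. ?\<beta> \<xi> * mass J' \<xi>)) \<longlongrightarrow> complex_of_real (LINT \<xi>|lebesgue. ?\<beta> \<xi>)) at_top"
          using lim[OF sb, of n] unfolding integral_complex_of_real by simp
        then have "((\<lambda>J'. LINT \<xi>|lebesgue. ?\<beta> \<xi> * mass J' \<xi>) \<longlongrightarrow> (LINT \<xi>|lebesgue. ?\<beta> \<xi>)) at_top"
          unfolding tendsto_of_real_iff .
        from tendsto_ennrealI[OF tendsto_nat_of_int[OF this, of J0]]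
        show "(\<lambda>m. ennreal (LINT \<xi>|lebesgue. ?\<beta> \<xi> * mass (J0 + int m) \<xi>)) \<longlonglongrightarrow> ennreal (LINT \<xi>|lebesgue. ?\<beta> \<xi>)" .
      qed
      also have "\<dots> = (\<integral>\<^sup>+\<xi>. ennreal (?\<beta> \<xi>) \<partial>lebesgue)"
        by (rule nn_integral_eq_integral[symmetric, OF real_bump_sq_integrable]) simp
      finally show ?thesis by simp
    qed
    have "(\<integral>\<^sup>+\<xi>. indicator (box a b) \<xi> * A \<xi> \<partial>lebesgue) = (\<integral>\<^sup>+\<xi>. indicator (box a b) \<xi> * 1 \<partial>lebesgue)"
      unfolding nn_integral_SUP_real_bump[OF Am, symmetric] step by (rule nn_integral_SUP_real_bump) simp
    then show ?thesis by simp
  qed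
  have finite_box: "emeasure lebesgue (box a b) \<noteq> \<infinity>" for a b :: "real^'d"
    by (simp add: emeasure_lborel_box_eq)
  have AE1: "AE \<xi> in lebesgue. complex_of_real (enn2real (A \<xi>) - 1) = 0"
  proof (rule local_zero[OF e])
    fix a b :: "real^'d" assume sb: "small_box e a b"
    have "AE \<xi> in lebesgue. indicator (box a b) \<xi> * A \<xi> \<noteq> \<infinity>"
    proof (rule nn_integral_PInf_AE)
      show "(\<lambda>\<xi>. indicator (box a b) \<xi> * A \<xi>) \<in> borel_measurable lebesgue"
        by (intro borel_measurable_times_ennreal borel_measurable_indicator Am) simp
    qed (use nnA[OF sb] finite_box in auto)
    then have "AE \<xi> in lebesgue. ennreal (indicator (box a b) \<xi> * enn2real (A \<xi>)) = indicator (box a b) \<xi> * A \<xi>"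
      by eventually_elim (auto simp: indicator_def less_top)
    then have nn: "(\<integral>\<^sup>+\<xi>. ennreal (indicator (box a b) \<xi> * enn2real (A \<xi>)) \<partial>lebesgue) = emeasure lebesgue (box a b)"
      using nnA[OF sb] by (simp add: nn_integral_cong_AE)
    have em: "(\<lambda>\<xi>. indicat_real (box a b) \<xi> * enn2real (A \<xi>)) \<in> borel_measurable lebesgue"
      by (intro borel_measurable_times borel_measurable_indicator borel_measurable_enn2real Am) simp
    have i1: "integrable lebesgue (\<lambda>\<xi>. indicator (box a b) \<xi> * enn2real (A \<xi>))"
      by (rule integrableI_nonneg) (use em nn finite_box in \<open>auto simp: less_top\<close>)
    have I1: "(LINT \<xi>|lebesgue. indicator (box a b) \<xi> * enn2real (A \<xi>)) = measure lebesgue (box a b)"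
      by (subst integral_eq_nn_integral) (use em in \<open>auto simp: nn measure_def\<close>)
    have i2: "integrable lebesgue (indicat_real (box a b))"
      using finite_box by (intro integrable_real_indicator) (auto simp: less_top)
    have eq: "indicator (box a b) \<xi> * complex_of_real (enn2real (A \<xi>) - 1) = complex_of_real (indicator (box a b) \<xi> * enn2real (A \<xi>) - indicator (box a b) \<xi>)" for \<xi>
      by (simp add: indicator_def)
    show "integrable lebesgue (\<lambda>\<xi>. indicator (box a b) \<xi> * complex_of_real (enn2real (A \<xi>) - 1))"
      unfolding eq by (intro integrable_of_real Bochner_Integration.integrable_diff i1 i2)
    have "(LINT \<xi>|lebesgue. indicator (box a b) \<xi> * enn2real (A \<xi>) - indicator (box a b) \<xi>) = 0"
      using I1 i1 i2 by simp
    then show "(LINT \<xi>|lebesgue. indicator (box a b) \<xi> * complex_of_real (enn2real (A \<xi>) - 1)) = 0"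
      unfolding eq integral_complex_of_real by simp
  qed
  show ?thesis
    using AE1
  proof eventually_elim
    case (elim \<xi>)
    then have "enn2real (A \<xi>) = 1" by simp
    then have "A \<xi> = 1" by (cases "A \<xi>") auto
    then show ?case by (simp add: A_def)
  qed
qed

text \<open>
  The partial sums increase to \<open>1\<close> almost everywhere, so they are dominated by \<open>1\<close>, and the test function itself is an integrable majorant.
\<close>

lemma dual_limit_imp_diagonal:
  assumes dual: "dual_cond" and h: "test_fun h"
  shows "((\<lambda>J'. pair_fun (fiber J' 0) h) \<longlongrightarrow> pair_fun (\<lambda>\<xi>. 1) h) at_top"
proof (rule tendsto_int_of_nat[of _ J0])
  note one = dual_limit_imp_mass_one[OF dual]
  show "(\<lambda>m. pair_fun (fiber (J0 + int m) 0) h) \<longlonglongrightarrow> pair_fun (\<lambda>\<xi>. 1) h"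
    unfolding pair_fun_def
  proof (rule integral_dominated_convergence[where w = "\<lambda>\<xi>. cmod (h \<xi>)"])
    have hm: "(\<lambda>\<xi>. cnj (h \<xi>)) \<in> borel_measurable lebesgue" by (rule measurable_cnj[OF test_fun_measurable[OF h]])
    then show "(\<lambda>\<xi>. 1 * cnj (h \<xi>)) \<in> borel_measurable lebesgue" by simp
    show "(\<lambda>\<xi>. fiber (J0 + int m) 0 \<xi> * cnj (h \<xi>)) \<in> borel_measurable lebesgue" for m
      by (intro borel_measurable_times hm fiber_measurable)
    show "integrable lebesgue (\<lambda>\<xi>. cmod (h \<xi>))" using test_fun_integrable[OF h] by simp
    show "AE \<xi> in lebesgue. (\<lambda>m. fiber (J0 + int m) 0 \<xi> * cnj (h \<xi>)) \<longlonglongrightarrow> 1 * cnj (h \<xi>)"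
      using one
    proof eventually_elim
      case (elim \<xi>)
      have "(\<lambda>m. ennreal (mass (J0 + int m) \<xi>)) \<longlonglongrightarrow> (SUP m. ennreal (mass (J0 + int m) \<xi>))"
        by (rule LIMSEQ_SUP) (intro incseq_SucI ennreal_leI mass_mono, simp)
      then have "(\<lambda>m. ennreal (mass (J0 + int m) \<xi>)) \<longlonglongrightarrow> ennreal 1" unfolding elim by simp
      then have "(\<lambda>m. mass (J0 + int m) \<xi>) \<longlonglongrightarrow> 1"
        by (rule tendsto_ennrealD) (auto simp: mass_nonneg)
      then have "(\<lambda>m. complex_of_real (mass (J0 + int m) \<xi>)) \<longlonglongrightarrow> of_real 1" by (rule tendsto_of_real)
      then show ?case unfolding fiber_0 by (intro tendsto_mult_right) simp
    qed
    show "AE \<xi> in lebesgue. norm (fiber (J0 + int m) 0 \<xi> * cnj (h \<xi>)) \<le> cmod (h \<xi>)" for m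
      using one
    proof eventually_elim
      case (elim \<xi>)
      have "ennreal (mass (J0 + int m) \<xi>) \<le> (SUP m. ennreal (mass (J0 + int m) \<xi>))" by (rule SUP_upper) simp
      then have "mass (J0 + int m) \<xi> \<le> 1" unfolding elim by simp
      then show ?case using mass_nonneg[of "J0 + int m" \<xi>]
        by (simp add: fiber_0 norm_mult mult_left_le_one_le)
    qed
  qed
qed

lemma fiber_limit_iff_dual_limit: "fiber_cond \<longleftrightarrow> dual_cond"
  using fiber_limit_imp_dual_limit dual_limit_imp_diagonal
    dual_limit_imp_off_diagonal
  unfolding fiber_limit_def by blast

end

section \<open>The scaling generators as one more level\<close>

definition prepend :: "int \<Rightarrow> 'a \<Rightarrow> (int \<Rightarrow> 'a) \<Rightarrow> int \<Rightarrow> 'a" where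
  "prepend J x0 x j = (if j < J then x0 else x j)"

lemma prepend_simps: "prepend J x0 x (J - 1) = x0" "j \<ge> J \<Longrightarrow> prepend J x0 x j = x j"
  by (auto simp: prepend_def)

lemma prepend_all: "(\<forall>j\<ge>J - 1. P j) \<longleftrightarrow> P (J - 1) \<and> (\<forall>j\<ge>J. P j)" for J :: int
  by (metis le_less linorder_not_le zle_diff1_eq order_refl)

lemma sum_prepend:
  fixes J :: int
  assumes "J \<le> J'"
  shows "(\<Sum>j\<in>{J - 1..<J'}. F j) = F (J - 1) + (\<Sum>j\<in>{J..<J'}. F j)"
proof -
  have "{J - 1..<J'} = insert (J - 1) {J..<J'}" using assms by auto
  then show ?thesis by simp
qed

text \<open>
  The added level repeats the matrix of level \<open>J\<close> and so adds no lattice.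
\<close>

lemma Lam_prepend: "Lam (J - 1) (prepend J (N J) N) = Lam J N"
proof -
  have "{J - 1..} = insert (J - 1) {J..}" by auto
  then have "Lam (J - 1) (prepend J (N J) N) = (\<lambda>k. matrix_inv (N J) *v k) ` Zd \<union> (\<Union>j\<in>{J..}. (\<lambda>k. matrix_inv (prepend J (N J) N j) *v k) ` Zd)"
    by (simp add: Lam_def prepend_simps)
  also have "(\<Union>j\<in>{J..}. (\<lambda>k. matrix_inv (prepend J (N J) N j) *v k) ` Zd) = Lam J N"
    unfolding Lam_def by (intro SUP_cong refl) (simp add: prepend_simps)
  finally show ?thesis by (auto simp: Lam_def)
qed

text \<open>
  The iterated sum of extended nonnegative numbers is one unordered sum over all triples of level, generator and shift.
\<close>

lemma frame_sum_prepend: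
  fixes N :: "int \<Rightarrow> real^'d^'d::finite" and \<gamma> :: "int \<Rightarrow> nat \<Rightarrow> 'd cfun"
  assumes c: "c \<ge> 0"
  shows "(\<Sum>\<^sub>\<infinity>l\<in>idx r. \<Sum>\<^sub>\<infinity>k\<in>Zd. ennreal ((cmod (pair_fun f (fun_dil (N J) k (\<gamma> (J - 1) l))))\<^sup>2))
      + (\<Sum>\<^sub>\<infinity>j\<in>{J..}. \<Sum>\<^sub>\<infinity>l\<in>idx (s j). \<Sum>\<^sub>\<infinity>k\<in>Zd. ennreal ((cmod (pair_fun f (fun_dil (N j) k (\<gamma> j l))))\<^sup>2))
      = ennreal c
    \<longleftrightarrow> ((\<lambda>(j, l, k). (cmod (pair_fun f (fun_dil (prepend J (N J) N j) k (\<gamma> j l))))\<^sup>2) has_sum c) (frame_index (J - 1) (prepend J r s))"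
proof -
  define g where "g = (\<lambda>j l k. (cmod (pair_fun f (fun_dil (prepend J (N J) N j) k (\<gamma> j l))))\<^sup>2)"
  have "(\<Sum>\<^sub>\<infinity>p\<in>frame_index (J - 1) (prepend J r s). ennreal (case p of (j, l, k) \<Rightarrow> g j l k))
     = (\<Sum>\<^sub>\<infinity>j\<in>{J - 1..}. \<Sum>\<^sub>\<infinity>l\<in>idx (prepend J r s j). \<Sum>\<^sub>\<infinity>k\<in>Zd. ennreal (g j l k))"
    unfolding frame_index_def infsum_Sigma_ennreal by simp
  also have "\<dots> = (\<Sum>\<^sub>\<infinity>l\<in>idx (prepend J r s (J - 1)). \<Sum>\<^sub>\<infinity>k\<in>Zd. ennreal (g (J - 1) l k))
     + (\<Sum>\<^sub>\<infinity>j\<in>{J..}. \<Sum>\<^sub>\<infinity>l\<in>idx (prepend J r s j). \<Sum>\<^sub>\<infinity>k\<in>Zd. ennreal (g j l k))"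
  proof -
    have "{J - 1..} = insert (J - 1) {J..}" by auto
    then show ?thesis by (simp add: infsum_insert nonneg_summable_on_complete)
  qed
  also have "(\<Sum>\<^sub>\<infinity>j\<in>{J..}. \<Sum>\<^sub>\<infinity>l\<in>idx (prepend J r s j). \<Sum>\<^sub>\<infinity>k\<in>Zd. ennreal (g j l k))
     = (\<Sum>\<^sub>\<infinity>j\<in>{J..}. \<Sum>\<^sub>\<infinity>l\<in>idx (s j). \<Sum>\<^sub>\<infinity>k\<in>Zd. ennreal ((cmod (pair_fun f (fun_dil (N j) k (\<gamma> j l))))\<^sup>2))"
    by (intro infsum_cong) (simp add: g_def prepend_simps)
  finally have eq: "(\<Sum>\<^sub>\<infinity>l\<in>idx r. \<Sum>\<^sub>\<infinity>k\<in>Zd. ennreal ((cmod (pair_fun f (fun_dil (N J) k (\<gamma> (J - 1) l))))\<^sup>2))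
      + (\<Sum>\<^sub>\<infinity>j\<in>{J..}. \<Sum>\<^sub>\<infinity>l\<in>idx (s j). \<Sum>\<^sub>\<infinity>k\<in>Zd. ennreal ((cmod (pair_fun f (fun_dil (N j) k (\<gamma> j l))))\<^sup>2))
     = (\<Sum>\<^sub>\<infinity>p\<in>frame_index (J - 1) (prepend J r s). ennreal (case p of (j, l, k) \<Rightarrow> g j l k))"
    by (simp add: g_def prepend_simps)
  show ?thesis unfolding eq
    by (subst infsum_ennreal_iff_has_sum[OF _ c]) (auto simp: g_def case_prod_unfold)
qed

lemma tight_prepend:
  fixes N :: "int \<Rightarrow> real^'d^'d::finite"
  shows "tight_wavelet_frame J N r \<Phi> s \<Psi> \<longleftrightarrow>
    (\<exists>\<gamma>. (\<forall>j\<ge>J - 1. \<forall>l\<in>idx (prepend J r s j). L2 (\<gamma> j l) \<and> represents (\<gamma> j l) (prepend J \<Phi> \<Psi> j l)) \<and>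
      (\<forall>f. L2 f \<longrightarrow> ((\<lambda>(j, l, k). (cmod (pair_fun f (fun_dil (prepend J (N J) N j) k (\<gamma> j l))))\<^sup>2)
         has_sum ((2 * pi) ^ CARD('d) * sqnorm f)) (frame_index (J - 1) (prepend J r s))))"
    (is "_ \<longleftrightarrow> (\<exists>\<gamma>. ?R \<gamma>)")
proof -
  let ?Q = "\<lambda>\<phi> \<psi>. (\<forall>l\<in>idx r. L2 (\<phi> l) \<and> represents (\<phi> l) (\<Phi> l)) \<and>
        (\<forall>j\<ge>J. \<forall>l\<in>idx (s j). L2 (\<psi> j l) \<and> represents (\<psi> j l) (\<Psi> j l)) \<and>
        (\<forall>f. L2 f \<longrightarrow>
           (\<Sum>\<^sub>\<infinity>l\<in>idx r. \<Sum>\<^sub>\<infinity>k\<in>Zd. ennreal ((cmod (pair_fun f (fun_dil (N J) k (\<phi> l))))\<^sup>2))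
           + (\<Sum>\<^sub>\<infinity>j\<in>{J..}. \<Sum>\<^sub>\<infinity>l\<in>idx (s j). \<Sum>\<^sub>\<infinity>k\<in>Zd.
                ennreal ((cmod (pair_fun f (fun_dil (N j) k (\<psi> j l))))\<^sup>2))
           = ennreal ((2 * pi) ^ CARD('d) * (LINT x|lebesgue. (cmod (f x))\<^sup>2)))"
  have RQ: "?R \<gamma> \<longleftrightarrow> ?Q (\<gamma> (J - 1)) \<gamma>" for \<gamma>
  proof -
    have c: "0 \<le> (2 * pi) ^ CARD('d) * sqnorm f" for f :: "'d cfun"
      by (intro mult_nonneg_nonneg zero_le_power sqnorm_nonneg) auto
    show ?thesis
      unfolding prepend_all frame_sum_prepend[OF c, symmetric] by (simp add: prepend_simps sqnorm_def cong: all_cong)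
  qed
  have Q_prepend: "?Q \<phi> \<psi> \<Longrightarrow> ?Q (prepend J \<phi> \<psi> (J - 1)) (prepend J \<phi> \<psi>)" for \<phi> \<psi>
  proof -
    assume Q: "?Q \<phi> \<psi>"
    have "(\<Sum>\<^sub>\<infinity>j\<in>{J..}. \<Sum>\<^sub>\<infinity>l\<in>idx (s j). \<Sum>\<^sub>\<infinity>k\<in>Zd. ennreal ((cmod (pair_fun f (fun_dil (N j) k (prepend J \<phi> \<psi> j l))))\<^sup>2))
      = (\<Sum>\<^sub>\<infinity>j\<in>{J..}. \<Sum>\<^sub>\<infinity>l\<in>idx (s j). \<Sum>\<^sub>\<infinity>k\<in>Zd. ennreal ((cmod (pair_fun f (fun_dil (N j) k (\<psi> j l))))\<^sup>2))" for f
      by (intro infsum_cong) (simp add: prepend_simps)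
    with Q show ?thesis by (simp add: prepend_simps)
  qed
  have "tight_wavelet_frame J N r \<Phi> s \<Psi> \<longleftrightarrow> (\<exists>\<phi> \<psi>. ?Q \<phi> \<psi>)"
    by (simp only: tight_wavelet_frame_def)
  also have "\<dots> \<longleftrightarrow> (\<exists>\<gamma>. ?Q (\<gamma> (J - 1)) \<gamma>)" using Q_prepend by blast
  also have "\<dots> \<longleftrightarrow> (\<exists>\<gamma>. ?R \<gamma>)" by (simp only: RQ)
  finally show ?thesis .
qed

lemma dual_prepend:
  fixes N :: "int \<Rightarrow> real^'d^'d::finite"
  shows "dual_wavelet_frames J N r \<Phi> \<Phi> s \<Psi> \<Psi> \<longleftrightarrow> dual_limit (J - 1) (prepend J (N J) N) (prepend J r s) (prepend J \<Phi> \<Psi>)"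
proof -
  let ?M = "prepend J (N J) N" and ?\<sigma> = "prepend J r s" and ?G = "prepend J \<Phi> \<Psi>"
  have ev: "\<forall>\<^sub>F J' in at_top. (\<Sum>j\<in>{J - 1..<J'}. \<Sum>\<^sub>\<infinity>p\<in>idx (?\<sigma> j) \<times> Zd. dual_term (?M j) (?G j) (?G j) f g p)
     = (\<Sum>\<^sub>\<infinity>p\<in>idx r \<times> Zd. dual_term (N J) \<Phi> \<Phi> f g p) + (\<Sum>j\<in>{J..<J'}. \<Sum>\<^sub>\<infinity>p\<in>idx (s j) \<times> Zd. dual_term (N j) (\<Psi> j) (\<Psi> j) f g p)" for f g
    using eventually_ge_at_top[of J]
  proof eventually_elim
    case (elim J')
    show ?case unfolding sum_prepend[OF elim] by (simp add: prepend_simps)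
  qed
  show ?thesis
    unfolding dual_wavelet_frames_def dual_limit_def prepend_all tendsto_cong[OF ev]
    by (simp add: prepend_simps cong: all_cong)
qed

lemma fiber_prepend:
  fixes N :: "int \<Rightarrow> real^'d^'d::finite"
  shows "fiber_conditions J N r \<phi> s \<psi> \<longleftrightarrow> fiber_limit (J - 1) (prepend J (N J) N) (prepend J r s) (prepend J \<phi> \<psi>)"
proof -
  have F: "fiber_sum (J - 1) (prepend J (N J) N) (prepend J r s) (prepend J \<phi> \<psi>) J' \<kappa> \<xi>
     = I_op r \<phi> (N J *v \<kappa>) (N J *v \<xi>) + (\<Sum>j\<in>{J..<J'}. I_op (s j) (\<psi> j) (N j *v \<kappa>) (N j *v \<xi>))" if "J \<le> J'" for J' \<kappa> \<xi>
    unfolding fiber_sum_def sum_prepend[OF that] by (simp add: prepend_simps)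
  have ev1: "\<forall>\<^sub>F J' in at_top. pair_fun (fiber_sum (J - 1) (prepend J (N J) N) (prepend J r s) (prepend J \<phi> \<psi>) J' 0) h
      = pair_fun (\<lambda>\<xi>. I_op r \<phi> 0 (N J *v \<xi>) + (\<Sum>j\<in>{J..<J'}. I_op (s j) (\<psi> j) 0 (N j *v \<xi>))) h" for h
    using eventually_ge_at_top[of J]
  proof eventually_elim
    case (elim J')
    have "fiber_sum (J - 1) (prepend J (N J) N) (prepend J r s) (prepend J \<phi> \<psi>) J' 0
      = (\<lambda>\<xi>. I_op r \<phi> 0 (N J *v \<xi>) + (\<Sum>j\<in>{J..<J'}. I_op (s j) (\<psi> j) 0 (N j *v \<xi>)))"
      by (rule ext) (simp add: F[OF elim])
    then show ?case by simp
  qed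
  have ev2: "\<forall>\<^sub>F J' in at_top. fiber_sum (J - 1) (prepend J (N J) N) (prepend J r s) (prepend J \<phi> \<psi>) J' \<kappa> \<xi>
      = I_op r \<phi> (N J *v \<kappa>) (N J *v \<xi>) + (\<Sum>j\<in>{J..<J'}. I_op (s j) (\<psi> j) (N j *v \<kappa>) (N j *v \<xi>))" for \<kappa> \<xi>
    using eventually_ge_at_top[of J] by eventually_elim (rule F)
  show ?thesis
    unfolding fiber_conditions_def fiber_limit_def Lam_prepend tendsto_cong[OF ev1] tendsto_cong[OF ev2] ..
qed

theorem corollary12:
  fixes J :: int
    and N :: "int \<Rightarrow> real ^ 'd ^ 'd::finite"
    and r :: enat and s :: "int \<Rightarrow> enat"
    and \<Phi> :: "nat \<Rightarrow> 'd functional"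
    and \<Psi> :: "int \<Rightarrow> nat \<Rightarrow> 'd functional"
  assumes "\<And>j. j \<ge> J \<Longrightarrow> invertible (N j)"
    and "\<And>l. l \<in> idx r \<Longrightarrow> distribution (\<Phi> l)"
    and "\<And>j l. j \<ge> J \<Longrightarrow> l \<in> idx (s j) \<Longrightarrow> distribution (\<Psi> j l)"
  shows "(tight_wavelet_frame J N r \<Phi> s \<Psi> \<longleftrightarrow> dual_wavelet_frames J N r \<Phi> \<Phi> s \<Psi> \<Psi>) \<and>
    (\<forall>\<phi> \<psi>.
      (\<forall>x. \<not> x islimpt Lam J N) \<longrightarrow>
      (\<forall>k\<in>Lam J N. ((\<lambda>j. norm (N j *v k)) \<longlongrightarrow> 0) at_top) \<longrightarrow>
      r \<noteq> \<infinity> \<longrightarrow> (\<forall>j\<ge>J. s j \<noteq> \<infinity>) \<longrightarrow>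
      (\<forall>l\<in>idx r. L2_loc (\<phi> l) \<and> represents (\<phi> l) (\<Phi> l)) \<longrightarrow>
      (\<forall>j\<ge>J. \<forall>l\<in>idx (s j). L2_loc (\<psi> j l) \<and> represents (\<psi> j l) (\<Psi> j l)) \<longrightarrow>
      (tight_wavelet_frame J N r \<Phi> s \<Psi> \<longleftrightarrow> fiber_conditions J N r \<phi> s \<psi>) \<and>
      (dual_wavelet_frames J N r \<Phi> \<Phi> s \<Psi> \<Psi> \<longleftrightarrow> fiber_conditions J N r \<phi> s \<psi>))"
proof -
  let ?M = "prepend J (N J) N" and ?\<sigma> = "prepend J r s" and ?G = "prepend J \<Phi> \<Psi>"
  have inv: "invertible (?M j)" if "j \<ge> J - 1" for j
    using that assms(1) by (auto simp: prepend_def)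
  have dist: "distribution (?G j l)" if "j \<ge> J - 1" "l \<in> idx (?\<sigma> j)" for j l
    using that assms(2,3) by (auto simp: prepend_def split: if_splits)
  have C: "0 \<le> (2 * pi) ^ CARD('d)" by simp
  have dual: "dual_wavelet_frames J N r \<Phi> \<Phi> s \<Psi> \<Psi> \<longleftrightarrow>
      (\<forall>f. test_fun f \<longrightarrow> ((\<lambda>p. (cmod (frame_coeff ?M ?G f p))\<^sup>2) has_sum ((2 * pi) ^ CARD('d) * sqnorm f)) (frame_index (J - 1) ?\<sigma>))"
    unfolding dual_prepend dual_limit_def by (rule dual_iff_test[OF inv dist C])
  have tight: "tight_wavelet_frame J N r \<Phi> s \<Psi> \<longleftrightarrow>
      (\<forall>f. test_fun f \<longrightarrow> ((\<lambda>p. (cmod (frame_coeff ?M ?G f p))\<^sup>2) has_sum ((2 * pi) ^ CARD('d) * sqnorm f)) (frame_index (J - 1) ?\<sigma>))"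
    unfolding tight_prepend by (rule tight_iff_test[OF inv dist C])
  have fiber: "dual_wavelet_frames J N r \<Phi> \<Phi> s \<Psi> \<Psi> \<longleftrightarrow> fiber_conditions J N r \<phi> s \<psi>"
    if discrete: "\<forall>x. \<not> x islimpt Lam J N" and contract: "\<forall>k\<in>Lam J N. ((\<lambda>j. norm (N j *v k)) \<longlongrightarrow> 0) at_top"
      and fin: "r \<noteq> \<infinity>" "\<forall>j\<ge>J. s j \<noteq> \<infinity>"
      and \<phi>: "\<forall>l\<in>idx r. L2_loc (\<phi> l) \<and> represents (\<phi> l) (\<Phi> l)"
      and \<psi>: "\<forall>j\<ge>J. \<forall>l\<in>idx (s j). L2_loc (\<psi> j l) \<and> represents (\<psi> j l) (\<Psi> j l)" for \<phi> \<psi>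
    unfolding dual_prepend fiber_prepend
  proof (rule fiber_limit_iff_dual_limit[symmetric])
    show "\<not> x islimpt Lam (J - 1) ?M" for x using discrete by (simp add: Lam_prepend)
    show "((\<lambda>j. norm (?M j *v k)) \<longlongrightarrow> 0) at_top" if "k \<in> Lam (J - 1) ?M" for k
    proof (rule Lim_transform_eventually)
      show "((\<lambda>j. norm (N j *v k)) \<longlongrightarrow> 0) at_top" using contract that by (simp add: Lam_prepend)
      show "\<forall>\<^sub>F j in at_top. norm (N j *v k) = norm (?M j *v k)"
        using eventually_ge_at_top[of J] by eventually_elim (simp add: prepend_simps)
    qed
    show "?\<sigma> j \<noteq> \<infinity>" if "j \<ge> J - 1" for j using fin by (auto simp: prepend_def)
    show "L2_loc (prepend J \<phi> \<psi> j l) \<and> represents (prepend J \<phi> \<psi> j l) (?G j l)" if "j \<ge> J - 1" "l \<in> idx (?\<sigma> j)" for j l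
      using that \<phi> \<psi> by (auto simp: prepend_def split: if_splits)
  qed (rule inv)
  show ?thesis using dual tight fiber by blast
qed

end
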